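(* Consider the game, with agents $i\in\mathcal I=\{1,\dots,N\}$, described in the context, and suppose that: (1) for each $i\in\mathcal I$, $\Omega_i\subseteq\mathbb R^{n_i}$ is closed and convex; $g_i:\mathbb R^{n_i}\to\mathbb R^m$ is componentwise convex and twice continuously differentiable; the set $\mathcal X=\Omega\cap\{x\in\mathbb R^n\mid g(x)\le \mathbf 0_m\}$ satisfies Slater's constraint qualification; $J_i$ is continuously differentiable and $J_i(\cdot,x_{-i})$ is convex for every $x_{-i}$; (2) the pseudo-gradient $F$ is $\mu$-strongly monotone for some $\mu>0$ and $\theta_0$-Lipschitz continuous for some $\theta_0>0$; (3) the communication graph $\mathcal G(\mathcal I,\mathcal E)$ is undirected and connected. Let $\theta\in[\mu,\theta_0]$ be a Lipschitz constant of the extended pseudo-gradient $\boldsymbol F$, and let $$c>\underline c:=\frac{(\theta_0+\theta)^2+4\mu\theta}{4\mu\lambda_2(L)}.$$ Consider the projected dynamical system in the variables $\mathrm{col}(\boldsymbol x,\boldsymbol z,\boldsymbol\lambda)\in\mathbb R^{Nn}\times\mathbb R^{Nm}\times\mathbb R^{Nm}$: $$\begin{aligned} \dot{\boldsymbol x}&=\Pi_{\boldsymbol\Omega}\big(\boldsymbol x,\,-\mathcal R^\top(\boldsymbol F(\boldsymbol x)+\mathbb G(\mathcal R\boldsymbol x)^\top\boldsymbol\lambda)-c\boldsymbol L_n\boldsymbol x\big),\\ \dot{\boldsymbol z}&=\boldsymbol L_m\boldsymbol\lambda,\\ \dot{\boldsymbol\lambda}&=\Pi_{\mathbb R^{Nm}_{\ge0}}\big(\boldsymbol\lambda,\,\boldsymbol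 g(\mathcal R\boldsymbol x)-\boldsymbol z-\boldsymbol L_m\boldsymbol\lambda\big). \end{aligned}$$ Then, for any initial condition in $S=\boldsymbol\Omega\times\boldsymbol E_m^\perp\times\mathbb R^{mN}_{\ge0}$, the system has a unique Carathéodory solution (on $[0,\infty)$), which belongs to $S$ for all $t\ge0$. The solution converges to an equilibrium $\mathrm{col}(\bar{\boldsymbol x},\bar{\boldsymbol z},\bar{\boldsymbol\lambda})$ with $\bar{\boldsymbol x}=\mathbf 1_N\otimes x^*$, $\bar{\boldsymbol\lambda}=\mathbf 1_N\otimes\lambda^*$, where $(x^*,\lambda^* )\in\mathbb R^n\times\mathbb R^m$ satisfies the KKT conditions $$\mathbf 0_n\in F(x^* )+\tfrac{\partial}{\partial x}g(x^* )^\top\lambda^*+\mathrm N_\Omega(x^* ),\qquad \mathbf 0_m\in -g(x^* )+\mathrm N_{\mathbb R^m_{\ge0}}(\lambda^* );$$ hence $x^*$ is the variational generalized Nash equilibrium (v-GNE) of the game.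
   Context: Game. Agent $i$ chooses $x_i\in\Omega_i\subseteq\mathbb R^{n_i}$; $n=\sum_i n_i$, $x=\mathrm{col}((x_i)_{i\in\mathcal I})$ (stacking), $x_{-i}=\mathrm{col}((x_j)_{j\ne i})$, $\Omega=\times_i\Omega_i\subseteq\mathbb R^n$. Agent $i$ has cost $J_i(x_i,x_{-i})\in\mathbb R$. The coupling constraints are $g(x):=\sum_{i}g_i(x_i)\le\mathbf 0_m$, with $g_i:\mathbb R^{n_i}\to\mathbb R^m$, and $\mathcal X=\Omega\cap\{x\mid g(x)\le\mathbf 0_m\}$. A generalized Nash equilibrium (GNE) is $x^*$ such that, for all $i$, $x_i^*\in\operatorname{argmin}_{y_i}J_i(y_i,x_{-i}^* )$ subject to $(y_i,x_{-i}^* )\in\mathcal X$. A v-GNE is a GNE whose individual KKT systems hold with equal dual variables for all agents, i.e. $x^*$ for which there is $\lambda^*$ such that $(x^*,\lambda^* )$ satisfies the KKT conditions displayed in the claim. Pseudo-gradient: $F(x):=\mathrm{col}((\nabla_{x_i}J_i(x_i,x_{-i}))_{i\in\mathcal I})$. $F$ is $\mu$-strongly monotone if $(F(x)-F(y))^\top(x-y)\ge\mu\|x-y\|^2$ for all $x,y$. Graph: $W$ is the symmetric adjacency matrix of $\mathcal G$ ($[W]_{i,j}=1$ if $(i,j)\in\mathcal E$, $0$ otherwise), $L$ its symmetric Laplacian, $\lambda_2(L)$ the second smallest eigenvalue of $L$; $\boldsymbol L_q:=L\otimes I_q$. Stacked variables: each agent $i$ holds $\boldsymbol x^i=\mathrm{col}((\boldsymbol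 x^i_j)_{j\in\mathcal I})\in\mathbb R^n$ with $\boldsymbol x^i_i=x_i$ and, for $j\neq i$, $\boldsymbol x^i_j\in\mathbb R^{n_j}$ an estimate of $x_j$; $\boldsymbol x^i_{-i}=\mathrm{col}((\boldsymbol x^i_j)_{j\neq i})$; $\boldsymbol x=\mathrm{col}((\boldsymbol x^i)_i)\in\mathbb R^{Nn}$; $\boldsymbol z=\mathrm{col}((z_i)_i)$, $\boldsymbol\lambda=\mathrm{col}((\lambda_i)_i)\in\mathbb R^{Nm}$. $\mathcal R:=\mathrm{diag}((\mathcal R_i)_i)$ (block diagonal), where $\mathcal R_i\in\mathbb R^{n_i\times n}$ selects the $i$-th block, so $\mathcal R_i\boldsymbol x^i=x_i$ and $\mathcal R\boldsymbol x=x$. $\boldsymbol\Omega:=\{\boldsymbol x\in\mathbb R^{Nn}\mid\mathcal R\boldsymbol x\in\Omega\}$. Extended pseudo-gradient: $\boldsymbol F(\boldsymbol x):=\mathrm{col}((\nabla_{x_i}J_i(x_i,\boldsymbol x^i_{-i}))_i)$; under hypothesis (2) it is $\theta$-Lipschitz for some $\theta\in[\mu,\theta_0]$. $\boldsymbol g(x):=\mathrm{col}((g_i(x_i))_i)$, $\mathbb G(x):=\frac{\partial}{\partial x}\boldsymbol g(x)=\mathrm{diag}((\frac{\partial}{\partial x_i}g_i(x_i))_i)$. $\boldsymbol E_q:=\{\mathbf 1_N\otimes y\mid y\in\mathbb R^q\}$, $\boldsymbol E_q^\perp:=\{\boldsymbol y\in\mathbb R^{Nq}\mid(\mathbf 1_N^\top\otimes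 I_q)\boldsymbol y=\mathbf 0_q\}$. Convex analysis: for closed convex $S$, $\mathrm N_S(x)=\{v\mid\sup_{z\in S}v^\top(z-x)\le0\}$ is the normal cone, $\mathrm T_S(x)=\mathrm{cl}(\bigcup_{\delta>0}\frac1\delta(S-x))$ the tangent cone, and $\Pi_S(x,v):=\mathrm{proj}_{\mathrm T_S(x)}(v)$ (Euclidean projection). A Carathéodory solution is an absolutely continuous function with the given initial value satisfying the differential equation for almost all $t\ge0$. An equilibrium is a point where the right-hand side vanishes. *)

theory Defs
  imports "HOL-Analysis.Analysis" "HOL-Library.Set_Algebras"
begin

section \<open>Convex analysis\<close>

(* N_S has domain S: it is empty at points outside S. *)
definition normal_cone :: "'a::real_inner set \<Rightarrow> 'a \<Rightarrow> 'a set" where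
  "normal_cone S x = {v. x \<in> S \<and> (\<forall>z\<in>S. v \<bullet> (z - x) \<le> 0)}"

definition tangent_cone :: "'a::real_normed_vector set \<Rightarrow> 'a \<Rightarrow> 'a set" where
  "tangent_cone S x = closure (\<Union>\<delta>\<in>{0<..}. (\<lambda>z. (1 / \<delta>) *\<^sub>R (z - x)) ` S)"

definition proj_vec :: "'a::euclidean_space set \<Rightarrow> 'a \<Rightarrow> 'a \<Rightarrow> 'a" where
  "proj_vec S x v = closest_point (tangent_cone S x) v"

definition strongly_monotone :: "real \<Rightarrow> ('a::real_inner \<Rightarrow> 'a) \<Rightarrow> bool" where
  "strongly_monotone \<mu> F \<longleftrightarrow> (\<forall>x y. (F x - F y) \<bullet> (x - y) \<ge> \<mu> * (norm (x - y))\<^sup>2)"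

definition nonneg_orthant :: "'a::{zero,ord} set" where
  "nonneg_orthant = {l. 0 \<le> l}"


section \<open>Smoothness\<close>

definition C1_fun :: "('a::real_normed_vector \<Rightarrow> 'b::real_normed_vector) \<Rightarrow> bool" where
  "C1_fun f \<longleftrightarrow> (\<exists>f' :: 'a \<Rightarrow> 'a \<Rightarrow>\<^sub>L 'b.
     (\<forall>x. (f has_derivative blinfun_apply (f' x)) (at x)) \<and> continuous_on UNIV f')"

definition C2_fun :: "('a::real_normed_vector \<Rightarrow> 'b::real_normed_vector) \<Rightarrow> bool" where
  "C2_fun f \<longleftrightarrow> (\<exists>f' :: 'a \<Rightarrow> 'a \<Rightarrow>\<^sub>L 'b.
     (\<forall>x. (f has_derivative blinfun_apply (f' x)) (at x)) \<and> C1_fun f')"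

definition gradient :: "('a::real_inner \<Rightarrow> real) \<Rightarrow> 'a \<Rightarrow> 'a" where
  "gradient f x = (THE D. GDERIV f x :> D)"


section \<open>Caratheodory solutions on the half-line\<close>

(* A division D of d is a finite family of compact intervals with disjoint interiors and union d. *)
definition abs_continuous_on :: "real \<Rightarrow> real \<Rightarrow> (real \<Rightarrow> 'a::real_normed_vector) \<Rightarrow> bool" where
  "abs_continuous_on a b f \<longleftrightarrow>
     (\<forall>\<epsilon>>0. \<exists>\<delta>>0. \<forall>D d. D division_of d \<and> d \<subseteq> {a..b} \<and> (\<Sum>K\<in>D. Sup K - Inf K) < \<delta> \<longrightarrow>
        (\<Sum>K\<in>D. norm (f (Sup K) - f (Inf K))) < \<epsilon>)"

(* Absolute continuity on the unbounded interval [0,\<infinity>) is meant on compact subintervals. *)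
definition caratheodory_solution ::
  "('a::real_normed_vector \<Rightarrow> 'a) \<Rightarrow> 'a \<Rightarrow> (real \<Rightarrow> 'a) \<Rightarrow> bool" where
  "caratheodory_solution f w0 \<omega> \<longleftrightarrow>
     \<omega> 0 = w0 \<and>
     (\<forall>T>0. abs_continuous_on 0 T \<omega>) \<and>
     (AE t in lebesgue. 0 \<le> t \<longrightarrow>
        (\<omega> has_vector_derivative f (\<omega> t)) (at t within {0..}))"


section \<open>Graphs\<close>

(* Self-loops, if any, cancel in the Laplacian. *)
definition adjacency_matrix :: "('i::finite \<times> 'i) set \<Rightarrow> real^'i^'i" where
  "adjacency_matrix E = (\<chi> i j. if (i, j) \<in> E then 1 else 0)"

definition laplacian :: "('i::finite \<times> 'i) set \<Rightarrow> real^'i^'i" where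
  "laplacian E = (\<chi> i j. (if i = j then \<Sum>k\<in>UNIV. adjacency_matrix E $ i $ k else 0)
                          - adjacency_matrix E $ i $ j)"

definition graph_connected :: "('i \<times> 'i) set \<Rightarrow> bool" where
  "graph_connected E \<longleftrightarrow> (\<forall>i j. (i, j) \<in> E\<^sup>*)"

definition eigenspace :: "real^'i^'i \<Rightarrow> real \<Rightarrow> (real^'i) set" where
  "eigenspace A s = {v. A *v v = s *\<^sub>R v}"

definition is_eigenvalue :: "real^'i^'i \<Rightarrow> real \<Rightarrow> bool" where
  "is_eigenvalue A s \<longleftrightarrow> (\<exists>v\<in>eigenspace A s. v \<noteq> 0)"

(* Eigenvalues of a symmetric matrix, counted with multiplicity.  For a 1 x 1 matrix there is no
   second eigenvalue and the value is unspecified; for one agent the Laplacian vanishes, so that a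
   gain bounded below in terms of this value does not affect the dynamics. *)
definition lambda2 :: "real^'i^'i \<Rightarrow> real" where
  "lambda2 A = (LEAST t. is_eigenvalue A t \<and>
     2 \<le> (\<Sum>s\<in>{s. is_eigenvalue A s \<and> s \<le> t}. dim (eigenspace A s)))"

(* (A \<otimes> B) v, where v = col(v_j) is represented by the family of its blocks. *)
definition kron_apply :: "real^'i^'j \<Rightarrow> real^'p^'q \<Rightarrow> real^'p^'i \<Rightarrow> real^'q^'j" where
  "kron_apply A B v = (\<chi> i. \<Sum>j\<in>UNIV. A $ i $ j *\<^sub>R (B *v (v $ j)))"

definition stacked_laplacian :: "('i::finite \<times> 'i) set \<Rightarrow> real^'q^'i \<Rightarrow> real^'q^'i" where
  "stacked_laplacian E v = kron_apply (laplacian E) (mat 1) v"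

(* 1_N \<otimes> y *)
definition replicate_vec :: "'a \<Rightarrow> 'a^'i" where
  "replicate_vec y = (\<chi> i. y)"

(* (1_N^T \<otimes> I_q) y is the sum of the blocks of y. *)
definition consensus_perp :: "(real^'q^'i) set" where
  "consensus_perp = {y. (\<Sum>i\<in>UNIV. y $ i) = 0}"


section \<open>The game\<close>

text \<open>
  The agents are the elements of a finite type \<^typ>\<open>'i\<close>, so that N is its cardinality.  The n
  coordinates of the joint action space, of type \<^typ>\<open>real^'n\<close>, are distributed among the agents by
  a map \<open>own\<close>: coordinate k belongs to agent \<open>own k\<close>, and agent i has n_i = card {k. own k = i}
  coordinates, so the n_i are arbitrary and may differ.  The space of actions of agent i is
  represented isometrically by the vectors that vanish on the coordinates of all other agents.
  An element \<open>bx\<close> of \<^typ>\<open>real^'n^'i\<close> is a stacked vector of estimates: \<open>bx $ i\<close> is the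
  vector held by agent i, whose own block is the action of agent i.
\<close>

definition agent_space :: "('n::finite \<Rightarrow> 'i) \<Rightarrow> 'i \<Rightarrow> (real^'n) set" where
  "agent_space own i = {u. \<forall>k. own k \<noteq> i \<longrightarrow> u $ k = 0}"

(* x_i *)
definition blk :: "('n::finite \<Rightarrow> 'i) \<Rightarrow> 'i \<Rightarrow> real^'n \<Rightarrow> real^'n" where
  "blk own i x = (\<chi> k. if own k = i then x $ k else 0)"

(* (u, x_{-i}) *)
definition subst_blk :: "('n::finite \<Rightarrow> 'i) \<Rightarrow> 'i \<Rightarrow> real^'n \<Rightarrow> real^'n \<Rightarrow> real^'n" where
  "subst_blk own i u x = (\<chi> k. if own k = i then u $ k else x $ k)"

(* col((u_i)_i) for u_i in the space of agent i *)
definition col :: "('n::finite \<Rightarrow> 'i) \<Rightarrow> ('i \<Rightarrow> real^'n) \<Rightarrow> real^'n" where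
  "col own u = (\<chi> k. u (own k) $ k)"

definition joint_set :: "('n::finite \<Rightarrow> 'i) \<Rightarrow> ('i \<Rightarrow> (real^'n) set) \<Rightarrow> (real^'n) set" where
  "joint_set own \<Omega> = {x. \<forall>i. blk own i x \<in> \<Omega> i}"

(* The functions g_i are only ever evaluated on the space of agent i. *)
definition coupling ::
  "('n::finite \<Rightarrow> 'i::finite) \<Rightarrow> ('i \<Rightarrow> real^'n \<Rightarrow> real^'m) \<Rightarrow> real^'n \<Rightarrow> real^'m" where
  "coupling own g x = (\<Sum>i\<in>UNIV. g i (blk own i x))"

definition stacked_g ::
  "('n::finite \<Rightarrow> 'i::finite) \<Rightarrow> ('i \<Rightarrow> real^'n \<Rightarrow> real^'m) \<Rightarrow> real^'n \<Rightarrow> real^'m^'i" where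
  "stacked_g own g x = (\<chi> i. g i (blk own i x))"

definition feasible_set ::
  "('n::finite \<Rightarrow> 'i::finite) \<Rightarrow> ('i \<Rightarrow> (real^'n) set) \<Rightarrow> ('i \<Rightarrow> real^'n \<Rightarrow> real^'m) \<Rightarrow> (real^'n) set" where
  "feasible_set own \<Omega> g = joint_set own \<Omega> \<inter> {x. coupling own g x \<le> 0}"

(* The order on vectors is componentwise, but "<" on vectors is not, hence the quantifier. *)
definition slater ::
  "('n::finite \<Rightarrow> 'i::finite) \<Rightarrow> ('i \<Rightarrow> (real^'n) set) \<Rightarrow> ('i \<Rightarrow> real^'n \<Rightarrow> real^'m) \<Rightarrow> bool" where
  "slater own \<Omega> g \<longleftrightarrow> (\<exists>x\<in>joint_set own \<Omega>. \<forall>k. coupling own g x $ k < 0)"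

(* \<nabla>_{x_i} f(x_i, x_{-i}) *)
definition partial_gradient ::
  "('n::finite \<Rightarrow> 'i) \<Rightarrow> 'i \<Rightarrow> (real^'n \<Rightarrow> real) \<Rightarrow> real^'n \<Rightarrow> real^'n" where
  "partial_gradient own i f x = blk own i (gradient f x)"

definition pseudo_gradient ::
  "('n::finite \<Rightarrow> 'i) \<Rightarrow> ('i \<Rightarrow> real^'n \<Rightarrow> real) \<Rightarrow> real^'n \<Rightarrow> real^'n" where
  "pseudo_gradient own J x = col own (\<lambda>i. partial_gradient own i (J i) x)"

definition ext_pseudo_gradient ::
  "('n::finite \<Rightarrow> 'i::finite) \<Rightarrow> ('i \<Rightarrow> real^'n \<Rightarrow> real) \<Rightarrow> real^'n^'i \<Rightarrow> real^'n" where
  "ext_pseudo_gradient own J bx = col own (\<lambda>i. partial_gradient own i (J i) (bx $ i))"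

(* The block-diagonal matrix diag((R_i)_i), as a linear map *)
definition sel :: "('n::finite \<Rightarrow> 'i::finite) \<Rightarrow> real^'n^'i \<Rightarrow> real^'n" where
  "sel own bx = col own (\<lambda>i. blk own i (bx $ i))"

lemma adjoint_sel: "adjoint (sel own) = (\<lambda>y. \<chi> i. blk own i y)"
proof (rule adjoint_unique, intro allI)
  fix bx :: "real^'a^'b" and y :: "real^'a"
  have "(\<Sum>k\<in>UNIV. bx $ own k $ k * y $ k)
      = (\<Sum>k\<in>UNIV. \<Sum>i\<in>UNIV. bx $ i $ k * (if own k = i then y $ k else 0))"
    by (simp add: if_distrib [of "\<lambda>z. _ * z"] cong: if_cong)
  also have "\<dots> = (\<Sum>i\<in>UNIV. \<Sum>k\<in>UNIV. bx $ i $ k * (if own k = i then y $ k else 0))"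
    by (rule sum.swap)
  finally show "sel own bx \<bullet> y = bx \<bullet> (\<chi> i. blk own i y)"
    by (simp add: inner_vec_def sel_def col_def blk_def)
qed

definition is_GNE ::
  "('n::finite \<Rightarrow> 'i::finite) \<Rightarrow> ('i \<Rightarrow> (real^'n) set) \<Rightarrow> ('i \<Rightarrow> real^'n \<Rightarrow> real^'m) \<Rightarrow>
   ('i \<Rightarrow> real^'n \<Rightarrow> real) \<Rightarrow> real^'n \<Rightarrow> bool" where
  "is_GNE own \<Omega> g J x \<longleftrightarrow>
     (\<forall>i. is_arg_min (\<lambda>u. J i (subst_blk own i u x))
            (\<lambda>u. u \<in> agent_space own i \<and> subst_blk own i u x \<in> feasible_set own \<Omega> g)
            (blk own i x))"

(* Transposed Jacobians are written as adjoints of Frechet derivatives. *)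
definition KKT ::
  "('n::finite \<Rightarrow> 'i::finite) \<Rightarrow> ('i \<Rightarrow> (real^'n) set) \<Rightarrow> ('i \<Rightarrow> real^'n \<Rightarrow> real^'m) \<Rightarrow>
   ('i \<Rightarrow> real^'n \<Rightarrow> real) \<Rightarrow> real^'n \<Rightarrow> real^'m \<Rightarrow> bool" where
  "KKT own \<Omega> g J x l \<longleftrightarrow>
     0 \<in> (pseudo_gradient own J x + adjoint (frechet_derivative (coupling own g) (at x)) l)
           +o normal_cone (joint_set own \<Omega>) x \<and>
     0 \<in> (- coupling own g x) +o normal_cone nonneg_orthant l"

definition is_vGNE ::
  "('n::finite \<Rightarrow> 'i::finite) \<Rightarrow> ('i \<Rightarrow> (real^'n) set) \<Rightarrow> ('i \<Rightarrow> real^'n \<Rightarrow> real^'m) \<Rightarrow>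
   ('i \<Rightarrow> real^'n \<Rightarrow> real) \<Rightarrow> real^'n \<Rightarrow> bool" where
  "is_vGNE own \<Omega> g J x \<longleftrightarrow> is_GNE own \<Omega> g J x \<and> (\<exists>l. KKT own \<Omega> g J x l)"


section \<open>The projected dynamics\<close>

definition stacked_set ::
  "('n::finite \<Rightarrow> 'i::finite) \<Rightarrow> ('i \<Rightarrow> (real^'n) set) \<Rightarrow> (real^'n^'i) set" where
  "stacked_set own \<Omega> = {bx. sel own bx \<in> joint_set own \<Omega>}"

definition closed_loop ::
  "('n::finite \<Rightarrow> 'i::finite) \<Rightarrow> ('i \<Rightarrow> (real^'n) set) \<Rightarrow> ('i \<Rightarrow> real^'n \<Rightarrow> real^'m) \<Rightarrow>
   ('i \<Rightarrow> real^'n \<Rightarrow> real) \<Rightarrow> ('i \<times> 'i) set \<Rightarrow> real \<Rightarrow>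
   (real^'n^'i) \<times> (real^'m^'i) \<times> (real^'m^'i) \<Rightarrow> (real^'n^'i) \<times> (real^'m^'i) \<times> (real^'m^'i)" where
  "closed_loop own \<Omega> g J E c = (\<lambda>(bx, z, l).
     (proj_vec (stacked_set own \<Omega>) bx
        (- adjoint (sel own)
             (ext_pseudo_gradient own J bx
              + adjoint (frechet_derivative (stacked_g own g) (at (sel own bx))) l)
         - c *\<^sub>R stacked_laplacian E bx),
      stacked_laplacian E l,
      proj_vec nonneg_orthant l
        (stacked_g own g (sel own bx) - z - stacked_laplacian E l)))"

end

theory Submission
  imports Defs "HOL-Complex_Analysis.Great_Picard"
begin

text \<open>
  The closed loop is a projected dynamical system \<open>w' = proj_vec K w (f w)\<close> with \<open>K\<close> closed and convex
  and \<open>f\<close> locally Lipschitz.  For \<open>f\<close> Lipschitz and bounded, projected Euler polygons converge to a solution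
  whose right derivative is the projected field at every time.  Its flow expands distances at most
  exponentially, so the speed is, up to an exponential factor, nonincreasing in time; hence it is continuous
  outside a countable set, and there the solution is differentiable.  No differentiation theorem for Lipschitz
  functions is needed.

  In the quadratic form \<open>|x|^2 + z \<bullet> P z + |l|^2\<close>, with \<open>P\<close> inverting the Laplacian on the vectors of zero
  sum, the distance to any equilibrium is nonincreasing: splitting the estimates \<open>x\<close> into
  their mean and a disagreement, the gain bound makes the quadratic form in the two norms positive definite,
  and convexity of the constraints makes the primal-dual coupling monotone.  This also keeps solutions in a ball,
  where \<open>f\<close> may be truncated.  An invariance argument on the limit set, where only \<open>z\<close> and \<open>l\<close> vary, yields
  an equilibrium in it, and then convergence.
\<close>

section \<open>Absolutely continuous functions\<close>

text \<open>The projected field may jump at the boundary of \<open>K\<close>, so existence theorems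
  for continuous right-hand sides do not apply. What survives is that
  \<open>f x - proj_vec K x (f x)\<close> is a normal vector and normal cones are monotone, so the
  field is one-sided Lipschitz.

  The weight \<open>P\<close> is dictated by the multipliers. Since \<open>P\<close> composed with
  the Laplacian is the projection onto zero-sum vectors, the equation z' = L l contributes exactly
  the product (z - ze) . (l - le) that the equation for l subtracts. The cancellation uses that z
  and ze both have zero sum.

  Nothing in this form decreases strictly in z, and nothing singles out one equilibrium in z and l.
  A Lyapunov function centered at an equilibrium given in advance therefore yields only boundedness
  and the shape of the limit set; the center has to be moved to an equilibrium found inside that
  set.

  Uniqueness ranges over all Caratheodory solutions, which are not assumed to respect the
  constraints, whereas the monotonicity of \<open>proj_vec\<close> is available only between points
  of the set. Invariance thus has to be shown for an arbitrary solution first.\<close>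

lemma abs_continuous_onE:
  assumes "abs_continuous_on a b f" "\<epsilon> > 0"
  obtains \<delta> where "\<delta> > 0" "\<And>D d. D division_of d \<Longrightarrow> d \<subseteq> {a..b} \<Longrightarrow> (\<Sum>K\<in>D. Sup K - Inf K) < \<delta> \<Longrightarrow>
        (\<Sum>K\<in>D. norm (f (Sup K) - f (Inf K))) < \<epsilon>"
  using assms unfolding abs_continuous_on_def by meson

lemma abs_continuous_on_uniform:
  assumes "abs_continuous_on a b f" "\<epsilon> > 0"
  obtains \<delta> where "\<delta> > 0" "\<And>s t. a \<le> s \<Longrightarrow> s \<le> t \<Longrightarrow> t \<le> b \<Longrightarrow> t - s < \<delta> \<Longrightarrow> norm (f t - f s) < \<epsilon>"
proof -
  obtain \<delta> where \<delta>: "\<delta> > 0" "\<And>D d. D division_of d \<Longrightarrow> d \<subseteq> {a..b} \<Longrightarrow> (\<Sum>K\<in>D. Sup K - Inf K) < \<delta> \<Longrightarrow>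
        (\<Sum>K\<in>D. norm (f (Sup K) - f (Inf K))) < \<epsilon>"
    using abs_continuous_onE [OF assms] by blast
  show thesis
  proof
    fix s t assume st: "a \<le> s" "s \<le> t" "t \<le> b" "t - s < \<delta>"
    have "{{s..t}} division_of {s..t}"
      using division_of_self [of s t] st by (auto simp: cbox_interval)
    from \<delta>(2) [OF this] st show "norm (f t - f s) < \<epsilon>" by auto
  qed (rule \<delta>)
qed

lemma abs_continuous_on_imp_continuous:
  assumes "abs_continuous_on a b f"
  shows "continuous_on {a..b} f"
  unfolding continuous_on_iff
proof (intro ballI allI impI)
  fix x e :: real assume x: "x \<in> {a..b}" and e: "e > 0"
  obtain \<delta> where \<delta>: "\<delta> > 0" "\<And>s t. a \<le> s \<Longrightarrow> s \<le> t \<Longrightarrow> t \<le> b \<Longrightarrow> t - s < \<delta> \<Longrightarrow> norm (f t - f s) < e"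
    using abs_continuous_on_uniform [OF assms e] by blast
  have "dist (f y) (f x) < e" if "y \<in> {a..b}" "dist y x < \<delta>" for y
    using \<delta>(2) [of x y] \<delta>(2) [of y x] that x
    by (cases "x \<le> y") (auto simp: dist_norm norm_minus_commute)
  then show "\<exists>d>0. \<forall>x'\<in>{a..b}. dist x' x < d \<longrightarrow> dist (f x') (f x) < e"
    using \<delta>(1) by blast
qed

lemma division_of_endpoints:
  fixes D :: "real set set"
  assumes "D division_of d" "d \<subseteq> {a..b}" "K \<in> D"
  shows "Inf K \<le> Sup K" "a \<le> Inf K" "Sup K \<le> b" "K = {Inf K..Sup K}"
proof -
  obtain u v where uv: "K = cbox u v" using assms division_ofD(4) by blast
  have "K \<noteq> {}" "K \<subseteq> {a..b}" using assms division_ofD(2,3) by blast+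
  with uv show "Inf K \<le> Sup K" "a \<le> Inf K" "Sup K \<le> b" "K = {Inf K..Sup K}"
    by (auto simp: cbox_interval)
qed

text \<open>The summand \<open>t - s\<close> absorbs factors that are Lipschitz in time, such as
  exponential weights; with \<psi> constant only that summand remains and Lipschitz functions
  result.\<close>

lemma abs_continuous_on_dominated:
  fixes f :: "real \<Rightarrow> 'a::real_normed_vector" and \<psi> :: "real \<Rightarrow> 'b::real_normed_vector"
  assumes \<psi>: "abs_continuous_on a b \<psi>" and C: "C \<ge> 0"
    and dom: "\<And>s t. a \<le> s \<Longrightarrow> s \<le> t \<Longrightarrow> t \<le> b \<Longrightarrow> norm (f t - f s) \<le> C * (t - s + norm (\<psi> t - \<psi> s))"
  shows "abs_continuous_on a b f"
  unfolding abs_continuous_on_def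
proof (intro allI impI)
  fix e :: real assume e: "e > 0"
  define e' where "e' = e / (2 * (C + 1))"
  have e': "e' > 0" using e C by (simp add: e'_def)
  obtain \<delta> where \<delta>: "\<delta> > 0" "\<And>D d. D division_of d \<Longrightarrow> d \<subseteq> {a..b} \<Longrightarrow> (\<Sum>K\<in>D. Sup K - Inf K) < \<delta> \<Longrightarrow>
        (\<Sum>K\<in>D. norm (\<psi> (Sup K) - \<psi> (Inf K))) < e'"
    using abs_continuous_onE [OF \<psi> e'] by blast
  show "\<exists>\<delta>>0. \<forall>D d. D division_of d \<and> d \<subseteq> {a..b} \<and> (\<Sum>K\<in>D. Sup K - Inf K) < \<delta> \<longrightarrow>
        (\<Sum>K\<in>D. norm (f (Sup K) - f (Inf K))) < e"
  proof (intro exI conjI allI impI)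
    show "min \<delta> e' > 0" using \<delta> e' by simp
    fix D d assume D: "D division_of d \<and> d \<subseteq> {a..b} \<and> (\<Sum>K\<in>D. Sup K - Inf K) < min \<delta> e'"
    have "(\<Sum>K\<in>D. norm (f (Sup K) - f (Inf K)))
        \<le> (\<Sum>K\<in>D. C * (Sup K - Inf K + norm (\<psi> (Sup K) - \<psi> (Inf K))))"
      using D by (intro sum_mono dom) (auto dest: division_of_endpoints)
    also have "\<dots> = C * ((\<Sum>K\<in>D. Sup K - Inf K) + (\<Sum>K\<in>D. norm (\<psi> (Sup K) - \<psi> (Inf K))))"
      by (simp add: sum_distrib_left [symmetric] sum.distrib)
    also have "\<dots> \<le> C * (e' + e')"
      using D \<delta>(2) [of D d] C by (intro mult_left_mono add_mono) auto
    also have "\<dots> < (C + 1) * (e' + e')" using e' C by simp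
    also have "\<dots> = e" using C unfolding e'_def by (simp add: divide_simps)
    finally show "(\<Sum>K\<in>D. norm (f (Sup K) - f (Inf K))) < e" .
  qed
qed

lemma abs_continuous_on_diff:
  assumes f: "abs_continuous_on a b f" and h: "abs_continuous_on a b h"
  shows "abs_continuous_on a b (\<lambda>t. f t - h t)"
  unfolding abs_continuous_on_def
proof (intro allI impI)
  fix e :: real assume e: "e > 0"
  obtain \<delta> where \<delta>: "\<delta> > 0" "\<And>D d. D division_of d \<Longrightarrow> d \<subseteq> {a..b} \<Longrightarrow> (\<Sum>K\<in>D. Sup K - Inf K) < \<delta> \<Longrightarrow>
        (\<Sum>K\<in>D. norm (f (Sup K) - f (Inf K))) < e / 2"
    using abs_continuous_onE [OF f half_gt_zero [OF e]] by blast
  obtain \<eta> where \<eta>: "\<eta> > 0" "\<And>D d. D division_of d \<Longrightarrow> d \<subseteq> {a..b} \<Longrightarrow> (\<Sum>K\<in>D. Sup K - Inf K) < \<eta> \<Longrightarrow>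
        (\<Sum>K\<in>D. norm (h (Sup K) - h (Inf K))) < e / 2"
    using abs_continuous_onE [OF h half_gt_zero [OF e]] by blast
  show "\<exists>\<delta>>0. \<forall>D d. D division_of d \<and> d \<subseteq> {a..b} \<and> (\<Sum>K\<in>D. Sup K - Inf K) < \<delta> \<longrightarrow>
        (\<Sum>K\<in>D. norm (f (Sup K) - h (Sup K) - (f (Inf K) - h (Inf K)))) < e"
  proof (intro exI conjI allI impI)
    show "min \<delta> \<eta> > 0" using \<delta> \<eta> by simp
    fix D d assume D: "D division_of d \<and> d \<subseteq> {a..b} \<and> (\<Sum>K\<in>D. Sup K - Inf K) < min \<delta> \<eta>"
    have "(\<Sum>K\<in>D. norm (f (Sup K) - h (Sup K) - (f (Inf K) - h (Inf K))))
        \<le> (\<Sum>K\<in>D. norm (f (Sup K) - f (Inf K)) + norm (h (Sup K) - h (Inf K)))"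
    proof (rule sum_mono)
      fix K
      have "f (Sup K) - h (Sup K) - (f (Inf K) - h (Inf K)) = (f (Sup K) - f (Inf K)) - (h (Sup K) - h (Inf K))" by simp
      then show "norm (f (Sup K) - h (Sup K) - (f (Inf K) - h (Inf K)))
          \<le> norm (f (Sup K) - f (Inf K)) + norm (h (Sup K) - h (Inf K))"
        by (metis norm_triangle_ineq4)
    qed
    also have "\<dots> < e / 2 + e / 2"
      unfolding sum.distrib using D \<delta>(2) [of D d] \<eta>(2) [of D d] by (intro add_strict_mono) auto
    finally show "(\<Sum>K\<in>D. norm (f (Sup K) - h (Sup K) - (f (Inf K) - h (Inf K)))) < e" by simp
  qed
qed

lemma lipschitz_imp_abs_continuous_on:
  assumes "\<And>s t. a \<le> s \<Longrightarrow> s \<le> t \<Longrightarrow> t \<le> b \<Longrightarrow> norm (f t - f s) \<le> C * (t - s)" "C \<ge> 0"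
  shows "abs_continuous_on a b f"
proof (rule abs_continuous_on_dominated [where \<psi> = "\<lambda>_. 0::real"])
  show "abs_continuous_on a b (\<lambda>_. 0::real)"
    by (auto simp: abs_continuous_on_def intro: exI [of _ 1])
qed (use assms in auto)

text \<open>Cousin's lemma provides a tagged division subordinate to the straddle estimate at good
  tags; the intervals with bad tags lie in an open set of small measure, so absolute continuity
  controls their contribution.\<close>

lemma abs_continuous_on_nonincreasing:
  fixes \<phi> :: "real \<Rightarrow> real"
  assumes ab: "a \<le> b" and ac: "abs_continuous_on a b \<phi>" and N: "negligible N"
    and straddle: "\<And>x e. x \<in> {a..b} - N \<Longrightarrow> e > 0 \<Longrightarrow>
       \<exists>d>0. \<forall>u v. a \<le> u \<and> u \<le> x \<and> x \<le> v \<and> v \<le> b \<and> x - d < u \<and> v < x + d \<longrightarrow> \<phi> v - \<phi> u \<le> e * (v - u)"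
  shows "\<phi> b \<le> \<phi> a"
proof (rule field_le_epsilon)
  fix e0 :: real assume e0: "e0 > 0"
  \<comment> \<open>The budget: intervals with bad tags will cost at most \<open>e\<close> in total,
    those with good tags at most \<open>e * (b - a)\<close>.\<close>
  define e where "e = e0 / (1 + (b - a))"
  have e: "e > 0" using e0 ab by (simp add: e_def)
  obtain \<delta> where \<delta>: "\<delta> > 0" "\<And>D d. D division_of d \<Longrightarrow> d \<subseteq> {a..b} \<Longrightarrow> (\<Sum>K\<in>D. Sup K - Inf K) < \<delta> \<Longrightarrow>
        (\<Sum>K\<in>D. norm (\<phi> (Sup K) - \<phi> (Inf K))) < e"
    using abs_continuous_onE [OF ac e] by blast
  have Ns: "N \<in> null_sets lebesgue" using N by (simp add: negligible_iff_null_sets)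
  then obtain U where U: "open U" "N \<subseteq> U" "(U - N) \<in> lmeasurable" "emeasure lebesgue (U - N) < ennreal \<delta>"
    using sets_lebesgue_outer_open [of N \<delta>] \<delta>(1) by blast
  have Um: "U \<in> lmeasurable" "measure lebesgue U < \<delta>"
  proof -
    have "emeasure lebesgue U = emeasure lebesgue (U - N)"
      using emeasure_Diff_null_set [OF Ns, of U] U(1) by simp
    then have lt: "emeasure lebesgue U < ennreal \<delta>" using U(4) by simp
    then have "emeasure lebesgue U < \<infinity>" by (rule order.strict_trans) simp
    then show "U \<in> lmeasurable" using U(1) by (intro fmeasurableI) auto
    then have "ennreal (measure lebesgue U) < ennreal \<delta>" using lt by (simp add: emeasure_eq_measure2)
    then show "measure lebesgue U < \<delta>" using \<delta>(1) by (simp add: ennreal_less_iff)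
  qed
  have "\<forall>x. \<exists>d. x \<in> {a..b} - N \<longrightarrow> d > 0 \<and> (\<forall>u v. a \<le> u \<and> u \<le> x \<and> x \<le> v \<and> v \<le> b \<and> x - d < u \<and> v < x + d
       \<longrightarrow> \<phi> v - \<phi> u \<le> e * (v - u))"
    using straddle e by blast
  then obtain \<rho> where \<rho>: "\<And>x. x \<in> {a..b} - N \<Longrightarrow> \<rho> x > 0"
     "\<And>x u v. x \<in> {a..b} - N \<Longrightarrow> a \<le> u \<and> u \<le> x \<and> x \<le> v \<and> v \<le> b \<and> x - \<rho> x < u \<and> v < x + \<rho> x
       \<Longrightarrow> \<phi> v - \<phi> u \<le> e * (v - u)"
    by metis
  define \<gamma> where "\<gamma> x = (if x \<in> N then U else if x \<in> {a..b} then ball x (\<rho> x) else UNIV)" for x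
  have "gauge \<gamma>"
    unfolding gauge_def
  proof
    fix x show "x \<in> \<gamma> x \<and> open (\<gamma> x)"
      using U(1,2) \<rho>(1) [of x] by (auto simp: \<gamma>_def)
  qed
  then obtain p where p: "p tagged_division_of {a..b}" "\<gamma> fine p"
    using fine_division_exists_real by blast
  have fin: "finite p" using p(1) by auto
  define p1 where "p1 = {(x,K) \<in> p. x \<in> N}"
  have pe: "K = {Inf K..Sup K}" "Inf K \<le> x" "x \<le> Sup K" "a \<le> Inf K" "Sup K \<le> b" "K \<subseteq> \<gamma> x"
    if xKp: "(x, K) \<in> p" for x K
  proof -
    have xK: "x \<in> K" "K \<subseteq> {a..b}" using tagged_division_ofD(2,3) [OF p(1) xKp] .
    obtain u v where uv: "K = {u..v}" using tagged_division_ofD(4) [OF p(1) xKp] by (metis box_real(2))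
    show "K = {Inf K..Sup K}" "Inf K \<le> x" "x \<le> Sup K" "a \<le> Inf K" "Sup K \<le> b"
      using xK uv by auto
    show "K \<subseteq> \<gamma> x" using p(2) xKp by (auto simp: fine_def)
  qed
  have "\<phi> b - \<phi> a = (\<Sum>(x,K)\<in>p. \<phi> (Sup K) - \<phi> (Inf K))"
    by (rule additive_tagged_division_1 [OF ab p(1), symmetric])
  also have "\<dots> = (\<Sum>(x,K)\<in>p1. \<phi> (Sup K) - \<phi> (Inf K)) + (\<Sum>(x,K)\<in>p - p1. \<phi> (Sup K) - \<phi> (Inf K))"
    using fin by (intro sum.subset_diff [THEN trans]) (auto simp: p1_def add.commute)
  also have "(\<Sum>(x,K)\<in>p - p1. \<phi> (Sup K) - \<phi> (Inf K)) \<le> (\<Sum>(x,K)\<in>p - p1. e * (Sup K - Inf K))"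
  proof (rule sum_mono)
    fix y assume "y \<in> p - p1"
    then obtain x K where y: "y = (x, K)" and xK: "(x, K) \<in> p" "(x, K) \<notin> p1" by (cases y) auto
    then have "x \<notin> N" by (simp add: p1_def)
    then have x: "x \<in> {a..b} - N" using pe(2-5) [OF xK(1)] by (metis DiffI atLeastAtMost_iff order_trans)
    have "\<gamma> x = ball x (\<rho> x)" using x by (simp add: \<gamma>_def)
    then have "K \<subseteq> ball x (\<rho> x)" using pe(6) [OF xK(1)] by metis
    moreover have "Inf K \<in> {Inf K..Sup K}" "Sup K \<in> {Inf K..Sup K}" using pe(2,3) [OF xK(1)] by simp_all
    then have "Inf K \<in> K" "Sup K \<in> K" using pe(1) [OF xK(1)] by metis+
    ultimately have "dist x (Inf K) < \<rho> x" "dist x (Sup K) < \<rho> x"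
      by (metis mem_ball subsetD)+
    then have "\<phi> (Sup K) - \<phi> (Inf K) \<le> e * (Sup K - Inf K)"
      using pe(2-5) [OF xK(1)] unfolding dist_real_def by (intro \<rho>(2) [OF x]) linarith
    then show "(case y of (x, K) \<Rightarrow> \<phi> (Sup K) - \<phi> (Inf K)) \<le> (case y of (x, K) \<Rightarrow> e * (Sup K - Inf K))"
      using y by simp
  qed
  also have "\<dots> \<le> (\<Sum>(x,K)\<in>p. e * (Sup K - Inf K))"
  proof (rule sum_mono2 [OF fin])
    fix b assume "b \<in> p - (p - p1)"
    then obtain x K where "b = (x, K)" "(x, K) \<in> p" by (cases b) auto
    with pe(2,3) [of x K] e show "0 \<le> (case b of (x, K) \<Rightarrow> e * (Sup K - Inf K))" by auto
  qed auto
  also have "\<dots> = e * (b - a)"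
    using additive_tagged_division_1 [OF ab p(1), of "\<lambda>x. x"]
    by (simp add: sum_distrib_left [symmetric] split_def)
  also have "(\<Sum>(x,K)\<in>p1. \<phi> (Sup K) - \<phi> (Inf K)) \<le> e"
  proof -
    have tp: "p1 tagged_partial_division_of {a..b}"
      using p(1) by (auto simp: tagged_division_of_def p1_def intro: tagged_partial_division_subset)
    then have td: "p1 tagged_division_of (\<Union>(snd ` p1))"
      by (rule tagged_partial_division_of_Union_self)
    have D: "snd ` p1 division_of \<Union>(snd ` p1)"
      by (rule partial_division_of_tagged_division [OF tp])
    have sub: "\<Union>(snd ` p1) \<subseteq> {a..b} \<inter> U"
    proof
      fix y assume "y \<in> \<Union>(snd ` p1)"
      then obtain x K where "y \<in> K" "(x, K) \<in> p" "x \<in> N" by (auto simp: p1_def)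
      then show "y \<in> {a..b} \<inter> U"
        using pe(6) [of x K] tagged_division_ofD(3) [OF p(1), of x K] by (auto simp: \<gamma>_def)
    qed
    have content: "Sup K - Inf K = measure lebesgue K" if "(x, K) \<in> p1" for x K
      by (subst (3) pe(1) [of x]) (use that pe(2,3) [of x K] in \<open>auto simp: p1_def\<close>)
    have "(\<Sum>K\<in>snd ` p1. Sup K - Inf K) = (\<Sum>K\<in>snd ` p1. measure lebesgue K)"
      using content by (intro sum.cong refl) auto
    also have "\<dots> = measure lebesgue (\<Union>(snd ` p1))"
      using content_division [OF D] by simp
    also have "\<dots> \<le> measure lebesgue U"
    proof (rule measure_mono_fmeasurable)
      show "\<Union>(snd ` p1) \<in> sets lebesgue" using D by (meson fmeasurableD lmeasurable_division)
    qed (use sub Um in auto)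
    finally have "(\<Sum>K\<in>snd ` p1. Sup K - Inf K) < \<delta>" using Um by simp
    then have *: "(\<Sum>K\<in>snd ` p1. norm (\<phi> (Sup K) - \<phi> (Inf K))) < e"
      using \<delta>(2) [OF D] sub by auto
    \<comment> \<open>Two tags can share an interval only if it has empty interior, so passing to
      the set of intervals needs terms that vanish there. For the empty set, where
      \<open>Sup\<close> and \<open>Inf\<close> carry no information, the conditional enforces
      this.\<close>
    have "(\<Sum>(x,K)\<in>p1. \<phi> (Sup K) - \<phi> (Inf K)) = (\<Sum>(x,K)\<in>p1. if K = {} then 0 else \<phi> (Sup K) - \<phi> (Inf K))"
    proof (rule sum.cong [OF refl])
      fix y assume "y \<in> p1"
      then obtain x K where y: "y = (x, K)" "(x, K) \<in> p" by (auto simp: p1_def)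
      then have "x \<in> K" using tagged_division_ofD(2) [OF p(1)] by blast
      then show "(case y of (x, K) \<Rightarrow> \<phi> (Sup K) - \<phi> (Inf K)) =
                 (case y of (x, K) \<Rightarrow> if K = {} then 0 else \<phi> (Sup K) - \<phi> (Inf K))"
        using y by auto
    qed
    also have "\<dots> = (\<Sum>K\<in>snd ` p1. if K = {} then 0 else \<phi> (Sup K) - \<phi> (Inf K))"
      by (rule sum.over_tagged_division_lemma [OF td]) (auto simp: cbox_interval less_le)
    also have "\<dots> \<le> (\<Sum>K\<in>snd ` p1. norm (\<phi> (Sup K) - \<phi> (Inf K)))"
      by (intro sum_mono) auto
    finally show ?thesis using * by simp
  qed
  finally have "\<phi> b - \<phi> a \<le> e + e * (b - a)" by simp
  also have "\<dots> = e * (1 + (b - a))" by (simp add: algebra_simps)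
  also have "\<dots> = e0" using ab by (simp add: e_def)
  finally show "\<phi> b \<le> \<phi> a + e0" by simp
qed

text \<open>The straddle lemma: as \<open>x\<close> lies between \<open>u\<close> and
  \<open>v\<close>, the one-sided errors add up to \<open>e\<close> times
  \<open>(v - x) + (x - u) = v - u\<close>, with nothing lost.\<close>

lemma has_vector_derivative_straddle:
  fixes f :: "real \<Rightarrow> 'a::real_normed_vector"
  assumes f: "(f has_vector_derivative f') (at x within S)" and e: "e > 0" and x: "x \<in> S"
  shows "\<exists>d>0. \<forall>u v. u \<in> S \<and> v \<in> S \<and> u \<le> x \<and> x \<le> v \<and> x - d < u \<and> v < x + d \<longrightarrow>
            norm (f v - f u - (v - u) *\<^sub>R f') \<le> e * (v - u)"
proof -
  obtain d where d: "d > 0" "\<And>y. y \<in> S \<Longrightarrow> norm (y - x) < d \<Longrightarrow> norm (f y - f x - (y - x) *\<^sub>R f') \<le> e * norm (y - x)"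
    using f e unfolding has_vector_derivative_def has_derivative_within_alt by blast
  show ?thesis
  proof (intro exI conjI allI impI)
    fix u v assume uv: "u \<in> S \<and> v \<in> S \<and> u \<le> x \<and> x \<le> v \<and> x - d < u \<and> v < x + d"
    have "norm (f v - f u - (v - u) *\<^sub>R f') = norm ((f v - f x - (v - x) *\<^sub>R f') - (f u - f x - (u - x) *\<^sub>R f'))"
      by (simp add: algebra_simps)
    also have "\<dots> \<le> e * norm (v - x) + e * norm (u - x)"
      by (intro order_trans [OF norm_triangle_ineq4] add_mono d) (use uv in auto)
    also have "\<dots> = e * (v - u)" using uv by (simp add: algebra_simps)
    finally show "norm (f v - f u - (v - u) *\<^sub>R f') \<le> e * (v - u)" .
  qed (rule d)
qed

lemma abs_continuous_on_deriv_nonpos: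
  fixes \<phi> :: "real \<Rightarrow> real"
  assumes "a \<le> b" and "abs_continuous_on a b \<phi>" and "negligible N"
    and deriv: "\<And>x. x \<in> {a..b} - N \<Longrightarrow> \<exists>D\<le>0. (\<phi> has_vector_derivative D) (at x within {a..b})"
  shows "\<phi> b \<le> \<phi> a"
proof (rule abs_continuous_on_nonincreasing [OF assms(1-3)])
  fix x e :: real assume x: "x \<in> {a..b} - N" and e: "e > 0"
  obtain D where D: "D \<le> 0" "(\<phi> has_vector_derivative D) (at x within {a..b})" using deriv [OF x] by blast
  obtain d where d: "d > 0" "\<And>u v. u \<in> {a..b} \<and> v \<in> {a..b} \<and> u \<le> x \<and> x \<le> v \<and> x - d < u \<and> v < x + d \<Longrightarrow>
            norm (\<phi> v - \<phi> u - (v - u) *\<^sub>R D) \<le> e * (v - u)"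
    using has_vector_derivative_straddle [OF D(2) e] x by blast
  have "\<phi> v - \<phi> u \<le> e * (v - u)" if "a \<le> u \<and> u \<le> x \<and> x \<le> v \<and> v \<le> b \<and> x - d < u \<and> v < x + d" for u v
  proof -
    have "\<phi> v - \<phi> u \<le> (v - u) * D + e * (v - u)" using d(2) [of u v] that by auto
    moreover have "(v - u) * D \<le> 0" using that D(1) by (simp add: mult_nonneg_nonpos)
    ultimately show ?thesis by simp
  qed
  with d(1) show "\<exists>d>0. \<forall>u v. a \<le> u \<and> u \<le> x \<and> x \<le> v \<and> v \<le> b \<and> x - d < u \<and> v < x + d \<longrightarrow> \<phi> v - \<phi> u \<le> e * (v - u)"
    by blast
qed

text \<open>At the last zero of \<open>\<phi> t - \<epsilon> (t - a) - \<epsilon>\<close> the hypothesis yields a contradiction; since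
  \<open>\<phi>\<close> is small there, the Dini estimate is only needed on the strip \<open>0 < \<phi> < \<eta>\<close>.\<close>

lemma dini_nonpos:
  fixes \<phi> :: "real \<Rightarrow> real"
  assumes cont: "continuous_on {a..b} \<phi>" and "\<phi> a \<le> 0" and ab: "a \<le> b" and \<eta>: "\<eta> > 0"
    and dini: "\<And>r e. a \<le> r \<Longrightarrow> r < b \<Longrightarrow> 0 < \<phi> r \<Longrightarrow> \<phi> r < \<eta> \<Longrightarrow> e > 0 \<Longrightarrow>
       \<exists>d>0. \<forall>t. r < t \<and> t < r + d \<longrightarrow> \<phi> t \<le> \<phi> r + e * (t - r)"
  shows "\<phi> b \<le> 0"
proof (rule ccontr)
  assume "\<not> \<phi> b \<le> 0"
  then have pos: "\<phi> b > 0" by simp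
  \<comment> \<open>The barrier \<open>e * (t - a) + e\<close> then never exceeds half of
    \<open>min (\<phi> b) \<eta>\<close>: at \<open>b\<close> it lies below \<phi>, and wherever
    \<phi> meets it, \<phi> stays below \<eta>.\<close>
  define e where "e = min (\<phi> b) \<eta> / (2 * (1 + (b - a)))"
  have e: "e > 0" using pos \<eta> ab by (simp add: e_def)
  have "1 + (b - a) > 0" using ab by simp
  then have e2: "e * (1 + (b - a)) = min (\<phi> b) \<eta> / 2" unfolding e_def by (simp add: field_simps del: min_less_iff_conj)
  define \<psi> where "\<psi> t = \<phi> t - e * (t - a) - e" for t
  have c: "continuous_on {a..b} \<psi>" unfolding \<psi>_def by (intro continuous_intros cont)
  define Z where "Z = {a..b} \<inter> \<psi> -` {..0}"
  have "closed Z" unfolding Z_def by (rule continuous_closed_preimage [OF c]) auto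
  moreover have "a \<in> Z" using ab e assms(2) by (simp add: Z_def \<psi>_def)
  moreover have bd: "bdd_above Z" by (auto simp: Z_def)
  ultimately have r: "Sup Z \<in> Z" by (intro closed_contains_Sup) auto
  define r where "r = Sup Z"
  have rZ: "a \<le> r" "r \<le> b" "\<psi> r \<le> 0" using r by (auto simp: Z_def r_def)
  have above: "\<psi> t > 0" if "r < t" "t \<le> b" for t
    using cSup_upper [OF _ bd, of t] that rZ by (force simp: r_def Z_def)
  have "\<psi> b > 0" using e2 pos \<eta> by (simp add: \<psi>_def algebra_simps min_def split: if_splits)
  then have rb: "r < b" using rZ by (metis leD le_less)
  \<comment> \<open>With \<open>\<psi> r \<le> 0\<close> this makes \<open>\<phi> r\<close> equal to
    the barrier, hence strictly between 0 and \<eta>, which is where the hypothesis speaks.\<close>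
  have \<psi>r: "\<psi> r \<ge> 0"
  proof -
    have "(\<psi> \<longlongrightarrow> \<psi> r) (at r within {a..b})"
      using c rZ unfolding continuous_on_def by simp
    then have "(\<psi> \<longlongrightarrow> \<psi> r) (at r within {r<..<b})"
      by (rule tendsto_within_subset) (use rZ in auto)
    moreover have "at r within {r<..<b} \<noteq> bot" using rb by (simp add: at_within_eq_bot_iff islimpt_greaterThanLessThan1)
    moreover have "eventually (\<lambda>t. \<psi> t \<ge> 0) (at r within {r<..<b})"
      using above by (auto simp: eventually_at_filter intro!: always_eventually less_imp_le)
    ultimately show ?thesis using tendsto_lowerbound by blast
  qed
  have \<phi>r: "\<phi> r = e * (1 + (r - a))" using \<psi>r rZ by (simp add: \<psi>_def algebra_simps)
  have "\<phi> r > 0" using \<phi>r e rZ by simp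
  moreover have "\<phi> r < \<eta>"
  proof -
    have "\<phi> r \<le> e * (1 + (b - a))" unfolding \<phi>r using e rZ by (intro mult_left_mono) auto
    moreover have "min (\<phi> b) \<eta> / 2 < \<eta>" using \<eta> by (simp add: min_def)
    ultimately show ?thesis using e2 by linarith
  qed
  ultimately obtain d where d: "d > 0" "\<And>t. r < t \<and> t < r + d \<Longrightarrow> \<phi> t \<le> \<phi> r + e * (t - r)"
    using dini [OF rZ(1) rb _ _ e] by blast
  define t where "t = min b (r + d / 2)"
  have t: "r < t" "t < r + d" "t \<le> b" using d rb by (auto simp: t_def)
  have "\<phi> t \<le> \<phi> r + e * (t - r)" using d(2) t by blast
  with t above [of t] \<psi>r rZ show False by (simp add: \<psi>_def algebra_simps)
qed

text \<open>Made for bootstrapping: a differential inequality known only while \<phi> is small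
  already prevents \<phi> from becoming large, so a region can be shown to trap a trajectory by an
  estimate valid only inside it.\<close>

lemma dini_nonpos_deriv:
  fixes \<phi> :: "real \<Rightarrow> real"
  assumes "continuous_on {a..b} \<phi>" and "\<phi> a \<le> 0" and "a \<le> b" and "\<eta> > 0"
    and deriv: "\<And>r. a \<le> r \<Longrightarrow> r < b \<Longrightarrow> 0 < \<phi> r \<Longrightarrow> \<phi> r < \<eta> \<Longrightarrow>
       \<exists>D\<le>0. (\<phi> has_vector_derivative D) (at_right r)"
  shows "\<phi> b \<le> 0"
proof (rule dini_nonpos [OF assms(1-4)])
  fix r e :: real assume r: "a \<le> r" "r < b" "0 < \<phi> r" "\<phi> r < \<eta>" and e: "e > 0"
  obtain D where D: "D \<le> 0" "(\<phi> has_vector_derivative D) (at_right r)" using deriv [OF r] by blast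
  obtain d where d: "d > 0" "\<And>y. y > r \<Longrightarrow> norm (y - r) < d \<Longrightarrow> norm (\<phi> y - \<phi> r - (y - r) *\<^sub>R D) \<le> e * norm (y - r)"
    using D(2) e unfolding has_vector_derivative_def has_derivative_within_alt by force
  have "\<phi> t \<le> \<phi> r + e * (t - r)" if "r < t" "t < r + d" for t
    using d(2) [of t] that D(1) mult_nonneg_nonpos [of "t - r" D] by auto
  with d(1) show "\<exists>d>0. \<forall>t. r < t \<and> t < r + d \<longrightarrow> \<phi> t \<le> \<phi> r + e * (t - r)" by blast
qed

section \<open>Tangent cones and projections\<close>

lemma tangent_cone_alt:
  "tangent_cone S x = closure {c *\<^sub>R (z - x) | c z. c > 0 \<and> z \<in> S}"
proof -
  have "(\<Union>\<delta>\<in>{0<..}. (\<lambda>z. (1 / \<delta>) *\<^sub>R (z - x)) ` S) = {c *\<^sub>R (z - x) | c z. c > (0::real) \<and> z \<in> S}"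
  proof (intro equalityI subsetI)
    fix w assume "w \<in> {c *\<^sub>R (z - x) | c z. c > (0::real) \<and> z \<in> S}"
    then obtain c :: real and z where c: "w = c *\<^sub>R (z - x)" "c > 0" "z \<in> S" by blast
    then have "w = (1 / (1 / c)) *\<^sub>R (z - x)" "1 / c \<in> {0<..}" by auto
    with c show "w \<in> (\<Union>\<delta>\<in>{0<..}. (\<lambda>z. (1 / \<delta>) *\<^sub>R (z - x)) ` S)" by blast
  next
    fix w assume "w \<in> (\<Union>\<delta>\<in>{0<..}. (\<lambda>z. (1 / \<delta>) *\<^sub>R (z - x)) ` S)"
    then obtain \<delta> :: real and z where "\<delta> > 0" "z \<in> S" "w = (1 / \<delta>) *\<^sub>R (z - x)" by auto
    then show "w \<in> {c *\<^sub>R (z - x) | c z. c > (0::real) \<and> z \<in> S}"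
      by (intro CollectI exI [of _ "1 / \<delta>"] exI [of _ z]) auto
  qed
  then show ?thesis by (simp add: tangent_cone_def)
qed

lemma closed_tangent_cone: "closed (tangent_cone S x)"
  by (simp add: tangent_cone_alt)

lemma tangent_cone_diff: "c > 0 \<Longrightarrow> z \<in> S \<Longrightarrow> c *\<^sub>R (z - x) \<in> tangent_cone S x"
  unfolding tangent_cone_alt by (rule closure_subset [THEN subsetD]) blast

lemma tangent_cone_scaleR:
  assumes "v \<in> tangent_cone S x" "c > 0"
  shows "c *\<^sub>R v \<in> tangent_cone S x"
proof -
  let ?C = "{c *\<^sub>R (z - x) | c z. c > 0 \<and> z \<in> S}"
  have "(\<lambda>v. c *\<^sub>R v) ` ?C \<subseteq> ?C"
  proof (rule image_subsetI)
    fix w assume "w \<in> ?C"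
    then obtain d z where "w = d *\<^sub>R (z - x)" "d > 0" "z \<in> S" by blast
    then have "c *\<^sub>R w = (c * d) *\<^sub>R (z - x)" "c * d > 0" "z \<in> S" using assms(2) by auto
    then show "c *\<^sub>R w \<in> ?C" by blast
  qed
  then have "(\<lambda>v. c *\<^sub>R v) ` closure ?C \<subseteq> closure ?C"
    using closure_mono [of "(\<lambda>v. c *\<^sub>R v) ` ?C" ?C] by (simp only: closure_scaleR)
  then show ?thesis using assms(1) by (auto simp: tangent_cone_alt)
qed

lemma convex_tangent_cone:
  assumes "convex S"
  shows "convex (tangent_cone S x)"
  unfolding tangent_cone_alt
proof (rule convex_closure)
  show "convex {c *\<^sub>R (z - x) | c z. c > 0 \<and> z \<in> S}"
  proof (rule convexI)
    fix a b and u v :: real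
    assume "a \<in> {c *\<^sub>R (z - x) | c z. c > 0 \<and> z \<in> S}" "b \<in> {c *\<^sub>R (z - x) | c z. c > 0 \<and> z \<in> S}"
      and uv: "0 \<le> u" "0 \<le> v" "u + v = 1"
    then obtain c d y z where ab: "a = c *\<^sub>R (y - x)" "b = d *\<^sub>R (z - x)" "c > 0" "d > 0" "y \<in> S" "z \<in> S"
      by blast
    define s where "s = u * c + v * d"
    have s: "s > 0"
      unfolding s_def using uv ab(3,4)
      by (metis add.right_neutral add_nonneg_pos add_pos_nonneg less_eq_real_def mult.commute mult_eq_0_iff mult_nonneg_nonneg mult_pos_pos zero_neq_one)
    have "u * c / s + v * d / s = 1" using s by (simp add: add_divide_distrib [symmetric] s_def)
    then have zS: "(u * c / s) *\<^sub>R y + (v * d / s) *\<^sub>R z \<in> S"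
      using s uv ab by (intro convexD [OF assms]) auto
    have "s *\<^sub>R ((u * c / s) *\<^sub>R y + (v * d / s) *\<^sub>R z - x) = (u * c) *\<^sub>R y + (v * d) *\<^sub>R z - s *\<^sub>R x"
      using s by (simp add: algebra_simps)
    also have "\<dots> = u *\<^sub>R a + v *\<^sub>R b" by (simp add: ab s_def algebra_simps)
    finally show "u *\<^sub>R a + v *\<^sub>R b \<in> {c *\<^sub>R (z - x) | c z. c > 0 \<and> z \<in> S}"
      using s zS by (metis (mono_tags, lifting) mem_Collect_eq)
  qed
qed

lemma tangent_cone_subset_halfspace:
  assumes "\<And>z. z \<in> S \<Longrightarrow> n \<bullet> (z - x) \<le> 0" "v \<in> tangent_cone S x"
  shows "n \<bullet> v \<le> (0::real)"
proof -
  have "{c *\<^sub>R (z - x) | c z. c > 0 \<and> z \<in> S} \<subseteq> {v. n \<bullet> v \<le> 0}"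
    using assms(1) by (auto simp: mult_nonneg_nonpos)
  then have "tangent_cone S x \<subseteq> {v. n \<bullet> v \<le> 0}"
    unfolding tangent_cone_alt by (intro closure_minimal closed_halfspace_le)
  with assms(2) show ?thesis by auto
qed

lemma proj_vec_in_tangent_cone:
  assumes "S \<noteq> {}"
  shows "proj_vec S x f \<in> tangent_cone S x"
proof -
  obtain z where "z \<in> S" using assms by blast
  from tangent_cone_diff [OF zero_less_one this, of x] show ?thesis
    unfolding proj_vec_def by (intro closest_point_in_set closed_tangent_cone) auto
qed

context
  fixes S :: "'a::euclidean_space set" and x f :: 'a
  assumes conv: "convex S" and xS: "x \<in> S"
begin

lemma zero_in_tangent_cone: "0 \<in> tangent_cone S x"
  using tangent_cone_diff [of 1 x S x] xS by simp

lemma proj_vec_orthogonal: "(f - proj_vec S x f) \<bullet> proj_vec S x f = 0"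
proof -
  let ?v = "proj_vec S x f"
  have v: "?v \<in> tangent_cone S x" using xS by (intro proj_vec_in_tangent_cone) auto
  have *: "(f - ?v) \<bullet> (u - ?v) \<le> 0" if "u \<in> tangent_cone S x" for u
    unfolding proj_vec_def
    by (rule closest_point_dot [OF convex_tangent_cone [OF conv] closed_tangent_cone that])
  from * [OF zero_in_tangent_cone] * [OF tangent_cone_scaleR [OF v, of 2]]
  show ?thesis by (simp add: scaleR_2)
qed

lemma proj_vec_polar:
  assumes "u \<in> tangent_cone S x"
  shows "(f - proj_vec S x f) \<bullet> u \<le> 0"
  using closest_point_dot [OF convex_tangent_cone [OF conv] closed_tangent_cone assms, of f]
    proj_vec_orthogonal by (simp add: inner_diff_right proj_vec_def)

lemma proj_vec_normal: "f - proj_vec S x f \<in> normal_cone S x"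
  using proj_vec_polar tangent_cone_diff [of 1 _ S x] xS by (force simp: normal_cone_def)

lemma inner_proj_vec: "f \<bullet> proj_vec S x f = (norm (proj_vec S x f))\<^sup>2"
  using proj_vec_orthogonal by (simp add: inner_diff_left power2_norm_eq_inner)

text \<open>Moreau's decomposition read backwards: a splitting into orthogonal parts, one in the
  cone and one in its polar, is the projection. Polarity is asked for against \<open>S - x\<close>
  only and passes to the generated cone and its closure.\<close>

lemma proj_vec_unique:
  assumes "v \<in> tangent_cone S x" "f - v \<in> normal_cone S x" "(f - v) \<bullet> v = 0"
  shows "proj_vec S x f = v"
  unfolding proj_vec_def
proof (rule closest_point_unique [symmetric, OF convex_tangent_cone [OF conv] closed_tangent_cone assms(1)], intro ballI)
  fix u assume u: "u \<in> tangent_cone S x"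
  have "(f - v) \<bullet> u \<le> 0"
    by (rule tangent_cone_subset_halfspace [OF _ u]) (use assms(2) in \<open>simp add: normal_cone_def\<close>)
  then have *: "(f - v) \<bullet> (u - v) \<le> 0" using assms(3) by (simp add: inner_diff_right)
  have "(norm (f - u))\<^sup>2 = (norm (f - v))\<^sup>2 - 2 * ((f - v) \<bullet> (u - v)) + (norm (u - v))\<^sup>2"
    by (simp add: power2_norm_eq_inner algebra_simps inner_commute)
  with * zero_le_power2 [of "norm (u - v)"] have "(norm (f - v))\<^sup>2 \<le> (norm (f - u))\<^sup>2" by linarith
  then show "dist f v \<le> dist f u" by (simp add: dist_norm)
qed

text \<open>Expand the square of \<open>q - v\<close>, where \<open>v\<close> is the projection. The
  norm bound controls the square of \<open>q\<close>. For \<open>q \<bullet> v\<close>, approximate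
  \<open>v\<close> by \<open>c *\<^sub>R (y - x)\<close> with \<open>y\<close> in \<open>S\<close>;
  the second estimate and \<open>f \<bullet> v = (norm v)\<^sup>2\<close> make it nearly the square
  of \<open>v\<close> from below. No compactness or prior convergence of \<open>q\<close> is
  involved.\<close>

lemma proj_vec_tendstoI:
  assumes norm_le: "(r \<longlongrightarrow> norm (proj_vec S x f)) F" "eventually (\<lambda>t. norm (q t) \<le> r t) F"
    and vi: "\<And>y. y \<in> S \<Longrightarrow> \<exists>r. (r \<longlongrightarrow> f \<bullet> (x - y)) F \<and> eventually (\<lambda>t. q t \<bullet> (x - y) \<le> r t) F"
  shows "(q \<longlongrightarrow> proj_vec S x f) F"
proof (rule tendstoI)
  define v where "v = proj_vec S x f"
  fix \<epsilon> :: real assume \<epsilon>: "\<epsilon> > 0"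
  \<comment> \<open>The final error is
    \<open>\<eta> * (\<eta> + 4 + 4 * norm v + 2 * norm f)\<close>, and \<open>A\<close> bounds the
    factor because \<open>\<eta> \<le> 1\<close>.\<close>
  define A where "A = 5 + 4 * norm v + 2 * norm f"
  have A: "A > 0" by (simp add: A_def add_pos_nonneg)
  define \<eta> where "\<eta> = min 1 (\<epsilon>\<^sup>2 / (2 * A))"
  have \<eta>: "\<eta> > 0" "\<eta> \<le> 1" "\<eta> * A < \<epsilon>\<^sup>2"
  proof -
    show "\<eta> > 0" "\<eta> \<le> 1" using \<epsilon> A by (auto simp: \<eta>_def)
    have "\<eta> * A \<le> \<epsilon>\<^sup>2 / (2 * A) * A" using A by (intro mult_right_mono) (auto simp: \<eta>_def)
    also have "\<dots> < \<epsilon>\<^sup>2" using A \<epsilon> by simp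
    finally show "\<eta> * A < \<epsilon>\<^sup>2" .
  qed
  have "v \<in> tangent_cone S x" unfolding v_def using xS by (intro proj_vec_in_tangent_cone) auto
  then obtain c y where c: "c > 0" "y \<in> S" "norm (c *\<^sub>R (y - x) - v) < \<eta>"
    using \<eta>(1) unfolding tangent_cone_alt closure_approachable dist_norm by blast
  obtain r' where r': "(r' \<longlongrightarrow> f \<bullet> (x - y)) F" "eventually (\<lambda>t. q t \<bullet> (x - y) \<le> r' t) F"
    using vi [OF c(2)] by blast
  have e1: "eventually (\<lambda>t. r t < norm v + \<eta>) F"
    using norm_le(1) \<eta>(1) by (intro order_tendstoD(2)) (auto simp: v_def)
  have e2: "eventually (\<lambda>t. r' t < f \<bullet> (x - y) + \<eta> / c) F"
    using r'(1) \<eta>(1) c(1) by (intro order_tendstoD(2)) auto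
  show "eventually (\<lambda>t. dist (q t) (proj_vec S x f) < \<epsilon>) F"
    using norm_le(2) r'(2) e1 e2
  proof eventually_elim
    case (elim t)
    define u where "u = c *\<^sub>R (y - x)"
    have "q t \<bullet> (x - y) \<le> f \<bullet> (x - y) + \<eta> / c" using elim by simp
    then have "c * (q t \<bullet> (x - y)) \<le> c * (f \<bullet> (x - y) + \<eta> / c)"
      using c(1) by (intro mult_left_mono) auto
    then have qu: "q t \<bullet> u \<ge> f \<bullet> u - \<eta>"
      using c(1) by (simp add: u_def inner_diff_right algebra_simps)
    have qn: "norm (q t) \<le> norm v + \<eta>" using elim by simp
    have uv: "norm (v - u) \<le> \<eta>" using c(3) by (simp add: u_def norm_minus_commute)
    have "q t \<bullet> (v - u) \<ge> - (norm (q t) * norm (v - u))"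
      using Cauchy_Schwarz_ineq2 [of "q t" "v - u"] by linarith
    moreover have "norm (q t) * norm (v - u) \<le> (norm v + 1) * \<eta>"
      using qn uv \<eta> by (intro mult_mono) auto
    moreover have "f \<bullet> (v - u) \<le> norm f * \<eta>"
      by (rule order_trans [OF norm_cauchy_schwarz mult_left_mono [OF uv]]) simp
    moreover have "f \<bullet> v = (norm v)\<^sup>2" by (simp add: v_def inner_proj_vec)
    ultimately have qv: "q t \<bullet> v \<ge> (norm v)\<^sup>2 - \<eta> * (2 + norm v + norm f)"
      using qu by (simp add: inner_diff_right algebra_simps)
    have "(norm (q t - v))\<^sup>2 = (norm (q t))\<^sup>2 - 2 * (q t \<bullet> v) + (norm v)\<^sup>2"
      by (simp add: power2_norm_eq_inner inner_diff_left inner_diff_right inner_commute)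
    also have "\<dots> \<le> (norm v + \<eta>)\<^sup>2 - 2 * ((norm v)\<^sup>2 - \<eta> * (2 + norm v + norm f)) + (norm v)\<^sup>2"
      using qv qn by (intro add_mono diff_mono power_mono) auto
    also have "\<dots> = \<eta> * (\<eta> + 4 + 4 * norm v + 2 * norm f)"
      by (simp add: power2_eq_square algebra_simps)
    also have "\<dots> \<le> \<eta> * A" using \<eta> by (intro mult_left_mono) (auto simp: A_def)
    also have "\<dots> < \<epsilon>\<^sup>2" by (rule \<eta>)
    finally show ?case using \<epsilon> by (simp add: dist_norm v_def power_less_imp_less_base)
  qed
qed

end

text \<open>Projecting subtracts a vector normal to \<open>S\<close> at the base point; the normal
  vectors at \<open>x\<close> and \<open>y\<close> both pair favorably with
  \<open>x - y\<close>.\<close>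

lemma proj_vec_monotone:
  fixes S :: "'a::euclidean_space set"
  assumes "convex S" "x \<in> S" "y \<in> S"
  shows "(proj_vec S x f - proj_vec S y h) \<bullet> (x - y) \<le> (f - h) \<bullet> (x - y)"
proof -
  have "(f - proj_vec S x f) \<bullet> (y - x) \<le> 0" "(h - proj_vec S y h) \<bullet> (x - y) \<le> 0"
    using proj_vec_normal [OF assms(1,2)] proj_vec_normal [OF assms(1,3)] assms by (auto simp: normal_cone_def)
  then show ?thesis by (simp add: inner_diff_left inner_diff_right)
qed

section \<open>Derivatives as limits of difference quotients\<close>

lemma has_vector_derivative_iff_quotient:
  fixes f :: "real \<Rightarrow> 'a::real_normed_vector"
  shows "(f has_vector_derivative D) (at x within S) \<longleftrightarrow>
         ((\<lambda>y. (1 / (y - x)) *\<^sub>R (f y - f x)) \<longlongrightarrow> D) (at x within S)"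
proof -
  have "(f has_vector_derivative D) (at x within S) \<longleftrightarrow>
      ((\<lambda>y. (1 / norm (y - x)) *\<^sub>R (f y - (f x + (y - x) *\<^sub>R D))) \<longlongrightarrow> 0) (at x within S)"
    by (simp add: has_vector_derivative_def has_derivative_within bounded_linear_scaleR_left)
  also have "\<dots> \<longleftrightarrow> ((\<lambda>y. (1 / (y - x)) *\<^sub>R (f y - f x) - D) \<longlongrightarrow> 0) (at x within S)"
  proof (subst (1 2) tendsto_norm_zero_iff [symmetric], rule tendsto_cong)
    show "eventually (\<lambda>y. norm ((1 / norm (y - x)) *\<^sub>R (f y - (f x + (y - x) *\<^sub>R D)))
        = norm ((1 / (y - x)) *\<^sub>R (f y - f x) - D)) (at x within S)"
      unfolding eventually_at_filter
    proof (rule always_eventually, intro allI impI)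
      fix y assume "y \<noteq> x" 
      then have "(1 / (y - x)) *\<^sub>R ((y - x) *\<^sub>R D) = D" by simp
      then have "(1 / (y - x)) *\<^sub>R (f y - f x) - D = (1 / (y - x)) *\<^sub>R (f y - (f x + (y - x) *\<^sub>R D))"
        by (simp only: scaleR_diff_right scaleR_add_right diff_diff_eq)
      then show "norm ((1 / norm (y - x)) *\<^sub>R (f y - (f x + (y - x) *\<^sub>R D)))
        = norm ((1 / (y - x)) *\<^sub>R (f y - f x) - D)" by simp
    qed
  qed
  also have "\<dots> \<longleftrightarrow> ((\<lambda>y. (1 / (y - x)) *\<^sub>R (f y - f x)) \<longlongrightarrow> D) (at x within S)"
    by (rule LIM_zero_iff)
  finally show ?thesis .
qed

section \<open>Projected dynamical systems\<close>

text \<open>The shift by \<open>j\<close> is 0 before the unit time slot \<open>j\<close>, linear in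
  it and 1 afterwards, so increments weighted by such shifts sum to a piecewise linear
  interpolation.\<close>

definition clamp01 :: "real \<Rightarrow> real" where "clamp01 u = max 0 (min 1 u)"

lemma norm_sq_increment:
  fixes a b y :: "'a::real_inner"
  shows "(norm (b - y))\<^sup>2 / 2 - (norm (a - y))\<^sup>2 / 2 = (b - a) \<bullet> (b - y) - (norm (b - a))\<^sup>2 / 2"
  by (simp add: power2_norm_eq_inner algebra_simps inner_commute) (simp add: field_simps)

lemma sum_clamp01: "u \<ge> 0 \<Longrightarrow> (\<Sum>j<N. clamp01 (u - real j)) = min u (real N)"
  by (induction N) (auto simp: clamp01_def min_def max_def)

lemma clamp01_mono: "u \<le> v \<Longrightarrow> clamp01 u \<le> clamp01 v"
  by (auto simp: clamp01_def)

lemma sum_clamp01_nat: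
  fixes d :: "nat \<Rightarrow> 'a::real_vector"
  assumes "k \<le> N"
  shows "(\<Sum>j<N. clamp01 (real k - real j) *\<^sub>R d j) = (\<Sum>j<k. d j)"
proof -
  have "(\<Sum>j<N. clamp01 (real k - real j) *\<^sub>R d j) = (\<Sum>j<N. if j < k then d j else 0)"
    by (intro sum.cong refl) (auto simp: clamp01_def)
  also have "\<dots> = (\<Sum>j\<in>{..<N} \<inter> {j. j < k}. d j)" by (simp add: sum.inter_restrict)
  also have "{..<N} \<inter> {j. j < k} = {..<k}" using assms by auto
  finally show ?thesis .
qed

locale projected_system =
  fixes K :: "'a::euclidean_space set" and f :: "'a \<Rightarrow> 'a" and L M :: real
  assumes closed: "closed K" and convex: "convex K"
    and lipschitz: "L-lipschitz_on K f"
    and bound: "\<And>x. x \<in> K \<Longrightarrow> norm (f x) \<le> M" and M: "M \<ge> 0"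
begin

abbreviation speed :: "'a \<Rightarrow> 'a" where "speed x \<equiv> proj_vec K x (f x)"

lemma L: "L \<ge> 0"
  using lipschitz by (rule lipschitz_on_nonneg)

lemma f_diff: "x \<in> K \<Longrightarrow> y \<in> K \<Longrightarrow> norm (f x - f y) \<le> L * norm (x - y)"
  using lipschitz by (metis dist_norm lipschitz_onD)

lemma f_cont: "continuous_on K f"
  using lipschitz by (rule lipschitz_on_continuous_on)

subsection \<open>The projected Euler scheme\<close>

primrec euler :: "real \<Rightarrow> 'a \<Rightarrow> nat \<Rightarrow> 'a" where
  "euler h p 0 = p"
| "euler h p (Suc k) = closest_point K (euler h p k + h *\<^sub>R f (euler h p k))"

context
  fixes h :: real and p :: 'a assumes h: "h > 0" and p: "p \<in> K"
begin

lemma euler_in: "euler h p k \<in> K"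
  by (induction k) (use p closed closest_point_in_set in auto)

lemma euler_step: "norm (euler h p (Suc k) - euler h p k) \<le> h * M"
proof -
  let ?x = "euler h p k"
  have "dist (closest_point K (?x + h *\<^sub>R f ?x)) (closest_point K ?x) \<le> dist (?x + h *\<^sub>R f ?x) ?x"
    using p by (intro closest_point_lipschitz convex closed) auto
  also have "\<dots> \<le> h * M" using h bound [OF euler_in] by (simp add: dist_norm)
  finally show ?thesis by (simp add: closest_point_self euler_in dist_norm)
qed

lemma euler_dist: "norm (euler h p (k + n) - euler h p k) \<le> real n * h * M"
proof (induction n)
  case (Suc n)
  have "norm (euler h p (k + Suc n) - euler h p k)
     \<le> norm (euler h p (Suc (k + n)) - euler h p (k + n)) + norm (euler h p (k + n) - euler h p k)"
    using norm_triangle_ineq [of "euler h p (Suc (k + n)) - euler h p (k + n)" "euler h p (k + n) - euler h p k"] by simp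
  also have "\<dots> \<le> h * M + real n * h * M" by (intro add_mono euler_step Suc)
  finally show ?case by (simp add: algebra_simps)
qed simp

lemma euler_dist_le:
  assumes "j \<le> n"
  shows "norm (euler h p (k + j) - euler h p k) \<le> real n * h * M"
  by (rule order_trans [OF euler_dist]) (use assms h M in \<open>intro mult_right_mono, auto\<close>)

lemma euler_vi:
  assumes "y \<in> K"
  shows "(euler h p (Suc k) - euler h p k) \<bullet> (euler h p (Suc k) - y) \<le> h * (f (euler h p k) \<bullet> (euler h p (Suc k) - y))"
  using closest_point_dot [OF convex closed assms, of "euler h p k + h *\<^sub>R f (euler h p k)"]
  by (simp add: inner_diff_left inner_diff_right inner_add_left algebra_simps)

lemma euler_evi_bound:
  assumes y: "y \<in> K" and B: "\<And>j. j < n \<Longrightarrow> f (euler h p (k + j)) \<bullet> (euler h p (Suc (k + j)) - y) \<le> B"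
  shows "(norm (euler h p (k + n) - y))\<^sup>2 / 2 - (norm (euler h p k - y))\<^sup>2 / 2 \<le> real n * h * B"
  using B
proof (induction n)
  case (Suc n)
  let ?a = "euler h p (k + n)" and ?b = "euler h p (Suc (k + n))"
  have "(norm (?b - y))\<^sup>2 / 2 - (norm (?a - y))\<^sup>2 / 2 = (?b - ?a) \<bullet> (?b - y) - (norm (?b - ?a))\<^sup>2 / 2"
    by (rule norm_sq_increment)
  also have "\<dots> \<le> (?b - ?a) \<bullet> (?b - y)" by simp
  also have "\<dots> \<le> h * (f ?a \<bullet> (?b - y))" by (rule euler_vi [OF y])
  also have "\<dots> \<le> h * B" using h Suc.prems [of n] by (intro mult_left_mono) auto
  finally show ?case using Suc by (simp add: algebra_simps)
qed simp

text \<open>The field is frozen at the first of the \<open>n\<close> steps. The error comes from the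
  drift of \<open>f\<close>, at most \<open>L\<close> times the distance travelled, and from the
  drift of the point, paired with a vector of norm at most \<open>M\<close>; within time \<tau> the
  distance is at most \<open>M * \<tau>\<close>.\<close>

lemma euler_evi:
  assumes y: "y \<in> K"
  shows "(norm (euler h p (k + n) - y))\<^sup>2 / 2 - (norm (euler h p k - y))\<^sup>2 / 2
    \<le> (real n * h) * (f (euler h p k) \<bullet> (euler h p k - y))
      + (real n * h)\<^sup>2 * (L * M * norm (euler h p k - y) + M\<^sup>2)"
proof -
  let ?x = "euler h p k" and ?\<tau> = "real n * h"
  have "f (euler h p (k + j)) \<bullet> (euler h p (Suc (k + j)) - y)
      \<le> f ?x \<bullet> (?x - y) + ?\<tau> * (L * M * norm (?x - y) + M\<^sup>2)" if j: "j < n" for j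
  proof -
    let ?a = "euler h p (k + j)" and ?b = "euler h p (Suc (k + j))"
    have "norm (f ?a - f ?x) \<le> L * (?\<tau> * M)"
      using f_diff [OF euler_in euler_in, of "k + j" k] euler_dist_le [of j n k] j L
      by (meson less_imp_le mult_left_mono order_trans)
    then have 1: "(f ?a - f ?x) \<bullet> (?x - y) \<le> L * (?\<tau> * M) * norm (?x - y)"
      by (intro order_trans [OF norm_cauchy_schwarz] mult_right_mono) auto
    have "norm (?b - ?x) \<le> ?\<tau> * M" using euler_dist_le [of "Suc j" n k] j by simp
    then have 2: "f ?a \<bullet> (?b - ?x) \<le> M * (?\<tau> * M)"
      using bound [OF euler_in] M by (intro order_trans [OF norm_cauchy_schwarz] mult_mono) auto
    have "f ?a \<bullet> (?b - y) = f ?x \<bullet> (?x - y) + (f ?a - f ?x) \<bullet> (?x - y) + f ?a \<bullet> (?b - ?x)"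
      by (simp add: inner_diff_left inner_diff_right)
    with 1 2 show ?thesis by (simp add: algebra_simps power2_eq_square)
  qed
  from euler_evi_bound [where n = n, OF y this] show ?thesis by (simp add: algebra_simps power2_eq_square)
qed

text \<open>Since \<open>f y - speed y\<close> is normal at \<open>y\<close>, only
  \<open>speed y\<close> and the Lipschitz error can drive the scheme away from \<open>y\<close>.
  Taken at \<open>y\<close> equal to the starting point of a trajectory, this bounds difference
  quotients by the projected velocity rather than by \<open>M\<close>.\<close>

lemma euler_approach:
  assumes y: "y \<in> K"
  shows "norm (euler h p (k + n) - y) \<le> norm (euler h p k - y)
    + (real n * h) * (norm (speed y) + L * (norm (euler h p k - y) + M * (real n * h)))"
proof -
  let ?x = "euler h p k" and ?\<tau> = "real n * h"
  define A where "A = norm (speed y) + L * (norm (?x - y) + M * ?\<tau>)"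
  have A: "norm (speed y) + L * norm (euler h p (k + j) - y) \<le> A" if "j < n" for j
  proof -
    have "norm (euler h p (k + j) - y) \<le> norm (?x - y) + norm (euler h p (k + j) - ?x)"
      using norm_triangle_ineq [of "?x - y" "euler h p (k + j) - ?x"] by simp
    also have "norm (euler h p (k + j) - ?x) \<le> M * ?\<tau>"
      using euler_dist_le [of j n k] that by (simp add: mult.commute)
    finally show ?thesis using L by (simp add: A_def mult_left_mono)
  qed
  have A0: "A \<ge> 0" using L M h by (auto simp: A_def intro!: add_nonneg_nonneg mult_nonneg_nonneg)
  have "norm (euler h p (k + j) - y) \<le> norm (?x - y) + real j * h * A" if "j \<le> n" for j
    using that
  proof (induction j)
    case (Suc j)
    let ?a = "euler h p (k + j)" and ?b = "euler h p (Suc (k + j))"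
    let ?\<rho> = "norm (?b - y)"
    have "(f y - speed y) \<bullet> (?b - y) \<le> 0"
      using proj_vec_normal [OF convex y, of "f y"] euler_in [of "Suc (k + j)"] by (auto simp: normal_cone_def)
    then have "f y \<bullet> (?b - y) \<le> norm (speed y) * ?\<rho>"
      using norm_cauchy_schwarz [of "speed y" "?b - y"] by (simp add: inner_diff_left)
    moreover have "(f ?a - f y) \<bullet> (?b - y) \<le> L * norm (?a - y) * ?\<rho>"
      using f_diff [OF euler_in y] by (intro order_trans [OF norm_cauchy_schwarz] mult_right_mono) auto
    ultimately have "f ?a \<bullet> (?b - y) \<le> (norm (speed y) + L * norm (?a - y)) * ?\<rho>"
      by (simp add: inner_diff_left algebra_simps)
    also have "\<dots> \<le> A * ?\<rho>" using A [of j] Suc.prems by (intro mult_right_mono) auto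
    finally have *: "h * (f ?a \<bullet> (?b - y)) \<le> h * A * ?\<rho>" using h by (simp add: mult.assoc)
    have "?\<rho> * ?\<rho> = (?b - ?a) \<bullet> (?b - y) + (?a - y) \<bullet> (?b - y)"
      by (simp add: power2_norm_eq_inner inner_diff_left flip: power2_eq_square)
    also have "\<dots> \<le> h * A * ?\<rho> + norm (?a - y) * ?\<rho>"
      using euler_vi [OF y, of "k + j"] * norm_cauchy_schwarz [of "?a - y" "?b - y"] by linarith
    finally have "?\<rho> * ?\<rho> \<le> (norm (?a - y) + h * A) * ?\<rho>" by (simp add: algebra_simps)
    then have "?\<rho> \<le> norm (?a - y) + h * A"
      using h A0 by (cases "?\<rho> = 0") auto
    also have "norm (?a - y) \<le> norm (?x - y) + real j * h * A" using Suc by simp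
    finally show ?case by (simp add: algebra_simps)
  qed simp
  from this [of n] show ?thesis by (simp add: A_def)
qed

end

subsection \<open>Solutions\<close>

text \<open>The first estimate encodes \<open>f (X s) - X' s \<in> N (X s)\<close> without mentioning derivatives, so that it is
  stable under uniform limits of Euler schemes; the second one bounds the speed by that of the
  projected field, which controls the norm of the derivative sharply.\<close>

definition flow_on :: "real \<Rightarrow> (real \<Rightarrow> 'a) \<Rightarrow> bool" where
  "flow_on T X \<longleftrightarrow> (\<forall>t\<in>{0..T}. X t \<in> K) \<and>
     (\<forall>s t. 0 \<le> s \<and> s \<le> t \<and> t \<le> T \<longrightarrow> norm (X t - X s) \<le> M * (t - s) \<and>
       (\<forall>y\<in>K. (norm (X t - y))\<^sup>2 / 2 - (norm (X s - y))\<^sup>2 / 2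
            \<le> (t - s) * (f (X s) \<bullet> (X s - y)) + (t - s)\<^sup>2 * (L * M * norm (X s - y) + M\<^sup>2) \<and>
          norm (X t - y) \<le> norm (X s - y) + (t - s) * (norm (speed y) + L * (norm (X s - y) + M * (t - s)))))"

lemma flow_onD:
  assumes "flow_on T X"
  shows "0 \<le> t \<Longrightarrow> t \<le> T \<Longrightarrow> X t \<in> K"
    and "0 \<le> s \<Longrightarrow> s \<le> t \<Longrightarrow> t \<le> T \<Longrightarrow> norm (X t - X s) \<le> M * (t - s)"
    and "0 \<le> s \<Longrightarrow> s \<le> t \<Longrightarrow> t \<le> T \<Longrightarrow> y \<in> K \<Longrightarrow> (norm (X t - y))\<^sup>2 / 2 - (norm (X s - y))\<^sup>2 / 2
            \<le> (t - s) * (f (X s) \<bullet> (X s - y)) + (t - s)\<^sup>2 * (L * M * norm (X s - y) + M\<^sup>2)"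
    and "0 \<le> s \<Longrightarrow> s \<le> t \<Longrightarrow> t \<le> T \<Longrightarrow> y \<in> K \<Longrightarrow>
          norm (X t - y) \<le> norm (X s - y) + (t - s) * (norm (speed y) + L * (norm (X s - y) + M * (t - s)))"
  using assms unfolding flow_on_def by auto

lemma flow_on_subinterval: "flow_on T X \<Longrightarrow> T' \<le> T \<Longrightarrow> flow_on T' X"
  unfolding flow_on_def by force

lemma flow_on_cong:
  assumes "flow_on T X" "\<And>t. 0 \<le> t \<Longrightarrow> t \<le> T \<Longrightarrow> Y t = X t"
  shows "flow_on T Y"
  using assms unfolding flow_on_def by simp

lemma flow_on_shift:
  assumes X: "flow_on T X" and a: "0 \<le> a"
  shows "flow_on (T - a) (\<lambda>t. X (a + t))"
  unfolding flow_on_def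
proof (intro conjI ballI allI impI)
  fix t assume "t \<in> {0..T - a}" then show "X (a + t) \<in> K" using a by (intro flow_onD [OF X]) auto
next
  fix s t assume st: "0 \<le> s \<and> s \<le> t \<and> t \<le> T - a"
  then show "norm (X (a + t) - X (a + s)) \<le> M * (t - s)"
    using flow_onD(2) [OF X, of "a + s" "a + t"] a by auto
  fix y assume y: "y \<in> K"
  from flow_onD(3,4) [OF X, of "a + s" "a + t" y] st a y
  show "(norm (X (a + t) - y))\<^sup>2 / 2 - (norm (X (a + s) - y))\<^sup>2 / 2
            \<le> (t - s) * (f (X (a + s)) \<bullet> (X (a + s) - y)) + (t - s)\<^sup>2 * (L * M * norm (X (a + s) - y) + M\<^sup>2)"
    "norm (X (a + t) - y) \<le> norm (X (a + s) - y) + (t - s) * (norm (speed y) + L * (norm (X (a + s) - y) + M * (t - s)))"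
    by auto
qed

text \<open>All defining estimates are nonstrict inequalities between continuous expressions, so
  pointwise convergence is enough. Rounding times down to nodes costs less than one step, so the
  elapsed number of steps times \<open>h n\<close> still tends to \<open>t - s\<close>.\<close>

lemma flow_on_limit:
  assumes h: "\<And>n. h n > 0" "h \<longlonglongrightarrow> 0" and p: "p \<in> K"
    and lim: "\<And>t. 0 \<le> t \<Longrightarrow> t \<le> T \<Longrightarrow> (\<lambda>n. euler (h n) p (nat \<lfloor>t / h n\<rfloor>)) \<longlonglongrightarrow> X t"
  shows "flow_on T X"
proof -
  define m where "m t n = nat \<lfloor>t / h n\<rfloor>" for t n
  define Y where "Y t n = euler (h n) p (m t n)" for t n
  have Y: "Y t \<longlonglongrightarrow> X t" if "0 \<le> t" "t \<le> T" for t
    using lim [OF that] by (simp add: Y_def [abs_def] m_def)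
  have YK: "Y t n \<in> K" for t n unfolding Y_def by (rule euler_in [OF h(1) p])
  have XK: "X t \<in> K" if "0 \<le> t" "t \<le> T" for t
    by (rule closed_sequentially [OF closed YK Y [OF that]])
  have fY: "(\<lambda>n. f (Y t n)) \<longlonglongrightarrow> f (X t)" if "0 \<le> t" "t \<le> T" for t
    by (rule continuous_on_tendsto_compose [OF f_cont Y [OF that] XK [OF that]]) (simp add: YK)
  have mh: "(\<lambda>n. real (m t n) * h n) \<longlonglongrightarrow> t" if "0 \<le> t" for t
  proof -
    have "\<bar>real (m t n) * h n - t\<bar> \<le> h n" for n
    proof -
      have "real (m t n) = of_int \<lfloor>t / h n\<rfloor>" using that h(1) [of n] by (simp add: m_def)
      then have "real (m t n) \<le> t / h n" "t / h n < real (m t n) + 1" by linarith+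
      then show ?thesis using h(1) [of n] by (simp add: field_simps abs_le_iff)
    qed
    then have "(\<lambda>n. real (m t n) * h n - t) \<longlonglongrightarrow> 0"
      by (intro Lim_null_comparison [OF _ h(2)] always_eventually) auto
    then show ?thesis by (rule LIM_zero_cancel)
  qed
  show ?thesis
    unfolding flow_on_def
  proof (intro conjI ballI allI impI)
    fix t assume "t \<in> {0..T}" then show "X t \<in> K" using XK by simp
  next
    fix s t assume st: "0 \<le> s \<and> s \<le> t \<and> t \<le> T"
    then have st': "0 \<le> s" "s \<le> T" "0 \<le> t" "t \<le> T" by auto
    have ms: "m s n \<le> m t n" for n
      unfolding m_def using st h(1) [of n] by (intro nat_mono floor_mono divide_right_mono) auto
    define \<tau> where "\<tau> n = real (m t n - m s n) * h n" for n
    have "\<tau> = (\<lambda>n. real (m t n) * h n - real (m s n) * h n)"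
      using ms by (auto simp: \<tau>_def of_nat_diff algebra_simps)
    then have \<tau>: "\<tau> \<longlonglongrightarrow> t - s" using mh st' by (auto intro: tendsto_diff)
    note lims = Y [OF st'(1,2)] Y [OF st'(3,4)] fY [OF st'(1,2)] \<tau>
    have "norm (Y t n - Y s n) \<le> \<tau> n * M" for n
      using euler_dist [OF h(1) p, of n "m s n" "m t n - m s n"] ms by (simp add: Y_def \<tau>_def)
    then have "norm (X t - X s) \<le> (t - s) * M"
      by (intro LIMSEQ_le [of "\<lambda>n. norm (Y t n - Y s n)" _ "\<lambda>n. \<tau> n * M"] tendsto_intros lims) auto
    then show "norm (X t - X s) \<le> M * (t - s)" by (simp add: mult.commute)
    fix y assume y: "y \<in> K"
    have "(norm (Y t n - y))\<^sup>2 / 2 - (norm (Y s n - y))\<^sup>2 / 2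
            \<le> \<tau> n * (f (Y s n) \<bullet> (Y s n - y)) + (\<tau> n)\<^sup>2 * (L * M * norm (Y s n - y) + M\<^sup>2)" for n
      using euler_evi [OF h(1) p y, of n "m s n" "m t n - m s n"] ms by (simp add: Y_def \<tau>_def)
    then show "(norm (X t - y))\<^sup>2 / 2 - (norm (X s - y))\<^sup>2 / 2
            \<le> (t - s) * (f (X s) \<bullet> (X s - y)) + (t - s)\<^sup>2 * (L * M * norm (X s - y) + M\<^sup>2)"
      by (intro LIMSEQ_le [of "\<lambda>n. (norm (Y t n - y))\<^sup>2 / 2 - (norm (Y s n - y))\<^sup>2 / 2" _
          "\<lambda>n. \<tau> n * (f (Y s n) \<bullet> (Y s n - y)) + (\<tau> n)\<^sup>2 * (L * M * norm (Y s n - y) + M\<^sup>2)"] tendsto_intros lims) auto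
    have "norm (Y t n - y) \<le> norm (Y s n - y) + \<tau> n * (norm (speed y) + L * (norm (Y s n - y) + M * \<tau> n))" for n
      using euler_approach [OF h(1) p y, of n "m s n" "m t n - m s n"] ms by (simp add: Y_def \<tau>_def)
    then show "norm (X t - y) \<le> norm (X s - y) + (t - s) * (norm (speed y) + L * (norm (X s - y) + M * (t - s)))"
      by (intro LIMSEQ_le [of "\<lambda>n. norm (Y t n - y)" _
         "\<lambda>n. norm (Y s n - y) + \<tau> n * (norm (speed y) + L * (norm (Y s n - y) + M * \<tau> n))"] tendsto_intros lims) auto
  qed
qed

text \<open>The interpolations only supply compactness: being \<open>M\<close>-Lipschitz, they have
  a uniformly convergent subsequence by Arzela-Ascoli. The Euler points differ from them by at most
  \<open>M * h\<close>, share the limit, and satisfy the estimates to be passed on.\<close>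

lemma flow_on_exists:
  assumes p: "p \<in> K" and T: "T > 0"
  shows "\<exists>X. flow_on T X \<and> X 0 = p"
proof -
  \<comment> \<open>Exactly \<open>Suc n\<close> steps exhaust the interval, so for
    \<open>t \<le> T\<close> the node index never exceeds the number of summands in
    \<open>Z\<close>.\<close>
  define h where "h n = T / real (Suc n)" for n
  have h: "h n > 0" for n using T by (simp add: h_def)
  have h0: "h \<longlonglongrightarrow> 0"
    using tendsto_mult_right_zero [OF LIMSEQ_inverse_real_of_nat, of T] by (simp add: h_def [abs_def] field_simps)
  define x where "x n = euler (h n) p" for n
  \<comment> \<open>the piecewise linear interpolation of the Euler points\<close>
  define Z where "Z n t = p + (\<Sum>j<Suc n. clamp01 (t / h n - real j) *\<^sub>R (x n (Suc j) - x n j))" for n t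
  have Z_lip: "norm (Z n t - Z n s) \<le> M * (t - s)" if "0 \<le> s" "s \<le> t" for n s t
  proof -
    have q: "0 \<le> s / h n" "s / h n \<le> t / h n" "0 \<le> t / h n" using that h [of n] by (auto intro: divide_right_mono)
    have "Z n t - Z n s = (\<Sum>j<Suc n. (clamp01 (t / h n - real j) - clamp01 (s / h n - real j)) *\<^sub>R (x n (Suc j) - x n j))"
      by (simp add: Z_def sum_subtractf [symmetric] scaleR_diff_left del: sum.lessThan_Suc)
    also have "norm \<dots> \<le> (\<Sum>j<Suc n. (clamp01 (t / h n - real j) - clamp01 (s / h n - real j)) * (h n * M))"
    proof (intro sum_norm_le)
      fix j
      have "0 \<le> clamp01 (t / h n - real j) - clamp01 (s / h n - real j)" using q by (simp add: clamp01_mono)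
      then show "norm ((clamp01 (t / h n - real j) - clamp01 (s / h n - real j)) *\<^sub>R (x n (Suc j) - x n j))
         \<le> (clamp01 (t / h n - real j) - clamp01 (s / h n - real j)) * (h n * M)"
        using euler_step [OF h p, of n j] by (simp add: x_def mult_left_mono del: euler.simps)
    qed
    also have "\<dots> = (min (t / h n) (real (Suc n)) - min (s / h n) (real (Suc n))) * (h n * M)"
      using q by (simp add: sum_distrib_right [symmetric] sum_subtractf sum_clamp01 del: sum.lessThan_Suc)
    also have "\<dots> \<le> (t / h n - s / h n) * (h n * M)"
      using q h [of n] M by (intro mult_right_mono) auto
    also have "\<dots> = M * (t - s)" using h [of n] by (simp add: field_simps)
    finally show ?thesis .
  qed
  have Z0: "Z n 0 = p" for n
    using sum_clamp01_nat [of 0 "Suc n" "\<lambda>j. x n (Suc j) - x n j"] by (simp add: Z_def del: sum.lessThan_Suc)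
  have Z_node: "Z n (real k * h n) = x n k" if "k \<le> Suc n" for n k
  proof -
    have "Z n (real k * h n) = p + (\<Sum>j<k. x n (Suc j) - x n j)"
      using sum_clamp01_nat [OF that, of "\<lambda>j. x n (Suc j) - x n j"] h [of n] by (simp add: Z_def del: sum.lessThan_Suc)
    also have "\<dots> = p + (x n k - x n 0)" by (subst sum_lessThan_telescope) (rule refl)
    also have "\<dots> = x n k" by (simp add: x_def)
    finally show ?thesis .
  qed
  obtain X r where X: "continuous_on {0..T} X" and r: "strict_mono (r :: nat \<Rightarrow> nat)"
    and conv: "\<And>e. 0 < e \<Longrightarrow> \<exists>N. \<forall>n t. n \<ge> N \<and> t \<in> {0..T} \<longrightarrow> norm (Z (r n) t - X t) < e"
  proof (rule Arzela_Ascoli [of "{0..T}" Z "norm p + M * T"])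
    show "norm (Z n t) \<le> norm p + M * T" if "t \<in> {0..T}" for n t
    proof -
      have "norm (Z n t - Z n 0) \<le> M * T"
        using Z_lip [of 0 t n] that M by (auto intro: order_trans mult_left_mono)
      then show ?thesis using norm_triangle_sub [of "Z n t" p] by (simp add: Z0)
    qed
    show "\<exists>d>0. \<forall>n t'. t' \<in> {0..T} \<and> norm (t - t') < d \<longrightarrow> norm (Z n t - Z n t') < e"
      if t: "t \<in> {0..T}" and e: "0 < e" for t e
    proof (intro exI conjI allI impI)
      show "e / (M + 1) > 0" using e M by simp
      fix n t' assume t': "t' \<in> {0..T} \<and> norm (t - t') < e / (M + 1)"
      have "norm (Z n t - Z n t') \<le> M * \<bar>t - t'\<bar>"
        using Z_lip [of t t' n] Z_lip [of t' t n] t t' by (cases "t \<le> t'") (auto simp: norm_minus_commute)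
      also have "\<dots> \<le> M * (e / (M + 1))" using t' M by (intro mult_left_mono) auto
      also have "\<dots> < e" using e M by (simp add: field_simps)
      finally show "norm (Z n t - Z n t') < e" .
    qed
  qed (blast intro: compact_Icc)+
  have ZX: "(\<lambda>n. Z (r n) t) \<longlonglongrightarrow> X t" if "0 \<le> t" "t \<le> T" for t
    unfolding LIMSEQ_iff using conv that by (metis atLeastAtMost_iff)
  have hr: "(\<lambda>n. h (r n)) \<longlonglongrightarrow> 0" using LIMSEQ_subseq_LIMSEQ [OF h0 r] by (simp add: o_def)
  have "flow_on T X"
  proof (rule flow_on_limit [of "\<lambda>n. h (r n)", OF h hr p])
    fix t assume t: "0 \<le> t" "t \<le> T"
    let ?k = "\<lambda>n. nat \<lfloor>t / h (r n)\<rfloor>"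
    have close: "norm (x (r n) (?k n) - Z (r n) t) \<le> M * h (r n)" for n
    proof -
      have hn: "h (r n) > 0" by (rule h)
      have k: "real (?k n) = of_int \<lfloor>t / h (r n)\<rfloor>" using t hn by simp
      then have "real (?k n) \<le> t / h (r n)" "t / h (r n) < real (?k n) + 1" by linarith+
      then have k2: "real (?k n) * h (r n) \<le> t" "t - real (?k n) * h (r n) \<le> h (r n)"
        using hn by (simp_all add: field_simps)
      have "t / h (r n) \<le> real (Suc (r n))"
        using t T mult_right_mono [of t T "real (Suc (r n))"] by (simp add: h_def divide_simps del: of_nat_Suc)
      with \<open>real (?k n) \<le> t / h (r n)\<close> have "real (?k n) \<le> real (Suc (r n))" by (rule order_trans)
      then have "?k n \<le> Suc (r n)" by (simp only: of_nat_le_iff)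
      then have "norm (x (r n) (?k n) - Z (r n) t) = norm (Z (r n) t - Z (r n) (real (?k n) * h (r n)))"
        by (simp add: Z_node norm_minus_commute)
      also have "\<dots> \<le> M * (t - real (?k n) * h (r n))" using k2 hn by (intro Z_lip) auto
      also have "\<dots> \<le> M * h (r n)" using k2 M by (intro mult_left_mono)
      finally show ?thesis .
    qed
    have "(\<lambda>n. x (r n) (?k n) - Z (r n) t) \<longlonglongrightarrow> 0"
      by (rule Lim_null_comparison [OF always_eventually [OF allI [OF close]] tendsto_mult_right_zero [OF hr]])
    from tendsto_add [OF this ZX [OF t]] show "(\<lambda>n. euler (h (r n)) p (?k n)) \<longlonglongrightarrow> X t"
      by (simp add: x_def)
  qed
  moreover have "X 0 = p"
    using ZX [of 0] T by (simp add: Z0 LIMSEQ_const_iff)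
  ultimately show ?thesis by blast
qed

subsection \<open>Right derivative and stability\<close>

lemma flow_on_lipschitz: "flow_on T X \<Longrightarrow> M-lipschitz_on {0..T} X"
proof (rule lipschitz_onI)
  fix s t assume X: "flow_on T X" and "s \<in> {0..T}" "t \<in> {0..T}"
  then show "dist (X s) (X t) \<le> M * dist s t"
    using flow_onD(2) [OF X, of s t] flow_onD(2) [OF X, of t s]
    by (cases "s \<le> t") (auto simp: dist_norm norm_minus_commute)
qed (rule M)

lemma flow_on_continuous: "flow_on T X \<Longrightarrow> continuous_on {0..T} X"
  by (rule lipschitz_on_continuous_on [OF flow_on_lipschitz])

text \<open>The two defining estimates of \<open>flow_on\<close> bound the difference quotients at time \<open>s\<close> by the norm of
  the projected velocity and force every limit point \<open>w\<close> to satisfy \<open>f (X s) - w \<in> N\<close>; these two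
  properties single out the projection.\<close>

lemma flow_on_right_derivative:
  assumes X: "flow_on T X" and s: "0 \<le> s" "s < T"
  shows "(X has_vector_derivative speed (X s)) (at_right s)"
  unfolding has_vector_derivative_iff_quotient
proof (rule proj_vec_tendstoI [OF convex])
  show XK: "X s \<in> K" using flow_onD(1) [OF X] s by simp
  let ?q = "\<lambda>t. (1 / (t - s)) *\<^sub>R (X t - X s)"
  let ?r = "\<lambda>t. norm (speed (X s)) + L * (M * (t - s))"
  have ev: "eventually (\<lambda>t. s < t \<and> t < T) (at_right s)"
    using eventually_at_right_less [of s] eventually_at_right_field s(2) by (auto simp: eventually_at_right_field intro: exI [of _ T])
  show "(?r \<longlongrightarrow> norm (speed (X s))) (at_right s)"
    by (rule tendsto_eq_intros refl | simp)+
  show "eventually (\<lambda>t. norm (?q t) \<le> ?r t) (at_right s)"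
    using ev
  proof eventually_elim
    case (elim t)
    then have "norm (X t - X s) \<le> (t - s) * ?r t"
      using flow_onD(4) [OF X s(1) _ _ XK, of t] by auto
    with elim show ?case by (simp add: divide_simps mult.commute)
  qed
  fix y assume y: "y \<in> K"
  let ?r = "\<lambda>t. f (X s) \<bullet> (X s - y) + (t - s) * (L * M * norm (X s - y) + M\<^sup>2)"
  have "(?r \<longlongrightarrow> f (X s) \<bullet> (X s - y)) (at_right s)"
    by (rule tendsto_eq_intros refl | simp)+
  moreover have "eventually (\<lambda>t. ?q t \<bullet> (X s - y) \<le> ?r t) (at_right s)"
    using ev
  proof eventually_elim
    case (elim t)
    let ?D = "X t - X s"
    have "?D \<bullet> (X s - y) \<le> (norm (X t - y))\<^sup>2 / 2 - (norm (X s - y))\<^sup>2 / 2"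
    proof -
      have "?D \<bullet> (X t - y) = ?D \<bullet> (X s - y) + (norm ?D)\<^sup>2"
        by (simp add: power2_norm_eq_inner inner_diff_right)
      then show ?thesis using norm_sq_increment [of "X t" y "X s"] zero_le_power2 [of "norm ?D"] by linarith
    qed
    also have "\<dots> \<le> (t - s) * ?r t"
      using flow_onD(3) [OF X s(1) _ _ y, of t] elim by (simp add: algebra_simps power2_eq_square)
    finally show ?case using elim by (simp add: divide_simps mult.commute)
  qed
  ultimately show "\<exists>r. (r \<longlongrightarrow> f (X s) \<bullet> (X s - y)) (at_right s) \<and>
      eventually (\<lambda>t. ?q t \<bullet> (X s - y) \<le> r t) (at_right s)" by blast
qed

text \<open>One-sided Lipschitz continuity, which is what a Gronwall argument needs, holds even
  where the projected field jumps.\<close>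

lemma speed_monotone:
  assumes "x \<in> K" "y \<in> K"
  shows "(speed x - speed y) \<bullet> (x - y) \<le> L * (norm (x - y))\<^sup>2"
proof -
  have "(speed x - speed y) \<bullet> (x - y) \<le> (f x - f y) \<bullet> (x - y)"
    by (rule proj_vec_monotone [OF convex assms])
  also have "\<dots> \<le> L * norm (x - y) * norm (x - y)"
    using f_diff [OF assms] by (intro order_trans [OF norm_cauchy_schwarz] mult_right_mono) auto
  finally show ?thesis by (simp add: power2_eq_square mult.assoc)
qed

text \<open>The squared distance weighted by \<open>exp (- 2 * L * s)\<close> is continuous and has
  a nonpositive right derivative at every time, so the Dini argument applies without two-sided
  differentiability.\<close>

lemma flow_on_stability:
  assumes X: "flow_on T X" and Y: "flow_on T Y" and t: "0 \<le> t" "t \<le> T"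
  shows "norm (X t - Y t) \<le> exp (L * t) * norm (X 0 - Y 0)"
proof -
  define \<phi> where "\<phi> s = exp (- 2 * L * s) * ((X s - Y s) \<bullet> (X s - Y s)) - (X 0 - Y 0) \<bullet> (X 0 - Y 0)" for s
  have "\<phi> t \<le> 0"
  proof (rule dini_nonpos_deriv [of 0 t \<phi> 1])
    show "continuous_on {0..t} \<phi>"
      unfolding \<phi>_def using t
      by (intro continuous_intros continuous_on_subset [OF flow_on_continuous [OF X]]
          continuous_on_subset [OF flow_on_continuous [OF Y]]) auto
    fix r assume r: "0 \<le> r" "r < t"
    let ?Z = "X r - Y r" and ?V = "speed (X r) - speed (Y r)"
    let ?D = "exp (- 2 * L * r) * (2 * (?V \<bullet> ?Z) - 2 * L * (?Z \<bullet> ?Z))"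
    have dX: "(X has_vector_derivative speed (X r)) (at_right r)" "(Y has_vector_derivative speed (Y r)) (at_right r)"
      using flow_on_right_derivative [OF X] flow_on_right_derivative [OF Y] r t by auto
    have dZ: "((\<lambda>s. (X s - Y s) \<bullet> (X s - Y s)) has_real_derivative 2 * (?V \<bullet> ?Z)) (at_right r)"
      using bounded_bilinear.has_vector_derivative [OF bounded_bilinear_inner
          has_vector_derivative_diff [OF dX] has_vector_derivative_diff [OF dX]]
      by (simp add: has_real_derivative_iff_has_vector_derivative inner_commute)
    have "(\<phi> has_real_derivative ?D) (at_right r)"
      unfolding \<phi>_def by (rule derivative_eq_intros dZ refl | simp add: algebra_simps)+
    moreover have "?D \<le> 0"
      using speed_monotone [of "X r" "Y r"] flow_onD(1) [OF X] flow_onD(1) [OF Y] r t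
      by (intro mult_nonneg_nonpos) (auto simp: power2_norm_eq_inner)
    ultimately show "\<exists>D\<le>0. (\<phi> has_vector_derivative D) (at_right r)"
      by (auto simp: has_real_derivative_iff_has_vector_derivative)
  qed (use t in \<open>auto simp: \<phi>_def\<close>)
  then have "exp (- 2 * L * t) * (norm (X t - Y t))\<^sup>2 \<le> (norm (X 0 - Y 0))\<^sup>2"
    by (simp add: \<phi>_def power2_norm_eq_inner)
  then have "(norm (X t - Y t))\<^sup>2 \<le> exp (2 * L * t) * (norm (X 0 - Y 0))\<^sup>2"
    by (simp add: exp_minus field_simps)
  also have "\<dots> = (exp (L * t) * norm (X 0 - Y 0))\<^sup>2"
    by (simp add: power_mult_distrib mult.assoc flip: exp_double)
  finally show ?thesis by (rule power2_le_imp_le) simp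
qed

lemma flow_on_unique:
  assumes "flow_on T X" "flow_on T Y" "X 0 = Y 0" "0 \<le> t" "t \<le> T"
  shows "X t = Y t"
  using flow_on_stability [OF assms(1,2,4,5)] assms(3) by simp

subsection \<open>The semiflow\<close>

definition is_flow :: "(real \<Rightarrow> 'a) \<Rightarrow> bool" where
  "is_flow X \<longleftrightarrow> (\<forall>T>0. flow_on T X)"

lemma is_flow_exists:
  assumes p: "p \<in> K"
  shows "\<exists>X. is_flow X \<and> X 0 = p"
proof -
  have "\<exists>X. flow_on (real (Suc n)) X \<and> X 0 = p" for n
    by (rule flow_on_exists [OF p]) simp
  then obtain X where X: "\<And>n. flow_on (real (Suc n)) (X n)" "\<And>n. X n 0 = p" by metis
  \<comment> \<open>Any solution whose interval reaches \<open>t\<close> gives the same value by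
    uniqueness; the ceiling selects one of them.\<close>
  define Y where "Y t = X (nat \<lceil>t\<rceil>) t" for t
  have YX: "Y t = X n t" if "0 \<le> t" "t \<le> real (Suc n)" for n t
  proof -
    define k where "k = nat \<lceil>t\<rceil>"
    have k: "t \<le> real (Suc k)" using real_nat_ceiling_ge [of t] by (simp add: k_def)
    have "X k t = X n t"
      by (rule flow_on_unique [of t])
        (use X flow_on_subinterval [OF X(1) k] flow_on_subinterval [OF X(1) that(2)] that(1) in auto)
    then show ?thesis by (simp add: Y_def k_def)
  qed
  have "flow_on T Y" if "T > 0" for T
  proof -
    obtain n where n: "T \<le> real n" using real_arch_simple by blast
    then have "flow_on T (X n)" by (intro flow_on_subinterval [OF X(1)]) simp
    from flow_on_cong [OF this] show ?thesis using n YX by simp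
  qed
  moreover have "Y 0 = p" using YX [of 0 0] X by simp
  ultimately show ?thesis unfolding is_flow_def by blast
qed

text \<open>For \<open>p\<close> in \<open>K\<close> the choice is determined at times
  \<open>t \<ge> 0\<close>, and only there.\<close>

definition flow :: "'a \<Rightarrow> real \<Rightarrow> 'a" where
  "flow p = (SOME X. is_flow X \<and> X 0 = p)"

context
  fixes p assumes p: "p \<in> K"
begin

lemma is_flow_flow: "is_flow (flow p)" and flow_0: "flow p 0 = p"
  using someI_ex [OF is_flow_exists [OF p]] by (auto simp: flow_def)

lemma flow_on_flow: "flow_on T (flow p)"
proof (cases "T > 0")
  case False
  then show ?thesis using is_flow_flow flow_on_subinterval [of 1 "flow p" T] by (auto simp: is_flow_def)
qed (use is_flow_flow in \<open>simp add: is_flow_def\<close>)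

lemma flow_in: "t \<ge> 0 \<Longrightarrow> flow p t \<in> K"
  using flow_onD(1) [OF flow_on_flow, of t t] by simp

lemma flow_lipschitz: "0 \<le> s \<Longrightarrow> s \<le> t \<Longrightarrow> norm (flow p t - flow p s) \<le> M * (t - s)"
  using flow_onD(2) [OF flow_on_flow, of s t t] by simp

lemma flow_continuous: "continuous_on {0..T} (flow p)"
  by (rule flow_on_continuous [OF flow_on_flow])

lemma flow_right_derivative:
  "t \<ge> 0 \<Longrightarrow> (flow p has_vector_derivative speed (flow p t)) (at_right t)"
  by (rule flow_on_right_derivative [OF flow_on_flow [of "t + 1"]]) auto

end

lemma flow_stability:
  assumes "p \<in> K" "q \<in> K" "t \<ge> 0"
  shows "norm (flow p t - flow q t) \<le> exp (L * t) * norm (p - q)"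
  using flow_on_stability [OF flow_on_flow [OF assms(1)] flow_on_flow [OF assms(2)], of t t] assms
  by (simp add: flow_0)

lemma flow_flow:
  assumes p: "p \<in> K" and "s \<ge> 0" "t \<ge> 0"
  shows "flow (flow p s) t = flow p (s + t)"
proof (rule flow_on_unique [of t "flow (flow p s)" "\<lambda>t. flow p (s + t)" t])
  show "flow_on t (flow (flow p s))" by (intro flow_on_flow flow_in assms)
  show "flow_on t (\<lambda>t. flow p (s + t))" using flow_on_shift [OF flow_on_flow [OF p, of "s + t"] assms(2)] by simp
qed (use assms flow_0 flow_in in auto)

subsection \<open>Differentiability outside a countable set\<close>

text \<open>By the semigroup law the trajectories issued from the states at times \<open>s\<close>
  and \<open>s + h\<close> are shifts of one another. Stability compares their increments after time
  \<open>t\<close> with those at the start; dividing by \<open>h\<close> gives speeds in the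
  limit.\<close>

lemma speed_decay:
  assumes p: "p \<in> K" and s: "0 \<le> s" and t: "0 \<le> t"
  shows "norm (speed (flow p (s + t))) \<le> exp (L * t) * norm (speed (flow p s))"
proof -
  let ?q = "\<lambda>r h. (1 / (h - r)) *\<^sub>R (flow p h - flow p r)"
  have q: "((\<lambda>h. norm (?q r (r + h))) \<longlongrightarrow> norm (speed (flow p r))) (at_right 0)" if "r \<ge> 0" for r
  proof -
    have "(?q r \<longlongrightarrow> speed (flow p r)) (at_right r)"
      using flow_right_derivative [OF p that] by (simp add: has_vector_derivative_iff_quotient)
    then have "((\<lambda>h. ?q r (h + r)) \<longlongrightarrow> speed (flow p r)) (at_right 0)"
      using at_right_to_0 [of r] by (simp add: filterlim_filtermap)
    from tendsto_norm [OF this] show ?thesis by (simp add: add.commute)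
  qed
  have "eventually (\<lambda>h. norm (?q (s + t) (s + t + h)) \<le> exp (L * t) * norm (?q s (s + h))) (at_right 0)"
    using eventually_at_right_less
  proof eventually_elim
    case (elim h)
    have "norm (flow (flow p (s + h)) t - flow (flow p s) t) \<le> exp (L * t) * norm (flow p (s + h) - flow p s)"
      using elim s t p by (intro flow_stability flow_in) auto
    then have "norm (flow p (s + t + h) - flow p (s + t)) \<le> exp (L * t) * norm (flow p (s + h) - flow p s)"
      using elim s t p by (simp add: flow_flow algebra_simps)
    then show ?case using elim by (simp add: divide_right_mono)
  qed
  then show ?thesis
    using tendsto_le [OF trivial_limit_at_right_real tendsto_mult_left [OF q [OF s]] q] s t by simp
qed

text \<open>Here \<open>exp (- L t) |speed|\<close> is nonincreasing, hence continuous outside a countable set.\<close>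

lemma countable_speed_discontinuities:
  assumes p: "p \<in> K"
  shows "countable {t \<in> {0<..}. \<not> isCont (\<lambda>t. norm (speed (flow p t))) t}"
proof -
  define m where "m t = - (exp (- L * t) * norm (speed (flow p t)))" for t
  have "mono_on {0<..} m"
  proof (rule mono_onI)
    fix s t :: real assume "s \<in> {0<..}" "t \<in> {0<..}" "s \<le> t"
    then have "norm (speed (flow p t)) \<le> exp (L * (t - s)) * norm (speed (flow p s))"
      using speed_decay [OF p, of s "t - s"] by simp
    then have "exp (- L * t) * norm (speed (flow p t)) \<le> exp (- L * t) * (exp (L * (t - s)) * norm (speed (flow p s)))"
      by (intro mult_left_mono) auto
    also have "\<dots> = exp (- L * s) * norm (speed (flow p s))"
      by (simp add: mult.assoc [symmetric] exp_add [symmetric] algebra_simps)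
    finally show "m s \<le> m t" by (simp add: m_def)
  qed
  then have "countable {t \<in> {0<..}. \<not> isCont m t}"
    by (intro mono_on_ctble_discont_open) auto
  moreover have "isCont (\<lambda>t. norm (speed (flow p t))) t" if "isCont m t" for t
  proof -
    have "isCont (\<lambda>t. - (exp (L * t) * m t)) t" by (intro continuous_intros that)
    also have "(\<lambda>t. - (exp (L * t) * m t)) = (\<lambda>t. norm (speed (flow p t)))"
      by (simp add: m_def fun_eq_iff mult.assoc [symmetric] exp_add [symmetric])
    finally show ?thesis .
  qed
  then have "{t \<in> {0<..}. \<not> isCont (\<lambda>t. norm (speed (flow p t))) t} \<subseteq> {t \<in> {0<..}. \<not> isCont m t}" by blast
  ultimately show ?thesis by (rule countable_subset [rotated])
qed

text \<open>Looking backwards, the approach estimate is applied at the earlier state, so the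
  quotient is bounded by the speed at time \<open>s < t\<close>. Only continuity of the speed at
  \<open>t\<close> turns this into the norm of the projected field at \<open>t\<close>, as
  \<open>proj_vec_tendstoI\<close> demands.\<close>

lemma flow_left_derivative:
  assumes p: "p \<in> K" and t: "t > 0" and cont: "isCont (\<lambda>t. norm (speed (flow p t))) t"
  shows "(flow p has_vector_derivative speed (flow p t)) (at_left t)"
  unfolding has_vector_derivative_iff_quotient
proof (rule proj_vec_tendstoI [OF convex])
  let ?X = "flow p"
  show XK: "?X t \<in> K" using flow_in [OF p] t by simp
  let ?q = "\<lambda>s. (1 / (s - t)) *\<^sub>R (?X s - ?X t)"
  let ?r = "\<lambda>s. norm (speed (?X s)) + L * (M * (t - s))"
  have ev: "eventually (\<lambda>s. 0 < s \<and> s < t) (at_left t)"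
    using t by (auto simp: eventually_at_left_field intro: exI [of _ 0])
  have sp: "((\<lambda>s. norm (speed (?X s))) \<longlongrightarrow> norm (speed (?X t))) (at_left t)"
    using cont unfolding isCont_def by (rule tendsto_within_subset) auto
  have "(?r \<longlongrightarrow> norm (speed (?X t)) + L * (M * (t - t))) (at_left t)"
    by (intro tendsto_intros sp)
  then show "(?r \<longlongrightarrow> norm (speed (?X t))) (at_left t)" by simp
  have q: "?q s = (1 / (t - s)) *\<^sub>R (?X t - ?X s)" for s
  proof -
    have "1 / (s - t) = - (1 / (t - s))" by (metis minus_diff_eq minus_divide_right)
    then show ?thesis by (simp add: algebra_simps)
  qed
  show "eventually (\<lambda>s. norm (?q s) \<le> ?r s) (at_left t)"
    using ev
  proof eventually_elim
    case (elim s)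
    then have "norm (?X t - ?X s) \<le> (t - s) * ?r s"
      using flow_onD(4) [OF flow_on_flow [OF p], of s t t "?X s"] flow_in [OF p, of s] by auto
    with elim show ?case unfolding q by (simp add: divide_simps mult.commute)
  qed
  fix y assume y: "y \<in> K"
  \<comment> \<open>The increment is now paired with the vector at its end point, so the square of
    the increment has the unfavorable sign; this is the extra \<open>M\<^sup>2 / 2\<close>.\<close>
  let ?r = "\<lambda>s. f (?X s) \<bullet> (?X s - y) + (t - s) * (L * M * norm (?X s - y) + M\<^sup>2 + M\<^sup>2 / 2)"
  have X: "(?X \<longlongrightarrow> ?X t) (at_left t)"
  proof -
    have "(?X \<longlongrightarrow> ?X t) (at t within {0..t})"
      using flow_continuous [OF p, of t] t by (simp add: continuous_on_def)
    then show ?thesis using at_within_Icc_at_left t by metis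
  qed
  have fX: "((\<lambda>s. f (?X s)) \<longlongrightarrow> f (?X t)) (at_left t)"
  proof (rule continuous_on_tendsto_compose [OF f_cont X XK])
    show "eventually (\<lambda>s. ?X s \<in> K) (at_left t)"
      using ev by eventually_elim (simp add: flow_in [OF p])
  qed
  have "(?r \<longlongrightarrow> f (?X t) \<bullet> (?X t - y) + (t - t) * (L * M * norm (?X t - y) + M\<^sup>2 + M\<^sup>2 / 2)) (at_left t)"
    by (intro tendsto_intros fX X)
  then have "(?r \<longlongrightarrow> f (?X t) \<bullet> (?X t - y)) (at_left t)" by simp
  moreover have "eventually (\<lambda>s. ?q s \<bullet> (?X t - y) \<le> ?r s) (at_left t)"
    using ev
  proof eventually_elim
    case (elim s)
    let ?D = "?X t - ?X s"
    have "(norm ?D)\<^sup>2 \<le> (M * (t - s))\<^sup>2"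
      using flow_lipschitz [OF p, of s t] elim by (intro power_mono) auto
    then have "?D \<bullet> (?X t - y) \<le> (norm (?X t - y))\<^sup>2 / 2 - (norm (?X s - y))\<^sup>2 / 2 + (M * (t - s))\<^sup>2 / 2"
      by (simp add: norm_sq_increment)
    also have "\<dots> \<le> (t - s) * (f (?X s) \<bullet> (?X s - y)) + (t - s)\<^sup>2 * (L * M * norm (?X s - y) + M\<^sup>2) + (M * (t - s))\<^sup>2 / 2"
      using flow_onD(3) [OF flow_on_flow [OF p] _ _ _ y, of s t t] elim by simp
    also have "\<dots> = (t - s) * ?r s"
      by (simp add: field_simps power2_eq_square)
    finally show ?case unfolding q using elim by (simp add: divide_simps mult.commute)
  qed
  ultimately show "\<exists>r. (r \<longlongrightarrow> f (?X t) \<bullet> (?X t - y)) (at_left t) \<and>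
      eventually (\<lambda>s. ?q s \<bullet> (?X t - y) \<le> r s) (at_left t)" by blast
qed

lemma flow_derivative:
  assumes p: "p \<in> K"
  obtains N where "countable N" "\<And>t. t > 0 \<Longrightarrow> t \<notin> N \<Longrightarrow> (flow p has_vector_derivative speed (flow p t)) (at t)"
proof
  show "countable {t \<in> {0<..}. \<not> isCont (\<lambda>t. norm (speed (flow p t))) t}"
    by (rule countable_speed_discontinuities [OF p])
  fix t :: real assume t: "t > 0" "t \<notin> {t \<in> {0<..}. \<not> isCont (\<lambda>t. norm (speed (flow p t))) t}"
  then have "(flow p has_vector_derivative speed (flow p t)) (at_left t)"
    by (intro flow_left_derivative [OF p]) auto
  moreover have "(flow p has_vector_derivative speed (flow p t)) (at_right t)"
    using t by (intro flow_right_derivative [OF p]) auto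
  ultimately show "(flow p has_vector_derivative speed (flow p t)) (at t)"
    unfolding has_vector_derivative_iff_quotient by (simp add: filterlim_at_split)
qed

end

section \<open>The Laplacian of a connected graph\<close>

definition mean :: "real^'q^'i \<Rightarrow> real^'q" where
  "mean v = (1 / real CARD('i)) *\<^sub>R (\<Sum>i\<in>UNIV. v $ i)"

lemma replicate_vec_nth [simp]: "replicate_vec y $ i = y"
  by (simp add: replicate_vec_def)

lemma inner_replicate_vec: "replicate_vec y \<bullet> v = y \<bullet> (\<Sum>i\<in>UNIV. v $ i)"
  by (simp add: inner_vec_def inner_sum_right)

lemma sum_eq_mean: "(\<Sum>i\<in>UNIV. v $ i) = real CARD('i) *\<^sub>R mean (v :: real^'q^'i)"
  by (simp add: mean_def)

lemma mean_replicate_vec [simp]: "mean (replicate_vec y :: real^'q^'i) = y"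
  by (simp add: mean_def sum_constant_scaleR del: sum_constant)

lemma linear_mean: "linear mean"
  by (rule linearI) (simp_all add: mean_def sum.distrib scaleR_right_distrib scaleR_sum_right scaleR_left_commute)

lemma linear_replicate_vec: "linear (replicate_vec :: real^'q \<Rightarrow> real^'q^'i)"
  by (rule linearI) (simp_all add: vec_eq_iff)

lemma laplacian_mult_nth:
  "(laplacian E *v u) $ i = (\<Sum>j\<in>UNIV. adjacency_matrix E $ i $ j * (u $ i - u $ j))"
proof -
  have "(laplacian E *v u) $ i
      = (\<Sum>j\<in>UNIV. (if i = j then (\<Sum>k\<in>UNIV. adjacency_matrix E $ i $ k) * u $ j else 0) - adjacency_matrix E $ i $ j * u $ j)"
    by (simp add: laplacian_def matrix_vector_mult_def left_diff_distrib if_distrib [of "\<lambda>z. z * _"] cong: if_cong)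
  also have "\<dots> = (\<Sum>k\<in>UNIV. adjacency_matrix E $ i $ k) * u $ i - (\<Sum>j\<in>UNIV. adjacency_matrix E $ i $ j * u $ j)"
    by (simp add: sum_subtractf)
  finally show ?thesis by (simp add: sum_distrib_right right_diff_distrib sum_subtractf)
qed

text \<open>Exchanging the names \<open>i\<close> and \<open>j\<close> and averaging the two
  expressions gives the Dirichlet form of the graph, from which symmetry, nonnegativity and the
  kernel can be read off.\<close>

lemma inner_laplacian:
  assumes "sym E"
  shows "(laplacian E *v u) \<bullet> w
    = (\<Sum>i\<in>UNIV. \<Sum>j\<in>UNIV. adjacency_matrix E $ i $ j * ((u $ i - u $ j) * (w $ i - w $ j))) / 2"
proof -
  let ?a = "\<lambda>i j. adjacency_matrix E $ i $ j"
  have a: "?a i j = ?a j i" for i j using symD [OF assms] by (auto simp: adjacency_matrix_def)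
  have 1: "(laplacian E *v u) \<bullet> w = (\<Sum>i\<in>UNIV. \<Sum>j\<in>UNIV. ?a i j * ((u $ i - u $ j) * w $ i))"
    by (simp add: inner_vec_def laplacian_mult_nth sum_distrib_right mult.assoc)
  also have "\<dots> = (\<Sum>i\<in>UNIV. \<Sum>j\<in>UNIV. ?a i j * ((u $ j - u $ i) * w $ j))"
    by (subst sum.swap) (simp add: a)
  finally have 2: "(laplacian E *v u) \<bullet> w = (\<Sum>i\<in>UNIV. \<Sum>j\<in>UNIV. ?a i j * ((u $ j - u $ i) * w $ j))" .
  have "(laplacian E *v u) \<bullet> w + (laplacian E *v u) \<bullet> w
     = (\<Sum>i\<in>UNIV. \<Sum>j\<in>UNIV. ?a i j * ((u $ i - u $ j) * (w $ i - w $ j)))"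
    by (subst 1, subst 2) (simp add: sum.distrib [symmetric] algebra_simps)
  then show ?thesis by simp
qed

lemma laplacian_nonneg: "sym E \<Longrightarrow> (laplacian E *v u) \<bullet> u \<ge> 0"
  by (simp add: inner_laplacian sum_nonneg adjacency_matrix_def)

lemma laplacian_kernel:
  assumes E: "sym E" "graph_connected E" and 0: "(laplacian E *v u) \<bullet> u = 0"
  shows "u $ i = u $ j"
proof -
  have "(\<Sum>i\<in>UNIV. \<Sum>j\<in>UNIV. adjacency_matrix E $ i $ j * ((u $ i - u $ j) * (u $ i - u $ j))) = 0"
    using 0 by (simp add: inner_laplacian [OF E(1)])
  then have "\<forall>i j. adjacency_matrix E $ i $ j * ((u $ i - u $ j) * (u $ i - u $ j)) = 0"
    by (simp add: sum_nonneg_eq_0_iff sum_nonneg adjacency_matrix_def)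
  then have zero: "adjacency_matrix E $ i $ j * ((u $ i - u $ j) * (u $ i - u $ j)) = 0" for i j by blast
  then have edge: "u $ i = u $ j" if "(i, j) \<in> E" for i j
    using zero [of i j] that by (simp add: adjacency_matrix_def)
  have "(i, j) \<in> E\<^sup>*" using E(2) by (simp add: graph_connected_def)
  then show ?thesis by (induction rule: rtrancl_induct) (auto dest: edge)
qed

text \<open>The first-order condition at a minimum. The test value \<open>- A / b\<close> uses
  \<open>b > 0\<close> above \<open>B\<close>, so that the linear term wins whatever the sign of
  \<open>B\<close>.\<close>

lemma quadratic_nonneg_imp_zero:
  fixes A B :: real
  assumes "\<And>t. 2 * t * A + t\<^sup>2 * B \<ge> 0"
  shows "A = 0"
proof (rule ccontr)
  assume A: "A \<noteq> 0"
  define b where "b = \<bar>B\<bar> + 1"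
  have b: "b > 0" "B < b" by (auto simp: b_def)
  have "0 \<le> 2 * (- A / b) * A + (- A / b)\<^sup>2 * B" by (rule assms)
  also have "\<dots> \<le> 2 * (- A / b) * A + (- A / b)\<^sup>2 * b"
    using b by (intro add_left_mono mult_left_mono) auto
  also have "\<dots> = - (A\<^sup>2 / b)" using b by (simp add: power2_eq_square field_simps)
  also have "\<dots> < 0" using A b by simp
  finally show False by simp
qed

lemma sum_laplacian: "sym E \<Longrightarrow> (\<Sum>i\<in>UNIV. (laplacian E *v u) $ i) = 0"
  using inner_laplacian [of E u "\<chi> i. 1"] by (simp add: inner_vec_def)

text \<open>The minimum of the Rayleigh quotient over the vectors with zero sum is attained at an
  eigenvector; it is the least positive eigenvalue, and the eigenvalue 0 is simple.\<close>

lemma lambda2_laplacian: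
  fixes E :: "('i::finite \<times> 'i) set"
  assumes E: "sym E" "graph_connected E" and N: "CARD('i) \<ge> 2"
  shows "lambda2 (laplacian E) > 0"
    and "(\<Sum>i\<in>UNIV. u $ i) = 0 \<Longrightarrow> (laplacian E *v u) \<bullet> u \<ge> lambda2 (laplacian E) * (norm u)\<^sup>2"
proof -
  let ?L = "laplacian E" and ?one = "(\<chi> i. 1) :: real^'i"
  define S where "S = sphere 0 1 \<inter> {u :: real^'i. ?one \<bullet> u = 0}"
  have perp: "?one \<bullet> u = (\<Sum>i\<in>UNIV. u $ i)" for u :: "real^'i" by (simp add: inner_vec_def)
  have cpt: "compact S" unfolding S_def by (intro compact_Int_closed compact_sphere closed_hyperplane)
  have ne: "S \<noteq> {}"
  proof -
    obtain a b :: 'i where ab: "a \<noteq> b"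
      using N card_le_Suc0_iff_eq [of "UNIV :: 'i set"] by auto
    define w where "w = axis a (1::real) - axis b 1"
    have "w $ a = 1" using ab by (simp add: w_def axis_def)
    then have w: "w \<noteq> 0" by auto
    have "?one \<bullet> w = 0" by (simp add: w_def inner_diff_right inner_axis)
    then have "(1 / norm w) *\<^sub>R w \<in> S" using w by (simp add: S_def)
    then show ?thesis by blast
  qed
  have cont: "continuous_on S (\<lambda>u. (?L *v u) \<bullet> u)"
    by (intro continuous_on_inner continuous_on_id linear_continuous_on)
      (simp add: linear_conv_bounded_linear [symmetric] matrix_vector_mul_linear)
  obtain v where v: "v \<in> S" "\<And>u. u \<in> S \<Longrightarrow> (?L *v v) \<bullet> v \<le> (?L *v u) \<bullet> u"
    using continuous_attains_inf [OF cpt ne cont] by blast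
  define q where "q = (?L *v v) \<bullet> v"
  have v1: "norm v = 1" "?one \<bullet> v = 0" using v(1) by (auto simp: S_def)
  have rayleigh: "(?L *v u) \<bullet> u \<ge> q * (norm u)\<^sup>2" if "?one \<bullet> u = 0" for u
  proof (cases "u = 0")
    case False
    have "(1 / norm u) *\<^sub>R u \<in> S" using False that by (simp add: S_def)
    from v(2) [OF this] have "q \<le> (?L *v u) \<bullet> u / (norm u)\<^sup>2"
      by (simp add: q_def matrix_vector_mult_scaleR power2_eq_square)
    then show ?thesis using False by (simp add: field_simps)
  qed simp
  have one_L: "?one \<bullet> (?L *v u) = 0" for u by (simp add: perp sum_laplacian [OF E(1)])
  have symL: "(?L *v u) \<bullet> w = (?L *v w) \<bullet> u" for u w by (simp add: inner_laplacian [OF E(1)] mult.commute)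
  \<comment> \<open>Vary the minimizer in a zero-sum direction. The residual has zero sum itself, so
    it may be tested against itself and must vanish.\<close>
  have "(?L *v v - q *\<^sub>R v) \<bullet> w = 0" if w: "?one \<bullet> w = 0" for w
  proof (rule quadratic_nonneg_imp_zero)
    fix t :: real
    have "q * (norm (v + t *\<^sub>R w))\<^sup>2 \<le> (?L *v (v + t *\<^sub>R w)) \<bullet> (v + t *\<^sub>R w)"
      by (rule rayleigh) (simp add: inner_add_right w v1)
    moreover have "(?L *v (v + t *\<^sub>R w)) \<bullet> (v + t *\<^sub>R w) = q + 2 * t * ((?L *v v) \<bullet> w) + t\<^sup>2 * ((?L *v w) \<bullet> w)"
      using symL [of w v]
      by (simp add: matrix_vector_right_distrib matrix_vector_mult_scaleR inner_add_left inner_add_right q_def power2_eq_square algebra_simps)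
    moreover have "(norm (v + t *\<^sub>R w))\<^sup>2 = 1 + 2 * t * (v \<bullet> w) + t\<^sup>2 * (norm w)\<^sup>2"
      using v1(1) unfolding power2_norm_eq_inner norm_eq_1
      by (simp add: inner_add_left inner_add_right inner_commute power2_eq_square)
    ultimately show "0 \<le> 2 * t * ((?L *v v - q *\<^sub>R v) \<bullet> w) + t\<^sup>2 * ((?L *v w) \<bullet> w - q * (norm w)\<^sup>2)"
      by (simp add: inner_diff_left algebra_simps)
  qed
  moreover have "?one \<bullet> (?L *v v - q *\<^sub>R v) = 0"
    by (simp only: inner_diff_right one_L v1 inner_scaleR_right)
  ultimately have "(?L *v v - q *\<^sub>R v) \<bullet> (?L *v v - q *\<^sub>R v) = 0" by blast
  then have Lv: "?L *v v = q *\<^sub>R v" by simp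
  have v0: "v \<noteq> 0" using v1 by auto
  have q: "q > 0"
  proof (rule ccontr)
    assume "\<not> q > 0"
    then have "(?L *v v) \<bullet> v = 0" using laplacian_nonneg [OF E(1), of v] by (simp add: q_def)
    then have const: "v $ i = v $ j" for i j by (rule laplacian_kernel [OF E])
    obtain i :: 'i where True by simp
    have "(\<Sum>j\<in>UNIV. v $ j) = (\<Sum>j\<in>(UNIV::'i set). v $ i)" by (rule sum.cong) (auto intro: const)
    then have "v $ i = 0" using v1(2) by (simp add: perp)
    then have "v = 0" using const [of _ i] by (simp add: vec_eq_iff)
    with v0 show False by simp
  qed
  have one0: "?one \<noteq> 0" by (simp add: vec_eq_iff)
  have L1: "?L *v ?one = 0" by (simp add: vec_eq_iff laplacian_mult_nth)
  have ev0: "is_eigenvalue ?L 0" unfolding is_eigenvalue_def eigenspace_def using one0 L1 by force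
  have evq: "is_eigenvalue ?L q" unfolding is_eigenvalue_def eigenspace_def using v0 Lv by force
  have small: "s = 0 \<or> q \<le> s" if s: "is_eigenvalue ?L s" for s
  proof (cases "s = 0")
    case s0: False
    obtain w where w: "?L *v w = s *\<^sub>R w" "w \<noteq> 0" using s by (auto simp: is_eigenvalue_def eigenspace_def)
    have "s * (?one \<bullet> w) = 0" using one_L [of w] by (simp add: w)
    then have "?one \<bullet> w = 0" using s0 by simp
    from rayleigh [OF this] show ?thesis using w by (simp add: power2_norm_eq_inner)
  qed simp
  have dim0: "dim (eigenspace ?L 0) \<le> 1"
  proof -
    have "eigenspace ?L 0 \<subseteq> span {?one}"
    proof
      fix u assume "u \<in> eigenspace ?L 0"
      then have "(?L *v u) \<bullet> u = 0" by (simp add: eigenspace_def)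
      then have const: "u $ i = u $ j" for i j by (rule laplacian_kernel [OF E])
      obtain i :: 'i where True by simp
      have "u = (u $ i) *\<^sub>R ?one" unfolding vec_eq_iff by (auto intro: const)
      then show "u \<in> span {?one}" by (metis span_base span_scale singletonI)
    qed
    then show ?thesis using dim_le_card [of "eigenspace ?L 0" "{?one}"] by simp
  qed
  have dim_pos: "dim (eigenspace ?L s) \<ge> 1" if ev: "is_eigenvalue ?L s" for s
  proof -
    obtain w where "w \<in> eigenspace ?L s" "w \<noteq> 0" using ev unfolding is_eigenvalue_def by blast
    then have "dim (eigenspace ?L s) \<noteq> 0" unfolding dim_eq_0 by blast
    then show ?thesis by linarith
  qed
  have "lambda2 ?L = q"
    unfolding lambda2_def
  proof (rule Least_equality)
    \<comment> \<open>The eigenvalue 0 contributes dimension at most 1, so the count with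
      multiplicity reaches 2 no earlier than at \<open>q\<close>; there both eigenspaces
      contribute.\<close>
    have "{s. is_eigenvalue ?L s \<and> s \<le> q} = {0, q}" using small ev0 evq q by force
    then show "is_eigenvalue ?L q \<and> 2 \<le> (\<Sum>s\<in>{s. is_eigenvalue ?L s \<and> s \<le> q}. dim (eigenspace ?L s))"
      using q evq dim_pos [OF ev0] dim_pos [OF evq] by simp
  next
    fix t assume t: "is_eigenvalue ?L t \<and> 2 \<le> (\<Sum>s\<in>{s. is_eigenvalue ?L s \<and> s \<le> t}. dim (eigenspace ?L s))"
    show "q \<le> t"
    proof (rule ccontr)
      assume "\<not> q \<le> t"
      then have "{s. is_eigenvalue ?L s \<and> s \<le> t} \<subseteq> {0}" using small by force
      then have "(\<Sum>s\<in>{s. is_eigenvalue ?L s \<and> s \<le> t}. dim (eigenspace ?L s)) \<le> (\<Sum>s\<in>{0}. dim (eigenspace ?L s))"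
        by (intro sum_mono2) auto
      with t dim0 show False by simp
    qed
  qed
  with q rayleigh show "lambda2 ?L > 0"
    "(\<Sum>i\<in>UNIV. u $ i) = 0 \<Longrightarrow> (?L *v u) \<bullet> u \<ge> lambda2 ?L * (norm u)\<^sup>2"
    by (auto simp: perp)
qed

subsection \<open>The stacked Laplacian\<close>

text \<open>The Kronecker product with the identity acts on each coordinate \<open>k\<close>
  separately, so facts about the scalar Laplacian transfer by summation over
  \<open>k\<close>.\<close>

lemma stacked_laplacian_nth_nth:
  "stacked_laplacian E v $ i $ k = (laplacian E *v (\<chi> i. v $ i $ k)) $ i"
  unfolding stacked_laplacian_def kron_apply_def matrix_vector_mul_lid
  by (simp add: matrix_vector_mult_def sum_component)

lemma linear_stacked_laplacian: "linear (stacked_laplacian E)"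
proof (rule linearI)
  fix v w :: "real^'a^'b" and r :: real
  show "stacked_laplacian E (v + w) = stacked_laplacian E v + stacked_laplacian E w"
    by (simp add: vec_eq_iff stacked_laplacian_nth_nth laplacian_mult_nth sum.distrib [symmetric] algebra_simps)
  show "stacked_laplacian E (r *\<^sub>R v) = r *\<^sub>R stacked_laplacian E v"
    by (simp add: vec_eq_iff stacked_laplacian_nth_nth laplacian_mult_nth sum_distrib_left algebra_simps)
qed

lemma inner_stacked_laplacian:
  "stacked_laplacian E v \<bullet> w = (\<Sum>k\<in>UNIV. (laplacian E *v (\<chi> i. v $ i $ k)) \<bullet> (\<chi> i. w $ i $ k))"
  unfolding inner_vec_def by (simp add: stacked_laplacian_nth_nth) (rule sum.swap)

lemma stacked_laplacian_symmetric:
  assumes "sym E"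
  shows "stacked_laplacian E v \<bullet> w = v \<bullet> stacked_laplacian E w"
proof -
  have "stacked_laplacian E v \<bullet> w = stacked_laplacian E w \<bullet> v"
    by (simp add: inner_stacked_laplacian inner_laplacian [OF assms] mult.commute)
  then show ?thesis by (simp add: inner_commute)
qed

lemma stacked_laplacian_nonneg: "sym E \<Longrightarrow> stacked_laplacian E v \<bullet> v \<ge> 0"
  by (simp add: inner_stacked_laplacian sum_nonneg laplacian_nonneg)

lemma stacked_laplacian_replicate_vec [simp]: "stacked_laplacian E (replicate_vec y) = 0"
  by (simp add: vec_eq_iff stacked_laplacian_nth_nth laplacian_mult_nth)

lemma stacked_laplacian_in_perp: "sym E \<Longrightarrow> stacked_laplacian E v \<in> consensus_perp"
  by (simp add: consensus_perp_def vec_eq_iff sum_component stacked_laplacian_nth_nth sum_laplacian)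

lemma stacked_laplacian_kernel:
  assumes E: "sym E" "graph_connected E" and 0: "stacked_laplacian E v \<bullet> v = 0"
  shows "v = replicate_vec (mean v)"
proof -
  have "(laplacian E *v (\<chi> i. v $ i $ k)) \<bullet> (\<chi> i. v $ i $ k) = 0" for k
    using 0 by (simp add: inner_stacked_laplacian sum_nonneg_eq_0_iff laplacian_nonneg E)
  from laplacian_kernel [OF E this] have "v $ i = v $ j" for i j by (simp add: vec_eq_iff)
  then obtain y where "v = replicate_vec y" by (metis replicate_vec_nth vec_eq_iff)
  then show ?thesis by simp
qed

text \<open>The quadratic form does not see the mean, and the deviation from the mean has zero sum
  in every coordinate, where the Rayleigh bound applies.\<close>

lemma stacked_laplacian_spectral_gap:
  fixes E :: "('i::finite \<times> 'i) set" and v :: "real^'q^'i"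
  assumes E: "sym E" "graph_connected E" and N: "CARD('i) \<ge> 2"
  shows "stacked_laplacian E v \<bullet> v \<ge> lambda2 (laplacian E) * (norm (v - replicate_vec (mean v)))\<^sup>2"
proof -
  define w where "w = v - replicate_vec (mean v)"
  have Lw: "stacked_laplacian E w = stacked_laplacian E v"
    by (simp add: w_def linear_diff [OF linear_stacked_laplacian])
  have sw: "(\<Sum>i\<in>UNIV. w $ i) = 0" by (simp add: w_def sum_subtractf sum_eq_mean sum_constant_scaleR del: sum_constant)
  have "(norm w)\<^sup>2 = (\<Sum>k\<in>UNIV. (norm (\<chi> i. w $ i $ k))\<^sup>2)"
    unfolding power2_norm_eq_inner inner_vec_def by simp (rule sum.swap)
  then have "lambda2 (laplacian E) * (norm w)\<^sup>2 = (\<Sum>k\<in>UNIV. lambda2 (laplacian E) * (norm (\<chi> i. w $ i $ k))\<^sup>2)"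
    by (simp add: sum_distrib_left)
  also have "\<dots> \<le> stacked_laplacian E w \<bullet> w"
    unfolding inner_stacked_laplacian
    using sw by (intro sum_mono lambda2_laplacian(2) [OF E N]) (simp add: vec_eq_iff sum_component)
  also have "\<dots> = stacked_laplacian E w \<bullet> v - stacked_laplacian E w \<bullet> replicate_vec (mean v)"
    by (simp add: w_def inner_diff_right)
  also have "\<dots> = stacked_laplacian E v \<bullet> v"
    by (simp add: stacked_laplacian_symmetric [OF E(1), of w] Lw [symmetric])
  finally show ?thesis by (simp add: w_def)
qed

lemma linear_pos_def_coercive:
  fixes B :: "'a::euclidean_space \<Rightarrow> 'a"
  assumes B: "linear B" and pos: "\<And>x. x \<noteq> 0 \<Longrightarrow> B x \<bullet> x > 0"
  obtains \<kappa> where "\<kappa> > 0" "\<And>x. B x \<bullet> x \<ge> \<kappa> * (norm x)\<^sup>2"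
proof -
  have cont: "continuous_on (sphere 0 1) (\<lambda>x. B x \<bullet> x)"
    by (intro continuous_on_inner continuous_on_id linear_continuous_on)
      (simp add: linear_conv_bounded_linear [symmetric] B)
  have ne: "sphere (0::'a) 1 \<noteq> {}" by simp
  obtain v where v: "v \<in> sphere 0 1" "\<And>u. u \<in> sphere 0 1 \<Longrightarrow> B v \<bullet> v \<le> B u \<bullet> u"
    using continuous_attains_inf [OF compact_sphere ne cont] by blast
  show thesis
  proof
    show "B v \<bullet> v > 0" using v(1) by (intro pos) auto
    fix x show "B x \<bullet> x \<ge> B v \<bullet> v * (norm x)\<^sup>2"
    proof (cases "x = 0")
      case False
      have "B v \<bullet> v \<le> B ((1 / norm x) *\<^sub>R x) \<bullet> ((1 / norm x) *\<^sub>R x)" using False by (intro v(2)) simp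
      also have "\<dots> = B x \<bullet> x / (norm x)\<^sup>2" by (simp add: linear_scale [OF B] power2_eq_square)
      finally show ?thesis using False by (simp add: field_simps)
    qed (simp add: linear_0 [OF B])
  qed
qed

text \<open>The operator \<open>P\<close> is the inverse of the Laplacian plus the projection onto the consensus space;
  it serves as a metric on the multipliers \<open>z\<close>.\<close>

lemma stacked_laplacian_inverse:
  fixes E :: "('i::finite \<times> 'i) set"
  assumes E: "sym E" "graph_connected E"
  obtains P :: "real^'q^'i \<Rightarrow> real^'q^'i" and \<kappa>
  where "linear P" "\<And>u w. P u \<bullet> w = u \<bullet> P w" "\<And>v. P (stacked_laplacian E v) = v - replicate_vec (mean v)"
    "\<kappa> > 0" "\<And>u. P u \<bullet> u \<ge> \<kappa> * (norm u)\<^sup>2"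
proof -
  define T where "T v = stacked_laplacian E v + replicate_vec (mean v)" for v :: "real^'q^'i"
  have linT: "linear T"
    unfolding T_def
    by (intro linear_compose_add linear_stacked_laplacian linear_compose [OF linear_mean linear_replicate_vec, unfolded o_def])
  have rm: "replicate_vec (mean u) \<bullet> w = real CARD('i) * (mean u \<bullet> mean w)" for u w :: "real^'q^'i"
    by (simp add: inner_replicate_vec sum_eq_mean)
  have symT: "T u \<bullet> w = u \<bullet> T w" for u w
    using stacked_laplacian_symmetric [OF E(1), of u w] rm [of u w] rm [of w u]
    by (simp add: T_def inner_add_left inner_add_right inner_commute)
  have Tpos: "T u \<bullet> u > 0" if "u \<noteq> 0" for u
  proof (rule ccontr)
    assume "\<not> T u \<bullet> u > 0"
    moreover have "T u \<bullet> u = stacked_laplacian E u \<bullet> u + real CARD('i) * (mean u \<bullet> mean u)"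
      by (simp add: T_def inner_add_left rm)
    ultimately have "stacked_laplacian E u \<bullet> u + real CARD('i) * (mean u \<bullet> mean u) \<le> 0" by simp
    moreover have "0 \<le> real CARD('i) * (mean u \<bullet> mean u)" by simp
    ultimately have "stacked_laplacian E u \<bullet> u = 0" "real CARD('i) * (mean u \<bullet> mean u) = 0"
      using stacked_laplacian_nonneg [OF E(1), of u] by linarith+
    then have "u = replicate_vec (mean u)" "mean u = 0" using stacked_laplacian_kernel [OF E, of u] by auto
    then have "u = replicate_vec 0" by simp
    with that show False by (simp add: vec_eq_iff)
  qed
  have "inj T"
    unfolding linear_injective_0 [OF linT] using Tpos by force
  then obtain P where P: "linear P" "\<And>x. P (T x) = x" "\<And>x. T (P x) = x"
    using linear_injective_isomorphism [OF linT] by blast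
  have symP: "P u \<bullet> w = u \<bullet> P w" for u w
    using symT [of "P u" "P w"] by (simp add: P)
  have "P u \<bullet> u > 0" if "u \<noteq> 0" for u
  proof -
    have "P u \<noteq> 0" using that P(3) linear_0 [OF linT] by metis
    from Tpos [OF this] show ?thesis by (simp add: P inner_commute)
  qed
  then obtain \<kappa> where \<kappa>: "\<kappa> > 0" "\<And>u. P u \<bullet> u \<ge> \<kappa> * (norm u)\<^sup>2"
    using linear_pos_def_coercive [OF P(1)] by blast
  \<comment> \<open>The deviation has mean zero, so the projection part of \<open>T\<close> vanishes
    on it.\<close>
  have "T (v - replicate_vec (mean v)) = stacked_laplacian E v" for v
    by (simp add: T_def linear_diff [OF linear_stacked_laplacian] linear_diff [OF linear_mean] vec_eq_iff)
  then have "P (stacked_laplacian E v) = v - replicate_vec (mean v)" for v by (metis P(2))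
  with that P(1) symP \<kappa> show thesis by blast
qed

text \<open>For a single agent the second eigenvalue is unspecified, but then every stacked vector is
  in consensus and both sides vanish.\<close>

lemma stacked_laplacian_gain:
  fixes E :: "('i::finite \<times> 'i) set"
  assumes E: "sym E" "graph_connected E" and \<mu>: "\<mu> > 0" and b: "b > 0"
    and c: "c > b / (4 * \<mu> * lambda2 (laplacian E))"
  obtains \<kappa> where "4 * \<mu> * \<kappa> > b"
    "\<And>v :: real^'q^'i. c * (stacked_laplacian E v \<bullet> v) \<ge> \<kappa> * (norm (v - replicate_vec (mean v)))\<^sup>2"
proof (cases "CARD('i) \<ge> 2")
  case True
  define l where "l = lambda2 (laplacian E)"
  have l: "l > 0" unfolding l_def by (rule lambda2_laplacian(1) [OF E True])
  have "c > 0" using c b \<mu> l unfolding l_def by (meson divide_pos_pos mult_pos_pos order.strict_trans zero_less_numeral)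
  show thesis
  proof
    show "4 * \<mu> * (c * l) > b" using c \<mu> l by (simp add: l_def [symmetric] field_simps)
    fix v :: "real^'q^'i"
    show "c * (stacked_laplacian E v \<bullet> v) \<ge> c * l * (norm (v - replicate_vec (mean v)))\<^sup>2"
      using stacked_laplacian_spectral_gap [OF E True, of v] \<open>c > 0\<close> by (simp add: l_def)
  qed
next
  case False
  moreover have "CARD('i) \<noteq> 0" by simp
  ultimately have "CARD('i) = 1" by linarith
  then have one: "i = j" for i j :: 'i by (metis card_1_singletonE UNIV_I singletonD)
  show thesis
  proof
    \<comment> \<open>With both sides of the second claim zero any constant works; this one just
      satisfies the first claim.\<close>
    show "4 * \<mu> * ((b + 1) / (4 * \<mu>)) > b" using \<mu> by simp
    fix v :: "real^'q^'i"
    have "v $ i = v $ j" for i j using one [of i j] by simp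
    then obtain y where "v = replicate_vec y" by (metis replicate_vec_nth vec_eq_iff)
    then show "c * (stacked_laplacian E v \<bullet> v) \<ge> (b + 1) / (4 * \<mu>) * (norm (v - replicate_vec (mean v)))\<^sup>2" by simp
  qed
qed

section \<open>Variational inequalities and multipliers\<close>

text \<open>Solutions are the fixed points of a gradient-like step followed by projection onto
  \<open>X\<close>. Strong monotonicity makes this map a contraction for a suitable step
  size.\<close>

lemma variational_inequality_exists:
  fixes F :: "'a::euclidean_space \<Rightarrow> 'a"
  assumes X: "closed X" "convex X" "X \<noteq> {}"
    and F: "strongly_monotone \<mu> F" "\<theta>-lipschitz_on UNIV F" and pos: "0 < \<mu>" "\<mu> \<le> \<theta>"
  obtains x where "x \<in> X" "\<And>y. y \<in> X \<Longrightarrow> F x \<bullet> (y - x) \<ge> 0"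
proof -
  \<comment> \<open>This step size minimizes the squared contraction factor \<open>1 - 2 * \<gamma>
    * \<mu> + \<gamma>\<^sup>2 * \<theta>\<^sup>2\<close>; the minimum is \<open>q\<close> below,
    nonnegative because \<open>\<mu> \<le> \<theta>\<close>.\<close>
  define \<gamma> where "\<gamma> = \<mu> / \<theta>\<^sup>2"
  define T where "T x = closest_point X (x - \<gamma> *\<^sub>R F x)" for x
  define q where "q = 1 - \<mu>\<^sup>2 / \<theta>\<^sup>2"
  have \<gamma>: "\<gamma> > 0" using pos by (simp add: \<gamma>_def)
  have "\<mu>\<^sup>2 \<le> \<theta>\<^sup>2" using pos by (intro power_mono) auto
  then have q: "0 \<le> q" "q < 1" using pos by (auto simp: q_def)
  have "dist (T x) (T y) \<le> sqrt q * dist x y" for x y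
  proof -
    let ?d = "F x - F y"
    have "dist (T x) (T y) \<le> dist (x - \<gamma> *\<^sub>R F x) (y - \<gamma> *\<^sub>R F y)"
      unfolding T_def by (rule closest_point_lipschitz [OF X(2,1,3)])
    then have "(dist (T x) (T y))\<^sup>2 \<le> (norm ((x - y) - \<gamma> *\<^sub>R ?d))\<^sup>2"
      by (intro power_mono) (auto simp: dist_norm algebra_simps)
    also have "\<dots> = (norm (x - y))\<^sup>2 - 2 * \<gamma> * (?d \<bullet> (x - y)) + \<gamma>\<^sup>2 * (norm ?d)\<^sup>2"
      unfolding power2_norm_eq_inner
      by (simp only: inner_diff_left inner_diff_right inner_scaleR_left inner_scaleR_right)
        (simp add: inner_commute power2_eq_square algebra_simps)
    also have "\<dots> \<le> (norm (x - y))\<^sup>2 - 2 * \<gamma> * (\<mu> * (norm (x - y))\<^sup>2) + \<gamma>\<^sup>2 * (\<theta> * norm (x - y))\<^sup>2"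
    proof (intro add_mono diff_mono mult_left_mono power_mono)
      show "\<mu> * (norm (x - y))\<^sup>2 \<le> ?d \<bullet> (x - y)" using F(1) by (simp add: strongly_monotone_def)
      show "norm ?d \<le> \<theta> * norm (x - y)" using lipschitz_onD [OF F(2), of x y] by (simp add: dist_norm)
    qed (use \<gamma> in auto)
    also have "\<dots> = (1 - 2 * \<gamma> * \<mu> + \<gamma>\<^sup>2 * \<theta>\<^sup>2) * (dist x y)\<^sup>2"
      by (simp add: power_mult_distrib dist_norm algebra_simps)
    also have "1 - 2 * \<gamma> * \<mu> + \<gamma>\<^sup>2 * \<theta>\<^sup>2 = q"
      using pos by (simp add: \<gamma>_def q_def power2_eq_square field_simps)
    finally have "dist (T x) (T y) \<le> sqrt (q * (dist x y)\<^sup>2)" by (rule real_le_rsqrt)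
    then show ?thesis by (simp add: real_sqrt_mult)
  qed
  then have "\<exists>!x. T x = x" using q by (intro banach_fix_type [of "sqrt q"]) auto
  then obtain x where x: "T x = x" by blast
  show thesis
  proof
    show "x \<in> X" using closest_point_in_set [OF X(1,3)] x by (metis T_def)
    fix y assume "y \<in> X"
    from closest_point_dot [OF X(2,1) this, of "x - \<gamma> *\<^sub>R F x"] x
    have "\<gamma> * (F x \<bullet> (y - x)) \<ge> 0" by (simp add: T_def)
    then show "F x \<bullet> (y - x) \<ge> 0" using \<gamma> by (simp add: zero_le_mult_iff)
  qed
qed

text \<open>Separates the epigraph-type set of attainable constraint and objective values from the
  negative objective axis.\<close>

lemma lagrange_multipliers:
  fixes h :: "'a::euclidean_space \<Rightarrow> real^'m" and c x s :: 'a
  assumes \<Omega>: "convex \<Omega>" and h: "\<And>k. convex_on \<Omega> (\<lambda>y. h y $ k)"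
    and x: "x \<in> \<Omega>" "h x \<le> 0" and s: "s \<in> \<Omega>" "\<And>k. h s $ k < 0"
    and opt: "\<And>y. y \<in> \<Omega> \<Longrightarrow> h y \<le> 0 \<Longrightarrow> c \<bullet> (y - x) \<ge> 0"
  obtains l where "0 \<le> l" "l \<bullet> h x = 0" "\<And>y. y \<in> \<Omega> \<Longrightarrow> c \<bullet> (y - x) + l \<bullet> h y \<ge> 0"
proof -
  define A where "A = {(u :: real^'m, r :: real). \<exists>y\<in>\<Omega>. h y \<le> u \<and> c \<bullet> (y - x) \<le> r}"
  define B where "B = {(0 :: real^'m)} \<times> {..<0 :: real}"
  have "convex A"
  proof (rule convexI)
    fix p q and a b :: real
    assume pq: "p \<in> A" "q \<in> A" and ab: "0 \<le> a" "0 \<le> b" "a + b = 1"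
    obtain y where y: "y \<in> \<Omega>" "h y \<le> fst p" "c \<bullet> (y - x) \<le> snd p" using pq(1) by (auto simp: A_def)
    obtain z where z: "z \<in> \<Omega>" "h z \<le> fst q" "c \<bullet> (z - x) \<le> snd q" using pq(2) by (auto simp: A_def)
    have 1: "a *\<^sub>R y + b *\<^sub>R z \<in> \<Omega>" by (rule convexD [OF \<Omega> y(1) z(1) ab])
    have 2: "h (a *\<^sub>R y + b *\<^sub>R z) \<le> a *\<^sub>R fst p + b *\<^sub>R fst q"
      unfolding less_eq_vec_def
    proof
      fix k
      have "h (a *\<^sub>R y + b *\<^sub>R z) $ k \<le> a * h y $ k + b * h z $ k"
        using h [of k] y(1) z(1) ab by (simp add: convex_on_def)
      also have "\<dots> \<le> a * fst p $ k + b * fst q $ k"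
        using y(2) z(2) ab by (intro add_mono mult_left_mono) (auto simp: less_eq_vec_def)
      finally show "h (a *\<^sub>R y + b *\<^sub>R z) $ k \<le> (a *\<^sub>R fst p + b *\<^sub>R fst q) $ k" by simp
    qed
    have "a *\<^sub>R y + b *\<^sub>R z - x = a *\<^sub>R (y - x) + b *\<^sub>R (z - x)"
      using ab(3) by (simp add: algebra_simps flip: scaleR_add_left)
    then have "c \<bullet> (a *\<^sub>R y + b *\<^sub>R z - x) = a * (c \<bullet> (y - x)) + b * (c \<bullet> (z - x))"
      by (simp add: inner_add_right)
    also have "\<dots> \<le> a * snd p + b * snd q"
      using y(3) z(3) ab by (intro add_mono mult_left_mono)
    finally have 3: "c \<bullet> (a *\<^sub>R y + b *\<^sub>R z - x) \<le> a * snd p + b * snd q" .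
    have "a *\<^sub>R p + b *\<^sub>R q = (a *\<^sub>R fst p + b *\<^sub>R fst q, a * snd p + b * snd q)"
      by (simp add: prod_eq_iff)
    with 1 2 3 show "a *\<^sub>R p + b *\<^sub>R q \<in> A" by (auto simp: A_def)
  qed
  moreover have "convex B" unfolding B_def by (intro convex_Times convex_singleton) simp
  moreover have "(h x, 0) \<in> A" using x by (auto simp: A_def)
  moreover have "(0, -1) \<in> B" by (simp add: B_def)
  moreover have "B \<inter> A = {}"
    using opt by (fastforce simp: A_def B_def)
  ultimately obtain a b where a: "a \<noteq> 0" "\<And>p. p \<in> B \<Longrightarrow> a \<bullet> p \<le> b" "\<And>p. p \<in> A \<Longrightarrow> b \<le> a \<bullet> p"
    using separating_hyperplane_sets [of B A] by (metis empty_iff)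
  obtain l0 \<rho> where l0: "a = (l0, \<rho>)" by (cases a)
  have B: "\<rho> * r \<le> b" if "r < 0" for r using a(2) [of "(0, r)"] that by (simp add: B_def l0)
  have A: "b \<le> l0 \<bullet> u + \<rho> * r" if "y \<in> \<Omega>" "h y \<le> u" "c \<bullet> (y - x) \<le> r" for y u r
    using a(3) [of "(u, r)"] that by (auto simp: A_def l0)
  \<comment> \<open>The half-line \<open>B\<close> comes arbitrarily close to the origin, which
    gives the sign of \<open>b\<close>; that it is unbounded below gives the sign of \<rho>.\<close>
  have b: "b \<ge> 0"
  proof (rule LIMSEQ_le_const2)
    show "(\<lambda>n. \<rho> * - inverse (real (Suc n))) \<longlonglongrightarrow> 0"
      using tendsto_mult_right_zero [OF LIMSEQ_inverse_real_of_nat, of "- \<rho>"] by simp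
    show "\<exists>N. \<forall>n\<ge>N. \<rho> * - inverse (real (Suc n)) \<le> b"
      by (intro exI [of _ 0] allI impI B) simp
  qed
  have \<rho>: "\<rho> \<ge> 0"
  proof (rule ccontr)
    assume r: "\<not> \<rho> \<ge> 0"
    have "\<rho> * ((b + 1) / \<rho>) \<le> b" using r b by (intro B) (simp add: divide_pos_neg)
    then show False using r by simp
  qed
  have l0_nonneg: "l0 $ k \<ge> 0" for k
  proof (rule ccontr)
    assume k: "\<not> l0 $ k \<ge> 0"
    \<comment> \<open>Raising constraint \<open>k\<close> by \<open>t\<close> stays in
      \<open>A\<close> and lowers the functional by exactly one more than the absolute value of
      \<open>l0 \<bullet> h x\<close>.\<close>
    define t where "t = (\<bar>l0 \<bullet> h x\<bar> + 1) / (- l0 $ k)"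
    have t: "t \<ge> 0" unfolding t_def using k by (intro divide_nonneg_pos) auto
    have "b \<le> l0 \<bullet> (h x + t *\<^sub>R axis k 1) + \<rho> * 0"
      using t by (intro A [OF x(1)]) (auto simp: less_eq_vec_def axis_def)
    also have "\<dots> = l0 \<bullet> h x + t * l0 $ k" by (simp add: inner_add_right inner_axis)
    also have "\<dots> = l0 \<bullet> h x - (\<bar>l0 \<bullet> h x\<bar> + 1)" using k by (simp add: t_def field_simps)
    finally show False using b by linarith
  qed
  \<comment> \<open>Here Slater's condition enters: with \<rho> = 0 the nonnegative
    \<open>l0\<close> would pair nonnegatively with the strictly negative \<open>h s\<close>, so the
    whole separating functional would vanish.\<close>
  have \<rho>0: "\<rho> > 0"
  proof (rule ccontr)
    assume "\<not> \<rho> > 0"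
    then have \<rho>00: "\<rho> = 0" using \<rho> by simp
    have "0 \<le> l0 \<bullet> h s" using A [OF s(1) order_refl order_refl] b \<rho>00 by simp
    then have "(\<Sum>k\<in>UNIV. l0 $ k * - h s $ k) \<le> 0" by (simp add: inner_vec_def sum_negf)
    moreover have nn: "l0 $ k * - h s $ k \<ge> 0" for k
      using l0_nonneg [of k] s(2) [of k] by (simp add: mult_nonneg_nonpos)
    ultimately have "(\<Sum>k\<in>UNIV. l0 $ k * - h s $ k) = 0" by (intro antisym sum_nonneg) auto
    then have "\<forall>k. l0 $ k * - h s $ k = 0" using nn by (subst (asm) sum_nonneg_eq_0_iff) auto
    then have "l0 = 0" using s(2) by (simp add: vec_eq_iff) (metis less_irrefl)
    with a(1) \<rho>00 l0 show False by (simp add: zero_prod_def)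
  qed
  define l where "l = (1 / \<rho>) *\<^sub>R l0"
  have l: "0 \<le> l" using l0_nonneg \<rho>0 by (simp add: less_eq_vec_def l_def)
  have main: "c \<bullet> (y - x) + l \<bullet> h y \<ge> 0" if "y \<in> \<Omega>" for y
  proof -
    have "0 \<le> l0 \<bullet> h y + \<rho> * (c \<bullet> (y - x))" using A [OF that order_refl order_refl] b by simp
    then have "0 \<le> (l0 \<bullet> h y + \<rho> * (c \<bullet> (y - x))) / \<rho>" using \<rho>0 by simp
    then show ?thesis using \<rho>0 by (simp add: l_def field_simps)
  qed
  have "l \<bullet> h x \<le> 0"
    unfolding inner_vec_def using l x(2) by (intro sum_nonpos) (auto simp: less_eq_vec_def mult_nonneg_nonpos)
  then have "l \<bullet> h x = 0" using main [OF x(1)] by simp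
  with that l main show thesis by blast
qed

section \<open>Orthants and complementarity\<close>

lemma inner_nonneg_vec:
  fixes u v :: "real^'m"
  shows "0 \<le> u \<Longrightarrow> 0 \<le> v \<Longrightarrow> 0 \<le> u \<bullet> v"
  unfolding inner_vec_def by (intro sum_nonneg) (auto simp: less_eq_vec_def)

lemma closed_nonneg_orthant: "closed (nonneg_orthant :: (real^'m^'i) set)"
proof -
  have "nonneg_orthant = (\<Inter>i. \<Inter>k. {l :: real^'m^'i. 0 \<le> l $ i $ k})"
    by (auto simp: nonneg_orthant_def less_eq_vec_def)
  moreover have "closed (\<Inter>i. \<Inter>k. {l :: real^'m^'i. 0 \<le> l $ i $ k})"
    by (intro closed_INT ballI closed_Collect_le continuous_intros)
  ultimately show ?thesis by metis
qed

lemma convex_nonneg_orthant: "convex (nonneg_orthant :: (real^'m^'i) set)"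
  by (auto simp: convex_def nonneg_orthant_def less_eq_vec_def)

text \<open>The complementarity conditions. Signs come from testing with
  \<open>l + axis k 1\<close>, orthogonality from testing with 0 and \<open>2 *\<^sub>R l\<close>,
  which move along the ray through \<open>l\<close> in both directions.\<close>

lemma normal_cone_nonneg_orthant:
  fixes l v :: "real^'m"
  shows "v \<in> normal_cone nonneg_orthant l \<longleftrightarrow> 0 \<le> l \<and> v \<le> 0 \<and> v \<bullet> l = 0"
proof
  assume v: "v \<in> normal_cone nonneg_orthant l"
  then have l: "0 \<le> l" and *: "\<And>z. 0 \<le> z \<Longrightarrow> v \<bullet> (z - l) \<le> 0" by (auto simp: normal_cone_def nonneg_orthant_def)
  have "v $ k \<le> 0" for k
  proof -
    have "0 \<le> l + axis k 1" using l by (auto simp: less_eq_vec_def axis_def add_nonneg_nonneg)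
    from * [OF this] show ?thesis by (simp add: inner_axis)
  qed
  then have v0: "v \<le> 0" by (simp add: less_eq_vec_def)
  have "v \<bullet> l = 0" using * [of 0] * [of "2 *\<^sub>R l"] l by (simp add: less_eq_vec_def scaleR_2)
  with l v0 show "0 \<le> l \<and> v \<le> 0 \<and> v \<bullet> l = 0" by simp
next
  assume v: "0 \<le> l \<and> v \<le> 0 \<and> v \<bullet> l = 0"
  then have "v \<bullet> (z - l) \<le> 0" if "0 \<le> z" for z
    using inner_nonneg_vec [of "- v" z] that by (simp add: inner_diff_right less_eq_vec_def)
  with v show "v \<in> normal_cone nonneg_orthant l" by (auto simp: normal_cone_def nonneg_orthant_def)
qed

lemma normal_cone_nonneg_orthant_stacked:
  fixes l v :: "real^'m^'i"
  shows "v \<in> normal_cone nonneg_orthant l \<longleftrightarrow> (\<forall>i. v $ i \<in> normal_cone nonneg_orthant (l $ i))"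
proof
  assume v: "v \<in> normal_cone nonneg_orthant l"
  show "\<forall>i. v $ i \<in> normal_cone nonneg_orthant (l $ i)"
  proof
    fix i
    have "v $ i \<bullet> (z - l $ i) \<le> 0" if "0 \<le> z" for z
    proof -
      define y where "y = l + axis i (z - l $ i)"
      have "0 \<le> y" using v that by (auto simp: y_def axis_def less_eq_vec_def normal_cone_def nonneg_orthant_def)
      then have "v \<bullet> (y - l) \<le> 0" using v by (auto simp: normal_cone_def nonneg_orthant_def)
      then show ?thesis by (simp add: y_def inner_axis)
    qed
    then show "v $ i \<in> normal_cone nonneg_orthant (l $ i)"
      using v by (auto simp: normal_cone_def nonneg_orthant_def less_eq_vec_def)
  qed
next
  assume v: "\<forall>i. v $ i \<in> normal_cone nonneg_orthant (l $ i)"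
  then have "v \<bullet> (z - l) \<le> 0" if "0 \<le> z" for z
    unfolding inner_vec_def [of v] using that
    by (intro sum_nonpos) (auto simp: normal_cone_def nonneg_orthant_def less_eq_vec_def)
  with v show "v \<in> normal_cone nonneg_orthant l"
    by (auto simp: normal_cone_def nonneg_orthant_def less_eq_vec_def)
qed

lemma zero_in_translated_iff: "0 \<in> (a::'a::ab_group_add) +o N \<longleftrightarrow> - a \<in> N"
  unfolding elt_set_plus_def by (auto simp: eq_commute [of 0] add_eq_0_iff)

section \<open>Directional derivatives, convexity and gradients\<close>

lemma directional_derivative_quotient:
  fixes f :: "'a::real_normed_vector \<Rightarrow> real"
  assumes "(f has_derivative f') (at x)"
  shows "((\<lambda>t. (f (x + t *\<^sub>R d) - f x) / t) \<longlongrightarrow> f' d) (at_right 0)"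
proof -
  have f: "(f has_derivative f') (at (x + 0 *\<^sub>R d))" using assms by simp
  have "((\<lambda>t. x + t *\<^sub>R d) has_derivative (\<lambda>t. t *\<^sub>R d)) (at_right 0)"
    by (auto intro!: derivative_eq_intros)
  from has_derivative_compose [OF this f]
  have "((\<lambda>t. f (x + t *\<^sub>R d)) has_derivative (\<lambda>t. f' (t *\<^sub>R d))) (at_right 0)" .
  then have "((\<lambda>t. f (x + t *\<^sub>R d)) has_vector_derivative f' d) (at_right 0)"
    by (simp add: has_vector_derivative_def linear_scale [OF has_derivative_linear [OF assms]])
  then show ?thesis by (simp add: has_vector_derivative_iff_quotient divide_inverse mult.commute)
qed

lemma convex_on_above_tangent:
  fixes f :: "'a::real_normed_vector \<Rightarrow> real"
  assumes f: "convex_on S f" and xy: "x \<in> S" "y \<in> S" and f': "(f has_derivative f') (at x)"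
  shows "f' (y - x) \<le> f y - f x"
proof (rule tendsto_upperbound [OF directional_derivative_quotient [OF f']])
  have "eventually (\<lambda>t. t < (1::real)) (at_right 0)"
    by (auto simp: eventually_at_right_field intro: exI [of _ 1])
  then show "eventually (\<lambda>t. (f (x + t *\<^sub>R (y - x)) - f x) / t \<le> f y - f x) (at_right 0)"
    using eventually_at_right_less
  proof eventually_elim
    case (elim t)
    have "f ((1 - t) *\<^sub>R x + t *\<^sub>R y) \<le> (1 - t) * f x + t * f y"
      using elim xy by (intro convex_onD [OF f]) auto
    then have "f (x + t *\<^sub>R (y - x)) - f x \<le> t * (f y - f x)" by (simp add: algebra_simps)
    then show ?case using elim by (simp add: divide_le_eq mult.commute)
  qed
qed simp

text \<open>\<open>gradient\<close> is a definite description, so a Riesz representative of the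
  derivative has to be exhibited and shown to be the only one.\<close>

lemma C1_fun_has_gradient:
  fixes f :: "'a::euclidean_space \<Rightarrow> real"
  assumes "C1_fun f"
  shows "(f has_derivative (\<lambda>h. h \<bullet> gradient f x)) (at x)"
proof -
  obtain f' where f': "(f has_derivative blinfun_apply (f' x)) (at x)" using assms by (auto simp: C1_fun_def)
  define D where "D = (\<Sum>b\<in>Basis. blinfun_apply (f' x) b *\<^sub>R b)"
  have "blinfun_apply (f' x) h = h \<bullet> D" for h
  proof -
    have "blinfun_apply (f' x) h = blinfun_apply (f' x) (\<Sum>b\<in>Basis. (h \<bullet> b) *\<^sub>R b)" by (simp add: euclidean_representation)
    also have "\<dots> = (\<Sum>b\<in>Basis. (h \<bullet> b) * blinfun_apply (f' x) b)" by (simp add: blinfun.sum_right blinfun.scaleR_right)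
    finally show ?thesis by (simp add: D_def inner_sum_right mult.commute)
  qed
  then have "blinfun_apply (f' x) = (\<lambda>h. h \<bullet> D)" by (simp add: fun_eq_iff)
  with f' have D: "GDERIV f x :> D" by (simp add: gderiv_def)
  have "D' = D" if "GDERIV f x :> D'" for D'
    using has_derivative_unique [of f "\<lambda>h. h \<bullet> D'" x "\<lambda>h. h \<bullet> D"] D that
    by (simp add: gderiv_def fun_eq_iff) (metis vector_eq_ldot)
  then have "gradient f x = D" using D unfolding gradient_def by (intro the_equality)
  with D show ?thesis by (simp add: gderiv_def)
qed

section \<open>Locally Lipschitz maps\<close>

text \<open>Stated on bounded sets because the dynamics will be truncated to a ball. The notion
  composes, as a Lipschitz map sends bounded sets to bounded sets.\<close>

definition locally_lipschitz :: "('a::metric_space \<Rightarrow> 'b::metric_space) \<Rightarrow> bool" where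
  "locally_lipschitz f \<longleftrightarrow> (\<forall>B. bounded B \<longrightarrow> (\<exists>L. L-lipschitz_on B f))"

lemma locally_lipschitzE:
  assumes "locally_lipschitz f" "bounded B"
  obtains L where "L-lipschitz_on B f"
  using assms unfolding locally_lipschitz_def by blast

lemma lipschitz_on_bounded_image:
  assumes f: "L-lipschitz_on B f" and B: "bounded B"
  shows "bounded (f ` B)"
proof (cases "B = {}")
  case False
  then obtain a where a: "a \<in> B" by blast
  obtain r where r: "\<And>x. x \<in> B \<Longrightarrow> dist a x \<le> r" using B bounded_any_center [of B a] by blast
  have "dist (f a) (f x) \<le> L * r" if "x \<in> B" for x
    using lipschitz_onD [OF f a that] r [OF that] lipschitz_on_nonneg [OF f]
    by (meson mult_left_mono order_trans)
  then show ?thesis unfolding bounded_def by blast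
qed simp

lemma locally_lipschitz_lipschitz: "L-lipschitz_on UNIV f \<Longrightarrow> locally_lipschitz f"
  unfolding locally_lipschitz_def by (meson lipschitz_on_subset subset_UNIV)

lemma locally_lipschitz_compose:
  assumes f: "locally_lipschitz f" and g: "locally_lipschitz g"
  shows "locally_lipschitz (\<lambda>x. g (f x))"
  unfolding locally_lipschitz_def
proof (intro allI impI)
  fix B :: "'a set" assume B: "bounded B"
  obtain L where L: "L-lipschitz_on B f" using f B by (rule locally_lipschitzE)
  obtain M where M: "M-lipschitz_on (f ` B) g"
    using g lipschitz_on_bounded_image [OF L B] by (rule locally_lipschitzE)
  show "\<exists>L. L-lipschitz_on B (\<lambda>x. g (f x))" using lipschitz_on_compose2 [OF L M] by blast
qed

lemma locally_lipschitz_bounded_linear: "bounded_linear f \<Longrightarrow> locally_lipschitz f"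
  by (metis bounded_linear.lipschitz_boundE locally_lipschitz_lipschitz)

lemma locally_lipschitz_linear:
  fixes f :: "'a::euclidean_space \<Rightarrow> 'b::real_normed_vector"
  shows "linear f \<Longrightarrow> locally_lipschitz f"
  by (simp add: linear_conv_bounded_linear locally_lipschitz_bounded_linear)

lemma locally_lipschitz_add:
  fixes f g :: "'a::metric_space \<Rightarrow> 'b::real_normed_vector"
  assumes f: "locally_lipschitz f" and g: "locally_lipschitz g"
  shows "locally_lipschitz (\<lambda>x. f x + g x)"
  unfolding locally_lipschitz_def
proof (intro allI impI)
  fix B :: "'a set" assume B: "bounded B"
  from f B obtain L where L: "L-lipschitz_on B f" by (rule locally_lipschitzE)
  from g B obtain M where "M-lipschitz_on B g" by (rule locally_lipschitzE)
  from lipschitz_on_add [OF L this] show "\<exists>L. L-lipschitz_on B (\<lambda>x. f x + g x)" by blast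
qed

lemma locally_lipschitz_minus:
  fixes f :: "'a::metric_space \<Rightarrow> 'b::real_normed_vector"
  shows "locally_lipschitz f \<Longrightarrow> locally_lipschitz (\<lambda>x. - f x)"
  unfolding locally_lipschitz_def using lipschitz_on_minus by blast

lemma locally_lipschitz_diff:
  fixes f g :: "'a::metric_space \<Rightarrow> 'b::real_normed_vector"
  assumes f: "locally_lipschitz f" and g: "locally_lipschitz g"
  shows "locally_lipschitz (\<lambda>x. f x - g x)"
  using locally_lipschitz_add [OF f locally_lipschitz_minus [OF g]] by simp

lemma locally_lipschitz_const: "locally_lipschitz (\<lambda>x. c)"
  unfolding locally_lipschitz_def using lipschitz_on_constant by blast

lemma locally_lipschitz_sum:
  fixes f :: "'i \<Rightarrow> 'a::metric_space \<Rightarrow> 'b::real_normed_vector"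
  assumes "\<And>i. i \<in> I \<Longrightarrow> locally_lipschitz (f i)"
  shows "locally_lipschitz (\<lambda>x. \<Sum>i\<in>I. f i x)"
  using assms by (induction I rule: infinite_finite_induct)
    (auto intro: locally_lipschitz_const locally_lipschitz_add)

lemma locally_lipschitz_Pair:
  fixes f :: "'a::metric_space \<Rightarrow> 'b::real_normed_vector" and g :: "'a \<Rightarrow> 'c::real_normed_vector"
  assumes f: "locally_lipschitz f" and g: "locally_lipschitz g"
  shows "locally_lipschitz (\<lambda>x. (f x, g x))"
  unfolding locally_lipschitz_def
proof (intro allI impI)
  fix B :: "'a set" assume B: "bounded B"
  from f B obtain L where L: "L-lipschitz_on B f" by (rule locally_lipschitzE)
  from g B obtain M where "M-lipschitz_on B g" by (rule locally_lipschitzE)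
  from lipschitz_on_Pair [OF L this] show "\<exists>L. L-lipschitz_on B (\<lambda>x. (f x, g x))" by blast
qed

lemma locally_lipschitz_bilinear:
  fixes f :: "'a::metric_space \<Rightarrow> 'b::real_normed_vector" and g :: "'a \<Rightarrow> 'c::real_normed_vector"
  assumes bl: "bounded_bilinear prd" and f: "locally_lipschitz f" and g: "locally_lipschitz g"
  shows "locally_lipschitz (\<lambda>x. prd (f x) (g x))"
  unfolding locally_lipschitz_def
proof (intro allI impI)
  fix B :: "'a set" assume B: "bounded B"
  obtain L where L: "L-lipschitz_on B f" using f B by (rule locally_lipschitzE)
  obtain M where M: "M-lipschitz_on B g" using g B by (rule locally_lipschitzE)
  obtain a where a: "a > 0" "\<And>x. x \<in> B \<Longrightarrow> norm (f x) \<le> a"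
    using lipschitz_on_bounded_image [OF L B] unfolding bounded_pos by auto
  obtain b where b: "b > 0" "\<And>x. x \<in> B \<Longrightarrow> norm (g x) \<le> b"
    using lipschitz_on_bounded_image [OF M B] unfolding bounded_pos by auto
  obtain K where K: "K > 0" "\<And>u v. norm (prd u v) \<le> norm u * norm v * K"
    using bounded_bilinear.pos_bounded [OF bl] by blast
  have LM: "L \<ge> 0" "M \<ge> 0" using lipschitz_on_nonneg L M by auto
  have "(a * M * K + L * b * K)-lipschitz_on B (\<lambda>x. prd (f x) (g x))"
  proof (rule lipschitz_onI)
    fix x y assume xy: "x \<in> B" "y \<in> B"
    have "prd (f x) (g x) - prd (f y) (g y) = prd (f x) (g x - g y) + prd (f x - f y) (g y)"
      by (simp add: bounded_bilinear.diff_left [OF bl] bounded_bilinear.diff_right [OF bl])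
    then have "dist (prd (f x) (g x)) (prd (f y) (g y))
        \<le> norm (prd (f x) (g x - g y)) + norm (prd (f x - f y) (g y))"
      by (simp add: dist_norm norm_triangle_ineq)
    also have "\<dots> \<le> norm (f x) * norm (g x - g y) * K + norm (f x - f y) * norm (g y) * K"
      by (intro add_mono K)
    also have "\<dots> \<le> a * (M * dist x y) * K + (L * dist x y) * b * K"
      using lipschitz_onD [OF L xy] lipschitz_onD [OF M xy] a(2) [OF xy(1)] b(2) [OF xy(2)] K(1) LM a(1)
      by (intro add_mono mult_right_mono mult_mono) (auto simp: dist_norm)
    finally show "dist (prd (f x) (g x)) (prd (f y) (g y)) \<le> (a * M * K + L * b * K) * dist x y"
      by (simp add: algebra_simps)
  qed (use a b K LM in auto)
  then show "\<exists>L. L-lipschitz_on B (\<lambda>x. prd (f x) (g x))" by blast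
qed

lemma locally_lipschitz_C1:
  fixes f :: "'a::euclidean_space \<Rightarrow> 'b::real_normed_vector"
  assumes "C1_fun f"
  shows "locally_lipschitz f"
  unfolding locally_lipschitz_def
proof (intro allI impI)
  fix B :: "'a set" assume "bounded B"
  then obtain r where "\<And>x. x \<in> B \<Longrightarrow> norm x \<le> r" unfolding bounded_iff by blast
  then have r: "B \<subseteq> cball 0 r" by auto
  obtain f' where f': "\<And>x. (f has_derivative blinfun_apply (f' x)) (at x)" "continuous_on UNIV f'"
    using assms by (auto simp: C1_fun_def)
  have "bounded (f' ` cball 0 r)"
    by (intro compact_imp_bounded compact_continuous_image continuous_on_subset [OF f'(2)]) auto
  then obtain M where M: "M > 0" "\<And>x. x \<in> cball 0 r \<Longrightarrow> norm (f' x) \<le> M"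
    unfolding bounded_pos by auto
  have "M-lipschitz_on B f"
  proof (rule lipschitz_onI)
    fix x y assume xy: "x \<in> B" "y \<in> B"
    have "norm (f x - f y) \<le> M * norm (x - y)"
      by (rule differentiable_bound [of "cball 0 r" f "\<lambda>x. blinfun_apply (f' x)"])
        (use xy r M(2) f'(1) in \<open>auto simp: norm_blinfun.rep_eq [symmetric] intro: has_derivative_at_withinI\<close>)
    then show "dist (f x) (f y) \<le> M * dist x y" by (simp add: dist_norm)
  qed (use M in simp)
  then show "\<exists>L. L-lipschitz_on B f" by blast
qed

section \<open>The game\<close>

lemma blk_nth [simp]: "blk own i x $ k = (if own k = i then x $ k else 0)"
  by (simp add: blk_def)

lemma linear_blk: "linear (blk own i)"
  by (rule linearI) (simp_all add: vec_eq_iff)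

lemma blk_in_agent_space: "blk own i x \<in> agent_space own i"
  by (simp add: agent_space_def)

lemma sel_nth [simp]: "sel own bx $ k = bx $ own k $ k"
  by (simp add: sel_def col_def)

lemma linear_sel: "linear (sel own)"
  by (rule linearI) (simp_all add: vec_eq_iff)

lemma sel_replicate_vec [simp]: "sel own (replicate_vec x) = x"
  by (simp add: vec_eq_iff)

lemma norm_sel_le: "norm (sel own bx) \<le> norm bx"
proof (rule power2_le_imp_le)
  have "(norm (sel own bx))\<^sup>2 = (\<Sum>k\<in>UNIV. (bx $ own k $ k)\<^sup>2)"
    unfolding power2_norm_eq_inner by (simp add: inner_vec_def power2_eq_square)
  also have "\<dots> \<le> (\<Sum>k\<in>UNIV. \<Sum>i\<in>UNIV. (bx $ i $ k)\<^sup>2)"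
    by (intro sum_mono member_le_sum) auto
  also have "\<dots> = (norm bx)\<^sup>2"
    unfolding power2_norm_eq_inner inner_vec_def by (subst sum.swap) (simp add: power2_eq_square)
  finally show "(norm (sel own bx))\<^sup>2 \<le> (norm bx)\<^sup>2" .
qed simp

lemma inner_adjoint_sel: "adjoint (sel own) y \<bullet> bx = y \<bullet> sel own bx"
  using adjoint_works [OF linear_sel, of bx own y] by (simp add: inner_commute)

lemma ext_pseudo_gradient_nth [simp]:
  "ext_pseudo_gradient own J bx $ k = gradient (J (own k)) (bx $ own k) $ k"
  by (simp add: ext_pseudo_gradient_def partial_gradient_def col_def)

lemma pseudo_gradient_nth [simp]: "pseudo_gradient own J x $ k = gradient (J (own k)) x $ k"
  by (simp add: pseudo_gradient_def partial_gradient_def col_def)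

lemma ext_pseudo_gradient_replicate_vec [simp]:
  "ext_pseudo_gradient own J (replicate_vec x) = pseudo_gradient own J x"
  by (simp add: vec_eq_iff)

locale gne_game =
  fixes own :: "'n::finite \<Rightarrow> 'i::finite"
    and \<Omega> :: "'i \<Rightarrow> (real^'n) set"
    and g :: "'i \<Rightarrow> real^'n \<Rightarrow> real^'m::finite"
    and J :: "'i \<Rightarrow> real^'n \<Rightarrow> real"
    and E :: "('i \<times> 'i) set"
    and \<mu> \<theta>\<^sub>0 \<theta> c :: real
  assumes Omega: "\<And>i. \<Omega> i \<subseteq> agent_space own i" "\<And>i. closed (\<Omega> i)" "\<And>i. convex (\<Omega> i)"
    and g_convex: "\<And>i k. convex_on (agent_space own i) (\<lambda>u. g i u $ k)"
    and g_C2: "\<And>i. C2_fun (\<lambda>x. g i (blk own i x))"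
    and slater: "slater own \<Omega> g"
    and J_C1: "\<And>i. C1_fun (J i)"
    and J_convex: "\<And>i x. convex_on (agent_space own i) (\<lambda>u. J i (subst_blk own i u x))"
    and strongly_monotone: "\<mu> > 0" "strongly_monotone \<mu> (pseudo_gradient own J)"
    and lipschitz: "\<theta>\<^sub>0 > 0" "\<theta>\<^sub>0-lipschitz_on UNIV (pseudo_gradient own J)"
    and graph: "sym E" "graph_connected E"
    and theta: "\<theta> \<in> {\<mu>..\<theta>\<^sub>0}" "\<theta>-lipschitz_on UNIV (ext_pseudo_gradient own J)"
    and gain: "c > ((\<theta>\<^sub>0 + \<theta>)\<^sup>2 + 4 * \<mu> * \<theta>) / (4 * \<mu> * lambda2 (laplacian E))"
begin

abbreviation F where "F \<equiv> pseudo_gradient own J"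
abbreviation bF where "bF \<equiv> ext_pseudo_gradient own J"
abbreviation SL :: "real^'q^'i \<Rightarrow> real^'q^'i" where "SL \<equiv> stacked_laplacian E"
abbreviation "joint \<equiv> joint_set own \<Omega>"
abbreviation "sg \<equiv> stacked_g own g"
abbreviation "cg \<equiv> coupling own g"

lemma closed_joint: "closed joint" and convex_joint: "convex joint"
proof -
  have eq: "joint = (\<Inter>i. blk own i -` \<Omega> i)" by (auto simp: joint_set_def)
  have "closed (blk own i -` \<Omega> i)" for i
    using Omega(2) linear_blk by (intro closed_vimage linear_continuous_on) (auto simp: linear_conv_bounded_linear)
  then show "closed joint" unfolding eq by (intro closed_INT) auto
  show "convex joint" unfolding eq by (intro convex_INT convex_linear_vimage linear_blk Omega)
qed

lemma stacked_set_vimage: "stacked_set own \<Omega> = sel own -` joint"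
  by (auto simp: stacked_set_def)

lemma closed_stacked_set: "closed (stacked_set own \<Omega>)"
  unfolding stacked_set_vimage using linear_sel closed_joint
  by (intro closed_vimage linear_continuous_on) (auto simp: linear_conv_bounded_linear)

lemma convex_stacked_set: "convex (stacked_set own \<Omega>)"
  unfolding stacked_set_vimage by (intro convex_linear_vimage linear_sel convex_joint)

subsection \<open>The coupling constraints\<close>

text \<open>One choice for all agents of derivatives that are themselves C1. They belong to the
  composites with \<open>blk own i\<close>, the functions whose smoothness is assumed, and so act on
  joint actions.\<close>

definition Dg :: "'i \<Rightarrow> real^'n \<Rightarrow> ((real^'n) \<Rightarrow>\<^sub>L (real^'m))" where
  "Dg = (SOME D. \<forall>i. (\<forall>x. ((\<lambda>x. g i (blk own i x)) has_derivative blinfun_apply (D i x)) (at x)) \<and> C1_fun (D i))"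

lemma g_has_derivative: "((\<lambda>x. g i (blk own i x)) has_derivative blinfun_apply (Dg i x)) (at x)"
  and Dg_C1: "C1_fun (Dg i)"
proof -
  have "\<exists>D. \<forall>i. (\<forall>x. ((\<lambda>x. g i (blk own i x)) has_derivative blinfun_apply (D i x)) (at x)) \<and> C1_fun (D i)"
    using g_C2 unfolding C2_fun_def by metis
  from someI_ex [OF this] show "((\<lambda>x. g i (blk own i x)) has_derivative blinfun_apply (Dg i x)) (at x)" "C1_fun (Dg i)"
    unfolding Dg_def by blast+
qed

lemma g_C1: "C1_fun (\<lambda>x. g i (blk own i x))"
proof -
  have "continuous_on UNIV (Dg i)"
    using Dg_C1 [of i] unfolding C1_fun_def
    by (meson continuous_at_imp_continuous_on has_derivative_continuous)
  then show ?thesis unfolding C1_fun_def using g_has_derivative by blast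
qed

lemma stacked_g_nth [simp]: "sg x $ i = g i (blk own i x)"
  by (simp add: stacked_g_def)

lemma stacked_g_has_derivative: "(sg has_derivative (\<lambda>v. \<chi> i. blinfun_apply (Dg i x) v)) (at x)"
proof -
  \<comment> \<open>A stacked vector is the sum of its blocks placed by \<open>axis\<close>, which
    reduces the claim to linear maps and sums.\<close>
  have "((\<lambda>y. \<Sum>i\<in>UNIV. axis i (g i (blk own i y))) has_derivative (\<lambda>v. \<Sum>i\<in>UNIV. axis i (blinfun_apply (Dg i x) v))) (at x)"
  proof (rule has_derivative_sum)
    fix i
    have "bounded_linear (axis i :: real^'m \<Rightarrow> real^'m^'i)"
      unfolding linear_conv_bounded_linear [symmetric] by (rule linearI) (auto simp: vec_eq_iff axis_def)
    from bounded_linear.has_derivative [OF this g_has_derivative]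
    show "((\<lambda>y. axis i (g i (blk own i y)) :: real^'m^'i) has_derivative (\<lambda>v. axis i (blinfun_apply (Dg i x) v))) (at x)" .
  qed
  moreover have "(\<Sum>i\<in>UNIV. axis i (f i)) = (\<chi> i. f i)" for f :: "'i \<Rightarrow> real^'m"
    by (simp add: vec_eq_iff axis_def sum_component if_distrib [of "\<lambda>z. z $ _"] cong: if_cong)
  ultimately show ?thesis by (simp add: stacked_g_def [abs_def])
qed

lemma frechet_stacked_g: "frechet_derivative sg (at x) = (\<lambda>v. \<chi> i. blinfun_apply (Dg i x) v)"
  by (rule frechet_derivative_at [OF stacked_g_has_derivative, symmetric])

lemma coupling_has_derivative: "(cg has_derivative (\<lambda>v. \<Sum>i\<in>UNIV. blinfun_apply (Dg i x) v)) (at x)"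
  unfolding coupling_def [abs_def] by (intro has_derivative_sum g_has_derivative)

lemma frechet_coupling: "frechet_derivative cg (at x) = (\<lambda>v. \<Sum>i\<in>UNIV. blinfun_apply (Dg i x) v)"
  by (rule frechet_derivative_at [OF coupling_has_derivative, symmetric])

abbreviation jacT :: "real^'n \<Rightarrow> real^'m^'i \<Rightarrow> real^'n" where
  "jacT x l \<equiv> adjoint (frechet_derivative sg (at x)) l"

lemma inner_jacT: "jacT x l \<bullet> v = (\<Sum>i\<in>UNIV. l $ i \<bullet> blinfun_apply (Dg i x) v)"
proof -
  have "linear (frechet_derivative sg (at x))"
    unfolding frechet_stacked_g by (rule has_derivative_linear [OF stacked_g_has_derivative])
  from adjoint_works [OF this, of v l] have "jacT x l \<bullet> v = l \<bullet> (\<chi> i. blinfun_apply (Dg i x) v)"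
    by (simp add: frechet_stacked_g inner_commute)
  also have "\<dots> = (\<Sum>i\<in>UNIV. l $ i \<bullet> blinfun_apply (Dg i x) v)"
    by (subst inner_vec_def) simp
  finally show ?thesis .
qed

lemma inner_coupling_adjoint:
  "adjoint (frechet_derivative cg (at x)) l \<bullet> v = l \<bullet> (\<Sum>i\<in>UNIV. blinfun_apply (Dg i x) v)"
proof -
  have "linear (frechet_derivative cg (at x))"
    unfolding frechet_coupling by (rule has_derivative_linear [OF coupling_has_derivative])
  from adjoint_works [OF this, of v l] show ?thesis
    by (simp add: frechet_coupling inner_commute)
qed

lemma g_component_convex: "convex_on UNIV (\<lambda>x. g i (blk own i x) $ k)"
proof (rule convex_onI)
  fix t :: real and x y assume "0 < t" "t < 1"
  then have "g i ((1 - t) *\<^sub>R blk own i x + t *\<^sub>R blk own i y) $ k \<le> (1 - t) * g i (blk own i x) $ k + t * g i (blk own i y) $ k"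
    by (intro convex_onD [OF g_convex]) (auto intro: blk_in_agent_space)
  then show "g i (blk own i ((1 - t) *\<^sub>R x + t *\<^sub>R y)) $ k \<le> (1 - t) * g i (blk own i x) $ k + t * g i (blk own i y) $ k"
    by (simp add: linear_add [OF linear_blk] linear_scale [OF linear_blk])
qed simp

lemma g_above_tangent: "blinfun_apply (Dg i x) (y - x) \<le> g i (blk own i y) - g i (blk own i x)"
  unfolding less_eq_vec_def
proof
  fix k
  have "((\<lambda>x. g i (blk own i x) $ k) has_derivative (\<lambda>v. blinfun_apply (Dg i x) v $ k)) (at x)"
    by (rule bounded_linear.has_derivative [OF bounded_linear_vec_nth g_has_derivative])
  from convex_on_above_tangent [OF g_component_convex UNIV_I UNIV_I this]
  show "blinfun_apply (Dg i x) (y - x) $ k \<le> (g i (blk own i y) - g i (blk own i x)) $ k" by simp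
qed

lemma inner_g_above_tangent:
  assumes "0 \<le> l"
  shows "l \<bullet> blinfun_apply (Dg i x) (y - x) \<le> l \<bullet> (g i (blk own i y) - g i (blk own i x))"
  using inner_nonneg_vec [OF assms, of "g i (blk own i y) - g i (blk own i x) - blinfun_apply (Dg i x) (y - x)"]
    g_above_tangent [of i x y] by (simp add: inner_diff_right)

lemma coupling_above_tangent:
  assumes "0 \<le> l"
  shows "l \<bullet> (\<Sum>i\<in>UNIV. blinfun_apply (Dg i x) (y - x)) \<le> l \<bullet> (cg y - cg x)"
  unfolding coupling_def sum_subtractf [symmetric] inner_sum_right
  by (intro sum_mono inner_g_above_tangent assms)

text \<open>The Lagrangian is convex in the actions and linear in the multipliers, so its saddle
  operator is monotone. Concretely, the tangent inequality is used at \<open>x\<close> weighted by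
  \<open>l\<close> and at \<open>x'\<close> weighted by \<open>l'\<close>.\<close>

lemma lagrangian_monotone:
  assumes l: "0 \<le> l" "0 \<le> l'"
  shows "(jacT x l - jacT x' l') \<bullet> (x - x') \<ge> (sg x - sg x') \<bullet> (l - l')"
proof -
  have "(sg x $ i - sg x' $ i) \<bullet> (l $ i - l' $ i)
      \<le> l $ i \<bullet> blinfun_apply (Dg i x) (x - x') - l' $ i \<bullet> blinfun_apply (Dg i x') (x - x')" for i
  proof -
    have "0 \<le> l $ i" "0 \<le> l' $ i" using l by (auto simp: less_eq_vec_def)
    from inner_g_above_tangent [OF this(1), of i x x'] inner_g_above_tangent [OF this(2), of i x' x]
    have "l $ i \<bullet> (sg x $ i - sg x' $ i) \<le> l $ i \<bullet> blinfun_apply (Dg i x) (x - x')"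
      "l' $ i \<bullet> blinfun_apply (Dg i x') (x - x') \<le> l' $ i \<bullet> (sg x $ i - sg x' $ i)"
      by (auto simp: blinfun.diff_right inner_diff_right)
    then show ?thesis by (simp add: inner_diff_right inner_commute)
  qed
  then show ?thesis
    unfolding inner_diff_left [of "jacT x l"] inner_jacT
    by (simp add: inner_vec_def [of "sg x - sg x'"] sum_subtractf [symmetric] sum_mono)
qed

lemma coupling_component_convex: "convex_on UNIV (\<lambda>x. cg x $ k)"
proof (rule convex_onI)
  fix t :: real and x y assume t: "0 < t" "t < 1"
  have "cg ((1 - t) *\<^sub>R x + t *\<^sub>R y) $ k
      \<le> (\<Sum>i\<in>UNIV. (1 - t) * g i (blk own i x) $ k + t * g i (blk own i y) $ k)"
    unfolding coupling_def sum_component using t by (intro sum_mono convex_onD [OF g_component_convex]) auto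
  then show "cg ((1 - t) *\<^sub>R x + t *\<^sub>R y) $ k \<le> (1 - t) * cg x $ k + t * cg y $ k"
    by (simp add: coupling_def sum_component sum.distrib sum_distrib_left)
qed simp

lemma continuous_coupling: "continuous_on UNIV cg"
  by (meson continuous_at_imp_continuous_on coupling_has_derivative has_derivative_continuous)

lemma feasible_set_closed: "closed (feasible_set own \<Omega> g)"
  and feasible_set_convex: "convex (feasible_set own \<Omega> g)"
  and feasible_set_nonempty: "feasible_set own \<Omega> g \<noteq> {}"
proof -
  have eq: "{x. cg x \<le> 0} = (\<Inter>k. {x. cg x $ k \<le> 0})" by (auto simp: less_eq_vec_def)
  have "closed {x. cg x $ k \<le> 0}" for k
    using continuous_coupling by (intro closed_Collect_le continuous_intros)
  then show "closed (feasible_set own \<Omega> g)"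
    unfolding feasible_set_def eq by (intro closed_Int closed_INT closed_joint) auto
  have "convex {x. cg x $ k \<le> 0}" for k
  proof (rule convexI)
    fix x y and u v :: real
    assume "x \<in> {x. cg x $ k \<le> 0}" "y \<in> {x. cg x $ k \<le> 0}" and uv: "0 \<le> u" "0 \<le> v" "u + v = 1"
    then have "u * cg x $ k + v * cg y $ k \<le> 0" by (auto intro: add_nonpos_nonpos mult_nonneg_nonpos)
    moreover have "cg (u *\<^sub>R x + v *\<^sub>R y) $ k \<le> u * cg x $ k + v * cg y $ k"
      using coupling_component_convex [of k] uv by (auto simp: convex_on_def)
    ultimately show "u *\<^sub>R x + v *\<^sub>R y \<in> {x. cg x $ k \<le> 0}" by simp
  qed
  then show "convex (feasible_set own \<Omega> g)"
    unfolding feasible_set_def eq by (intro convex_Int convex_INT convex_joint) auto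
  show "feasible_set own \<Omega> g \<noteq> {}"
    using slater by (fastforce simp: slater_def feasible_set_def less_eq_vec_def less_imp_le)
qed

subsection \<open>Variational equilibria\<close>

lemma KKT_iff:
  "KKT own \<Omega> g J x l \<longleftrightarrow> x \<in> joint \<and>
     (\<forall>y\<in>joint. F x \<bullet> (y - x) + l \<bullet> (\<Sum>i\<in>UNIV. blinfun_apply (Dg i x) (y - x)) \<ge> 0) \<and>
     0 \<le> l \<and> cg x \<le> 0 \<and> cg x \<bullet> l = 0"
  unfolding KKT_def zero_in_translated_iff normal_cone_nonneg_orthant
  by (auto simp: normal_cone_def inner_add_left inner_coupling_adjoint inner_diff_left)

lemma KKT_feasible: "KKT own \<Omega> g J x l \<Longrightarrow> x \<in> feasible_set own \<Omega> g"
  by (simp add: KKT_iff feasible_set_def)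

text \<open>Convexity replaces the linearized constraints by \<open>cg y - cg x\<close>; by
  complementarity at \<open>x\<close> and feasibility of \<open>y\<close> the multiplier term is
  then nonpositive and can be discarded.\<close>

lemma KKT_variational_inequality:
  assumes K: "KKT own \<Omega> g J x l" and y: "y \<in> feasible_set own \<Omega> g"
  shows "F x \<bullet> (y - x) \<ge> 0"
proof -
  have l: "0 \<le> l" "cg x \<bullet> l = 0" using K by (auto simp: KKT_iff)
  have "0 \<le> F x \<bullet> (y - x) + l \<bullet> (\<Sum>i\<in>UNIV. blinfun_apply (Dg i x) (y - x))"
    using K y by (auto simp: KKT_iff feasible_set_def)
  also have "\<dots> \<le> F x \<bullet> (y - x) + l \<bullet> (cg y - cg x)"
    using coupling_above_tangent [OF l(1)] by simp
  also have "l \<bullet> (cg y - cg x) \<le> 0"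
    using inner_nonneg_vec [OF l(1), of "- cg y"] y l(2)
    by (auto simp: feasible_set_def inner_diff_right inner_commute less_eq_vec_def)
  finally show ?thesis by simp
qed

lemma KKT_unique:
  assumes "KKT own \<Omega> g J x l" "KKT own \<Omega> g J y l'"
  shows "x = y"
proof -
  have "\<mu> * (norm (x - y))\<^sup>2 \<le> (F x - F y) \<bullet> (x - y)"
    using strongly_monotone(2) by (simp add: strongly_monotone_def)
  also have "\<dots> \<le> 0"
    using KKT_variational_inequality [OF assms(1) KKT_feasible [OF assms(2)]]
      KKT_variational_inequality [OF assms(2) KKT_feasible [OF assms(1)]]
    by (simp add: inner_diff_left inner_diff_right)
  finally show ?thesis using strongly_monotone(1) by (simp add: mult_le_0_iff)
qed

text \<open>Freezing \<open>F\<close> at the solution \<open>x\<close> of the variational inequality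
  over the feasible set makes \<open>x\<close> optimal for a linear objective, to which the
  multiplier theorem applies.\<close>

lemma KKT_exists: "\<exists>x l. KKT own \<Omega> g J x l"
proof -
  have mt: "\<mu> \<le> \<theta>\<^sub>0" using theta(1) by simp
  obtain x where x: "x \<in> feasible_set own \<Omega> g" "\<And>y. y \<in> feasible_set own \<Omega> g \<Longrightarrow> F x \<bullet> (y - x) \<ge> 0"
    using variational_inequality_exists [OF feasible_set_closed feasible_set_convex feasible_set_nonempty
        strongly_monotone(2) lipschitz(2) strongly_monotone(1) mt] by blast
  obtain s where s: "s \<in> joint" "\<And>k. cg s $ k < 0" using slater by (auto simp: slater_def)
  obtain l where l: "0 \<le> l" "l \<bullet> cg x = 0" "\<And>y. y \<in> joint \<Longrightarrow> F x \<bullet> (y - x) + l \<bullet> cg y \<ge> 0"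
  proof (rule lagrange_multipliers [of joint cg x s "F x"])
    show "convex_on joint (\<lambda>y. cg y $ k)" for k
      by (rule convex_on_subset [OF coupling_component_convex]) (auto simp: convex_joint)
    show "0 \<le> F x \<bullet> (y - x)" if "y \<in> joint" "cg y \<le> 0" for y
      using that by (intro x(2)) (simp add: feasible_set_def)
  qed (use x(1) s convex_joint in \<open>auto simp: feasible_set_def\<close>)
  \<comment> \<open>The Lagrangian is nonnegative on \<open>joint\<close> and zero at
    \<open>x\<close>, so its derivative at \<open>x\<close> along a segment into
    \<open>joint\<close> is nonnegative.\<close>
  have "F x \<bullet> (y - x) + l \<bullet> (\<Sum>i\<in>UNIV. blinfun_apply (Dg i x) (y - x)) \<ge> 0" if y: "y \<in> joint" for y
  proof (rule tendsto_lowerbound)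
    have "((\<lambda>z. F x \<bullet> (z - x) + l \<bullet> cg z) has_derivative (\<lambda>v. F x \<bullet> v + l \<bullet> (\<Sum>i\<in>UNIV. blinfun_apply (Dg i x) v))) (at x)"
      by (auto intro!: derivative_eq_intros coupling_has_derivative)
    from directional_derivative_quotient [OF this, of "y - x"]
    show "((\<lambda>t. (F x \<bullet> (x + t *\<^sub>R (y - x) - x) + l \<bullet> cg (x + t *\<^sub>R (y - x)) - (F x \<bullet> (x - x) + l \<bullet> cg x)) / t)
       \<longlongrightarrow> F x \<bullet> (y - x) + l \<bullet> (\<Sum>i\<in>UNIV. blinfun_apply (Dg i x) (y - x))) (at_right 0)" .
    have "eventually (\<lambda>t. t < (1::real)) (at_right 0)"
      by (auto simp: eventually_at_right_field intro: exI [of _ 1])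
    then show "eventually (\<lambda>t. 0 \<le> (F x \<bullet> (x + t *\<^sub>R (y - x) - x) + l \<bullet> cg (x + t *\<^sub>R (y - x)) - (F x \<bullet> (x - x) + l \<bullet> cg x)) / t) (at_right 0)"
      using eventually_at_right_less
    proof eventually_elim
      case (elim t)
      have "x + t *\<^sub>R (y - x) = (1 - t) *\<^sub>R x + t *\<^sub>R y" by (simp add: algebra_simps)
      also have "\<dots> \<in> joint" using x(1) y elim by (intro convexD [OF convex_joint]) (auto simp: feasible_set_def)
      finally show ?case using l(2) l(3) [of "x + t *\<^sub>R (y - x)"] elim by (intro divide_nonneg_pos) auto
    qed
  qed simp
  then have "KKT own \<Omega> g J x l"
    using x(1) l by (auto simp: KKT_iff feasible_set_def inner_commute)
  then show ?thesis by blast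
qed

text \<open>A profitable unilateral deviation would, by convexity of the agent's own cost, be a
  direction of negative derivative. Only the block of agent \<open>i\<close> moves, so that
  derivative is \<open>F x \<bullet> (y - x)\<close> for a feasible \<open>y\<close>, which is
  nonnegative.\<close>

lemma KKT_imp_GNE:
  assumes K: "KKT own \<Omega> g J x l"
  shows "is_GNE own \<Omega> g J x"
  unfolding is_GNE_def is_arg_min_def
proof (intro allI conjI notI)
  fix i
  have self: "subst_blk own i (blk own i x) x = x" by (simp add: vec_eq_iff subst_blk_def)
  show "blk own i x \<in> agent_space own i" by (rule blk_in_agent_space)
  show "subst_blk own i (blk own i x) x \<in> feasible_set own \<Omega> g" unfolding self by (rule KKT_feasible [OF K])
  assume "\<exists>u. (u \<in> agent_space own i \<and> subst_blk own i u x \<in> feasible_set own \<Omega> g) \<and>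
      J i (subst_blk own i u x) < J i (subst_blk own i (blk own i x) x)"
  then obtain u where u: "u \<in> agent_space own i" "subst_blk own i u x \<in> feasible_set own \<Omega> g"
    "J i (subst_blk own i u x) < J i x" by (auto simp: self)
  let ?y = "subst_blk own i u x"
  have "((\<lambda>u. subst_blk own i u x) has_derivative blk own i) (at (blk own i x))"
  proof -
    have "(\<lambda>u. subst_blk own i u x) = (\<lambda>u. blk own i u + (x - blk own i x))"
      by (auto simp: fun_eq_iff vec_eq_iff subst_blk_def)
    moreover have "(blk own i has_derivative blk own i) (at (blk own i x))"
      using linear_blk by (intro bounded_linear_imp_has_derivative) (simp add: linear_conv_bounded_linear)
    ultimately show ?thesis by (auto intro!: derivative_eq_intros)
  qed
  from has_derivative_compose [OF this, of "J i" "\<lambda>h. h \<bullet> gradient (J i) x"]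
  have "((\<lambda>u. J i (subst_blk own i u x)) has_derivative (\<lambda>h. blk own i h \<bullet> gradient (J i) x)) (at (blk own i x))"
    using C1_fun_has_gradient [OF J_C1, of i x] by (simp add: self)
  from convex_on_above_tangent [OF J_convex blk_in_agent_space u(1) this]
  have "blk own i (u - blk own i x) \<bullet> gradient (J i) x < 0" using u(3) by (simp add: self)
  also have "blk own i (u - blk own i x) \<bullet> gradient (J i) x = F x \<bullet> (?y - x)"
    unfolding inner_vec_def by (intro sum.cong) (auto simp: subst_blk_def mult.commute)
  also have "\<dots> \<ge> 0" by (rule KKT_variational_inequality [OF K u(2)])
  finally show False by simp
qed

lemma KKT_imp_vGNE: "KKT own \<Omega> g J x l \<Longrightarrow> is_vGNE own \<Omega> g J x"
  using KKT_imp_GNE by (auto simp: is_vGNE_def)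

lemma vGNE_unique: "KKT own \<Omega> g J x l \<Longrightarrow> is_vGNE own \<Omega> g J y \<Longrightarrow> y = x"
  using KKT_unique by (auto simp: is_vGNE_def)

subsection \<open>Monotonicity of the augmented extended pseudo-gradient\<close>

text \<open>Let \<open>a\<close> be the distance of the mean estimate from \<open>x\<close> and
  \<open>b\<close> the size of the disagreement. The increment of \<open>bF\<close> splits at the
  mean: between two consensus vectors it is an increment of \<open>F\<close>, with constants \<mu>
  and \<open>\<theta>\<^sub>0\<close>, and the rest costs \<open>\<theta> * b\<close>. Pairing both
  with the two parts of the actions gives a quadratic form in \<open>a\<close> and \<open>b\<close>
  with cross coefficient \<open>\<theta>\<^sub>0 + \<theta>\<close>, and the gain bound is its
  discriminant condition. Being definite, the form also settles the case of equality.\<close>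

lemma augmented_monotone:
  fixes bx :: "real^'n^'i"
  shows "(bF bx - F x) \<bullet> (sel own bx - x) + c * (SL bx \<bullet> bx) \<ge> 0"
    and "(bF bx - F x) \<bullet> (sel own bx - x) + c * (SL bx \<bullet> bx) \<le> 0 \<Longrightarrow> bx = replicate_vec x"
proof -
  have \<theta>: "\<theta> > 0" using theta(1) strongly_monotone(1) by auto
  obtain \<kappa> where \<kappa>: "4 * \<mu> * \<kappa> > (\<theta>\<^sub>0 + \<theta>)\<^sup>2 + 4 * \<mu> * \<theta>"
    "\<And>v :: real^'n^'i. c * (SL v \<bullet> v) \<ge> \<kappa> * (norm (v - replicate_vec (mean v)))\<^sup>2"
  proof (rule stacked_laplacian_gain [OF graph strongly_monotone(1) _ gain])
    show "(\<theta>\<^sub>0 + \<theta>)\<^sup>2 + 4 * \<mu> * \<theta> > 0" using strongly_monotone(1) \<theta> by (intro add_nonneg_pos) auto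
  qed blast
  let ?y = "mean bx"
  define p where "p = bx - replicate_vec ?y"
  define a where "a = norm (?y - x)"
  define b where "b = norm p"
  let ?T = "(bF bx - F x) \<bullet> (sel own bx - x) + c * (SL bx \<bullet> bx)"
  have sp: "sel own bx - x = sel own p + (?y - x)" by (simp add: p_def linear_diff [OF linear_sel])
  have np: "norm (sel own p) \<le> b" by (simp add: b_def norm_sel_le)
  have nF: "norm (F ?y - F x) \<le> \<theta>\<^sub>0 * a"
    using lipschitz_onD [OF lipschitz(2), of ?y x] by (simp add: dist_norm a_def)
  have nbF: "norm (bF bx - F ?y) \<le> \<theta> * b"
    using lipschitz_onD [OF theta(2), of bx "replicate_vec ?y"] by (simp add: dist_norm b_def p_def)
  have 1: "(F ?y - F x) \<bullet> (?y - x) \<ge> \<mu> * a\<^sup>2"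
    using strongly_monotone(2) by (simp add: strongly_monotone_def a_def)
  have cs: "u \<bullet> v \<ge> - (r * s)" if "norm u \<le> r" "norm v \<le> s" for u v :: "real^'n" and r s
  proof -
    have "norm u * norm v \<le> r * s"
      using that norm_ge_zero [of u] by (intro mult_mono) (auto intro: order_trans [OF norm_ge_zero])
    then show ?thesis using Cauchy_Schwarz_ineq2 [of u v] by linarith
  qed
  have 2: "(F ?y - F x) \<bullet> sel own p \<ge> - (\<theta>\<^sub>0 * a * b)" by (rule cs [OF nF np])
  have 3: "(bF bx - F ?y) \<bullet> (?y - x) \<ge> - (\<theta> * b * a)" by (rule cs [OF nbF]) (simp add: a_def)
  have 4: "(bF bx - F ?y) \<bullet> sel own p \<ge> - (\<theta> * b * b)" by (rule cs [OF nbF np])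
  have 5: "c * (SL bx \<bullet> bx) \<ge> \<kappa> * b\<^sup>2" using \<kappa>(2) [of bx] by (simp add: b_def p_def)
  have "?T = (F ?y - F x) \<bullet> (?y - x) + (F ?y - F x) \<bullet> sel own p + (bF bx - F ?y) \<bullet> (?y - x)
     + (bF bx - F ?y) \<bullet> sel own p + c * (SL bx \<bullet> bx)"
    unfolding sp by (simp add: inner_diff_left inner_add_right)
  then have T: "?T \<ge> \<mu> * a\<^sup>2 - (\<theta>\<^sub>0 + \<theta>) * a * b + (\<kappa> - \<theta>) * b\<^sup>2"
    using 1 2 3 4 5 by (simp add: algebra_simps power2_eq_square)
  have "4 * \<mu> * ?T \<ge> 4 * \<mu> * (\<mu> * a\<^sup>2 - (\<theta>\<^sub>0 + \<theta>) * a * b + (\<kappa> - \<theta>) * b\<^sup>2)"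
    using T strongly_monotone(1) by simp
  \<comment> \<open>Completing the square in \<open>a\<close> after multiplication by
    \<open>4 * \<mu>\<close>: the remaining coefficient of the square of \<open>b\<close> is what
    the choice of \<kappa> makes positive.\<close>
  also have "4 * \<mu> * (\<mu> * a\<^sup>2 - (\<theta>\<^sub>0 + \<theta>) * a * b + (\<kappa> - \<theta>) * b\<^sup>2)
      = (2 * \<mu> * a - (\<theta>\<^sub>0 + \<theta>) * b)\<^sup>2 + (4 * \<mu> * \<kappa> - ((\<theta>\<^sub>0 + \<theta>)\<^sup>2 + 4 * \<mu> * \<theta>)) * b\<^sup>2"
    by (simp add: power2_eq_square algebra_simps)
  finally have main: "(2 * \<mu> * a - (\<theta>\<^sub>0 + \<theta>) * b)\<^sup>2 + (4 * \<mu> * \<kappa> - ((\<theta>\<^sub>0 + \<theta>)\<^sup>2 + 4 * \<mu> * \<theta>)) * b\<^sup>2 \<le> 4 * \<mu> * ?T" .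
  have nn: "(4 * \<mu> * \<kappa> - ((\<theta>\<^sub>0 + \<theta>)\<^sup>2 + 4 * \<mu> * \<theta>)) * b\<^sup>2 \<ge> 0" using \<kappa>(1) by (intro mult_nonneg_nonneg) auto
  have "4 * \<mu> * ?T \<ge> 0" by (rule order_trans [OF _ main]) (use nn in \<open>intro add_nonneg_nonneg, auto\<close>)
  then show "?T \<ge> 0" using strongly_monotone(1) by (simp add: zero_le_mult_iff)
  assume "?T \<le> 0"
  then have "4 * \<mu> * ?T \<le> 0" using strongly_monotone(1) by (simp add: mult_nonneg_nonpos)
  then have sum0: "(2 * \<mu> * a - (\<theta>\<^sub>0 + \<theta>) * b)\<^sup>2 + (4 * \<mu> * \<kappa> - ((\<theta>\<^sub>0 + \<theta>)\<^sup>2 + 4 * \<mu> * \<theta>)) * b\<^sup>2 \<le> 0"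
    using main by linarith
  then have "(4 * \<mu> * \<kappa> - ((\<theta>\<^sub>0 + \<theta>)\<^sup>2 + 4 * \<mu> * \<theta>)) * b\<^sup>2 = 0"
    using nn zero_le_power2 [of "2 * \<mu> * a - (\<theta>\<^sub>0 + \<theta>) * b"] by linarith
  then have b0: "b = 0" using \<kappa>(1) by simp
  with sum0 have "a = 0" using strongly_monotone(1) by simp
  with b0 show "bx = replicate_vec x" by (simp add: a_def b_def p_def)
qed

end

section \<open>Products, invariance and uniqueness\<close>

text \<open>Only the inclusion of the tangent cone of the product in the product of the tangent
  cones is used. The two orthogonality terms are each nonpositive and add up to zero, so both vanish
  and each component is characterized by \<open>proj_vec_unique\<close>.\<close>

lemma proj_vec_Times:
  fixes A :: "'a::euclidean_space set" and B :: "'b::euclidean_space set"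
  assumes A: "convex A" "a \<in> A" and B: "convex B" "b \<in> B"
  shows "proj_vec (A \<times> B) (a, b) (f, g) = (proj_vec A a f, proj_vec B b g)"
proof -
  have AB: "convex (A \<times> B)" "(a, b) \<in> A \<times> B" using A B by (auto intro: convex_Times)
  obtain v1 v2 where v: "proj_vec (A \<times> B) (a, b) (f, g) = (v1, v2)" by (meson surj_pair)
  have T: "(v1, v2) \<in> tangent_cone (A \<times> B) (a, b)"
    unfolding v [symmetric] using AB(2) by (intro proj_vec_in_tangent_cone) auto
  have N: "(f - v1, g - v2) \<in> normal_cone (A \<times> B) (a, b)"
    using proj_vec_normal [OF AB, of "(f, g)"] by (simp add: v)
  have O: "(f - v1) \<bullet> v1 + (g - v2) \<bullet> v2 = 0"
    using proj_vec_orthogonal [OF AB, of "(f, g)"] by (simp add: v)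
  let ?C = "{c *\<^sub>R (z - (a, b)) | c z. c > 0 \<and> z \<in> A \<times> B}"
  have "fst ` ?C \<subseteq> {c *\<^sub>R (z - a) | c z. c > 0 \<and> z \<in> A}" by force
  then have "fst ` closure ?C \<subseteq> closure {c *\<^sub>R (z - a) | c z. c > 0 \<and> z \<in> A}"
    using closure_bounded_linear_image_subset [OF bounded_linear_fst, of ?C] closure_mono by blast
  then have T1: "v1 \<in> tangent_cone A a" using T unfolding tangent_cone_alt by force
  have "snd ` ?C \<subseteq> {c *\<^sub>R (z - b) | c z. c > 0 \<and> z \<in> B}" by force
  then have "snd ` closure ?C \<subseteq> closure {c *\<^sub>R (z - b) | c z. c > 0 \<and> z \<in> B}"
    using closure_bounded_linear_image_subset [OF bounded_linear_snd, of ?C] closure_mono by blast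
  then have T2: "v2 \<in> tangent_cone B b" using T unfolding tangent_cone_alt by force
  have N1: "f - v1 \<in> normal_cone A a" using N B(2) unfolding normal_cone_def by fastforce
  have N2: "g - v2 \<in> normal_cone B b" using N A(2) unfolding normal_cone_def by fastforce
  have "(f - v1) \<bullet> v1 \<le> 0" using N1 by (intro tangent_cone_subset_halfspace [OF _ T1]) (simp add: normal_cone_def)
  moreover have "(g - v2) \<bullet> v2 \<le> 0" using N2 by (intro tangent_cone_subset_halfspace [OF _ T2]) (simp add: normal_cone_def)
  ultimately have "(f - v1) \<bullet> v1 = 0" "(g - v2) \<bullet> v2 = 0" using O by linarith+
  then show ?thesis
    using proj_vec_unique [OF A T1 N1] proj_vec_unique [OF B T2 N2] v by simp
qed

section \<open>Invariance and uniqueness for almost everywhere differentiable curves\<close>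

lemma AE_lebesgue_negligible:
  assumes "AE t in lebesgue. P t"
  obtains N where "negligible N" "\<And>t. t \<notin> N \<Longrightarrow> P t"
proof -
  obtain N where "{t \<in> space lebesgue. \<not> P t} \<subseteq> N" "N \<in> null_sets lebesgue"
    using assms unfolding eventually_ae_filter by blast
  with that [of N] show thesis by (auto simp: negligible_iff_null_sets)
qed

text \<open>Outside \<open>K\<close> every direction of the cone generated by \<open>K - x\<close> points towards the
  projection of \<open>x\<close>, so the squared distance to \<open>K\<close> cannot increase.\<close>

lemma proj_vec_invariant:
  fixes y :: "real \<Rightarrow> 'a::euclidean_space"
  assumes K: "closed K" "convex K" and y0: "y 0 \<in> K"
    and ac: "\<And>T. T > 0 \<Longrightarrow> abs_continuous_on 0 T y" and N: "negligible N"
    and deriv: "\<And>t. t \<ge> 0 \<Longrightarrow> t \<notin> N \<Longrightarrow> \<exists>u. (y has_vector_derivative proj_vec K (y t) u) (at t within {0..})"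
    and T: "T \<ge> 0"
  shows "y T \<in> K"
proof (cases "T = 0")
  case False
  then have T: "T > 0" using T by simp
  have ne: "K \<noteq> {}" using y0 by auto
  define p where "p t = closest_point K (y t)" for t
  define \<phi> where "\<phi> t = (norm (y t - p t))\<^sup>2" for t
  have pK: "p t \<in> K" for t unfolding p_def by (rule closest_point_in_set [OF K(1) ne])
  have ycont: "continuous_on {0..T} y" by (rule abs_continuous_on_imp_continuous [OF ac [OF T]])
  have pcont: "continuous_on {0..T} p"
    unfolding p_def by (rule continuous_on_compose2 [OF continuous_on_closest_point [OF K(2,1) ne, of UNIV] ycont]) auto
  obtain b where b: "b > 0" "\<And>t. t \<in> {0..T} \<Longrightarrow> norm (y t - p t) \<le> b"
  proof -
    have "bounded ((\<lambda>t. y t - p t) ` {0..T})"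
      by (intro compact_imp_bounded compact_continuous_image continuous_on_diff ycont pcont) simp
    then show thesis using that unfolding bounded_pos by auto
  qed
  \<comment> \<open>Comparing \<open>y t\<close> with the earlier projection \<open>p s\<close>
    bounds the increase by an expression linear in the increment of \<open>y\<close>, so
    \<open>p\<close> needs only to be continuous.\<close>
  have incr: "\<phi> t - \<phi> s \<le> (y t - y s) \<bullet> (y t + y s - 2 *\<^sub>R p s)" for s t
  proof -
    have "norm (y t - p t) \<le> norm (y t - p s)"
      using closest_point_le [OF K(1) pK, of "y t" s] by (simp add: p_def dist_norm)
    then have "\<phi> t \<le> (norm (y t - p s))\<^sup>2" unfolding \<phi>_def by (intro power_mono) auto
    also have "\<dots> = \<phi> s + (y t - y s) \<bullet> (y t + y s - 2 *\<^sub>R p s)"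
      unfolding \<phi>_def power2_norm_eq_inner by (simp add: algebra_simps inner_commute)
    finally show ?thesis by simp
  qed
  have acphi: "abs_continuous_on 0 T \<phi>"
  proof (rule abs_continuous_on_dominated [OF ac [OF T], of "2 * b"])
    fix s t assume st: "0 \<le> s" "s \<le> t" "t \<le> T"
    have "\<bar>norm (y t - p t) - norm (y s - p s)\<bar> \<le> norm (y t - y s)"
    proof -
      have "norm (y t - p t) = infdist (y t) K" for t
        using setdist_closest_point [OF K(1) ne, of "y t"] ne by (simp add: p_def infdist_eq_setdist dist_norm)
      then show ?thesis using infdist_triangle_abs [of "y t" K "y s"] by (simp add: dist_norm)
    qed
    moreover have "norm (y t - p t) + norm (y s - p s) \<le> 2 * b" using b(2) [of s] b(2) [of t] st by auto
    moreover have "\<phi> t - \<phi> s = (norm (y t - p t) - norm (y s - p s)) * (norm (y t - p t) + norm (y s - p s))"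
      by (simp add: \<phi>_def power2_eq_square algebra_simps)
    ultimately have "norm (\<phi> t - \<phi> s) \<le> norm (y t - y s) * (2 * b)"
      by (auto simp: abs_mult intro!: mult_mono)
    also have "\<dots> \<le> 2 * b * (t - s + norm (y t - y s))" using b(1) st by (simp add: algebra_simps)
    finally show "norm (\<phi> t - \<phi> s) \<le> 2 * b * (t - s + norm (y t - y s))" .
  qed (use b in auto)
  have "\<phi> T \<le> \<phi> 0"
  proof (rule abs_continuous_on_nonincreasing [OF less_imp_le [OF T] acphi N])
    fix x e :: real assume x: "x \<in> {0..T} - N" and e: "e > 0"
    obtain u where u: "(y has_vector_derivative proj_vec K (y x) u) (at x within {0..})"
      using deriv [of x] x by auto
    define v where "v = proj_vec K (y x) u"
    have v: "(y has_vector_derivative v) (at x within {0..T})"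
      using u unfolding v_def by (rule has_vector_derivative_within_subset) auto
    have vn: "(y x - p x) \<bullet> v \<le> 0"
    proof (rule tangent_cone_subset_halfspace)
      show "v \<in> tangent_cone K (y x)" unfolding v_def by (rule proj_vec_in_tangent_cone [OF ne])
      fix z assume "z \<in> K"
      then have "(y x - p x) \<bullet> (z - p x) \<le> 0" unfolding p_def by (rule closest_point_dot [OF K(2,1)])
      moreover have "(y x - p x) \<bullet> (z - y x) = (y x - p x) \<bullet> (z - p x) - (y x - p x) \<bullet> (y x - p x)"
        by (simp add: inner_diff_right)
      ultimately show "(y x - p x) \<bullet> (z - y x) \<le> 0" using inner_ge_zero [of "y x - p x"] by linarith
    qed
    \<comment> \<open>The limit, as \<open>s\<close> and \<open>t\<close> approach \<open>x\<close>,
      of the factor that \<open>incr\<close> pairs with the increment of \<open>y\<close>.\<close>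
    define w where "w = 2 *\<^sub>R (y x - p x)"
    define W where "W = norm w + norm v + 2"
    define e1 where "e1 = min 1 (e / (2 * W))"
    have e1: "e1 > 0" "e1 \<le> 1" "e1 * (norm w + norm v + 2) < e"
    proof -
      have pos: "W > 0" by (simp add: W_def add_nonneg_pos)
      show "e1 > 0" "e1 \<le> 1" using e pos by (auto simp: e1_def)
      have "e1 * W \<le> e / (2 * W) * W"
        using pos by (intro mult_right_mono) (auto simp: e1_def)
      also have "\<dots> < e" using pos e by simp
      finally show "e1 * (norm w + norm v + 2) < e" by (simp add: W_def)
    qed
    obtain d1 where d1: "d1 > 0" "\<And>s t. s \<in> {0..T} \<and> t \<in> {0..T} \<and> s \<le> x \<and> x \<le> t \<and> x - d1 < s \<and> t < x + d1 \<Longrightarrow>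
            norm (y t - y s - (t - s) *\<^sub>R v) \<le> e1 * (t - s)"
      using has_vector_derivative_straddle [OF v e1(1)] x by blast
    \<comment> \<open>The quarters add up in \<open>q - w\<close>: two increments of
      \<open>y\<close> and twice one increment of \<open>p\<close>.\<close>
    obtain d2 where d2: "d2 > 0" "\<And>t. t \<in> {0..T} \<Longrightarrow> dist t x < d2 \<Longrightarrow> dist (y t) (y x) < e1 / 4"
      using ycont e1(1) x unfolding continuous_on_iff by (metis DiffD1 zero_less_divide_iff zero_less_numeral)
    obtain d3 where d3: "d3 > 0" "\<And>t. t \<in> {0..T} \<Longrightarrow> dist t x < d3 \<Longrightarrow> dist (p t) (p x) < e1 / 4"
      using pcont e1(1) x unfolding continuous_on_iff by (metis DiffD1 zero_less_divide_iff zero_less_numeral)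
    show "\<exists>d>0. \<forall>s t. 0 \<le> s \<and> s \<le> x \<and> x \<le> t \<and> t \<le> T \<and> x - d < s \<and> t < x + d \<longrightarrow> \<phi> t - \<phi> s \<le> e * (t - s)"
    proof (intro exI conjI allI impI)
      show "min d1 (min d2 d3) > 0" using d1 d2 d3 by simp
      fix s t assume st: "0 \<le> s \<and> s \<le> x \<and> x \<le> t \<and> t \<le> T \<and> x - min d1 (min d2 d3) < s \<and> t < x + min d1 (min d2 d3)"
      define q where "q = y t + y s - 2 *\<^sub>R p s"
      define r where "r = y t - y s - (t - s) *\<^sub>R v"
      have r: "norm r \<le> e1 * (t - s)" unfolding r_def using st by (intro d1) auto
      have "norm (y t - y x) < e1 / 4" "norm (y s - y x) < e1 / 4" "norm (p s - p x) < e1 / 4"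
        using d2(2) [of t] d2(2) [of s] d3(2) [of s] st by (auto simp: dist_norm)
      moreover have "q - w = (y t - y x) + (y s - y x) - 2 *\<^sub>R (p s - p x)"
        by (simp add: q_def w_def scaleR_2 algebra_simps)
      ultimately have qw: "norm (q - w) \<le> e1"
        using norm_triangle_ineq4 [of "(y t - y x) + (y s - y x)" "2 *\<^sub>R (p s - p x)"]
          norm_triangle_ineq [of "y t - y x" "y s - y x"] by simp
      have "\<phi> t - \<phi> s \<le> ((t - s) *\<^sub>R v + r) \<bullet> q"
        using incr [of t s] by (simp add: q_def r_def)
      also have "\<dots> = (t - s) * (v \<bullet> w) + (t - s) * (v \<bullet> (q - w)) + r \<bullet> q"
        by (simp add: algebra_simps)
      also have "\<dots> \<le> 0 + (t - s) * (norm v * e1) + e1 * (t - s) * (norm w + 1)"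
      proof (intro add_mono)
        show "(t - s) * (v \<bullet> w) \<le> 0"
          using vn st by (intro mult_nonneg_nonpos) (auto simp: w_def inner_commute)
        show "(t - s) * (v \<bullet> (q - w)) \<le> (t - s) * (norm v * e1)"
          using qw st by (intro mult_left_mono order_trans [OF norm_cauchy_schwarz]) auto
        have "norm q \<le> norm w + 1" using qw e1(2) norm_triangle_sub [of q w] by linarith
        then show "r \<bullet> q \<le> e1 * (t - s) * (norm w + 1)"
          using r order_trans [OF norm_ge_zero r]
          by (intro order_trans [OF norm_cauchy_schwarz] mult_mono) auto
      qed
      also have "\<dots> \<le> (t - s) * (e1 * (norm w + norm v + 2))"
        using e1(1) st by (simp add: algebra_simps)
      also have "\<dots> \<le> (t - s) * e" using e1(3) st by (intro mult_left_mono) auto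
      finally show "\<phi> t - \<phi> s \<le> e * (t - s)" by (simp add: mult.commute)
    qed
  qed
  also have "\<phi> 0 = 0" using y0 by (simp add: \<phi>_def p_def closest_point_self)
  finally have "y T = p T" by (simp add: \<phi>_def)
  then show ?thesis using pK by metis
qed (use y0 in simp)

lemma exp_minus_diff_le:
  fixes a b :: real
  assumes "0 \<le> b" "b \<le> a"
  shows "exp (- b) - exp (- a) \<le> a - b" "exp (- a) \<le> exp (- b)" "exp (- a) \<le> 1"
proof -
  have "exp (- b) - exp (- a) = exp (- b) * (1 - exp (- (a - b)))"
    by (simp add: right_diff_distrib flip: exp_add)
  also have "1 - exp (- (a - b)) \<le> a - b" using exp_ge_add_one_self [of "- (a - b)"] by linarith
  then have "exp (- b) * (1 - exp (- (a - b))) \<le> 1 * (a - b)"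
    using assms by (intro mult_mono) auto
  finally show "exp (- b) - exp (- a) \<le> a - b" by simp
qed (use assms in auto)

text \<open>Gronwall's lemma for derivatives known only almost everywhere. Hence the weighted square
  must be shown absolutely continuous, by domination: the weight is Lipschitz in time and
  \<open>Z\<close> is bounded.\<close>

lemma gronwall_zero:
  fixes Z :: "real \<Rightarrow> 'a::real_inner"
  assumes T: "T > 0" and ac: "abs_continuous_on 0 T Z" and Z0: "Z 0 = 0" and N: "negligible N" and L: "L \<ge> 0"
    and deriv: "\<And>t. t \<in> {0..T} - N \<Longrightarrow>
      \<exists>Z'. (Z has_vector_derivative Z') (at t within {0..T}) \<and> Z' \<bullet> Z t \<le> L * (norm (Z t))\<^sup>2"
  shows "Z T = 0"
proof -
  define \<phi> where "\<phi> t = exp (- (2 * L * t)) * (Z t \<bullet> Z t)" for t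
  have "bounded (Z ` {0..T})"
    by (intro compact_imp_bounded compact_continuous_image abs_continuous_on_imp_continuous [OF ac]) simp
  then obtain b where b: "b > 0" "\<And>t. t \<in> {0..T} \<Longrightarrow> norm (Z t) \<le> b" unfolding bounded_pos by auto
  have ac\<phi>: "abs_continuous_on 0 T \<phi>"
  proof (rule abs_continuous_on_dominated [OF ac, of "2 * L * b\<^sup>2 + 2 * b"])
    fix s t assume st: "0 \<le> s" "s \<le> t" "t \<le> T"
    let ?E = "\<lambda>t. exp (- (2 * L * t))"
    have E: "?E s - ?E t \<le> 2 * L * t - 2 * L * s" "?E t \<le> ?E s" "?E t \<le> 1"
      using exp_minus_diff_le [of "2 * L * s" "2 * L * t"] L st by (auto intro: mult_left_mono)
    have Zt: "norm (Z t) \<le> b" "norm (Z s) \<le> b" using b st by auto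
    have "Z s \<bullet> Z s \<le> b\<^sup>2" using Zt by (simp add: power_mono flip: power2_norm_eq_inner)
    then have 1: "\<bar>(?E t - ?E s) * (Z s \<bullet> Z s)\<bar> \<le> (2 * L * t - 2 * L * s) * b\<^sup>2"
      unfolding abs_mult using E by (intro mult_mono) auto
    have "Z t \<bullet> Z t - Z s \<bullet> Z s = (Z t - Z s) \<bullet> (Z t + Z s)" by (simp add: algebra_simps inner_commute)
    moreover have "\<bar>(Z t - Z s) \<bullet> (Z t + Z s)\<bar> \<le> norm (Z t - Z s) * (2 * b)"
      using Zt norm_triangle_ineq [of "Z t" "Z s"]
      by (intro order_trans [OF Cauchy_Schwarz_ineq2] mult_left_mono) auto
    ultimately have 2: "\<bar>?E t * (Z t \<bullet> Z t - Z s \<bullet> Z s)\<bar> \<le> 1 * (norm (Z t - Z s) * (2 * b))"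
      unfolding abs_mult using E by (intro mult_mono) auto
    have "\<phi> t - \<phi> s = (?E t - ?E s) * (Z s \<bullet> Z s) + ?E t * (Z t \<bullet> Z t - Z s \<bullet> Z s)"
      by (simp add: \<phi>_def algebra_simps)
    then have "norm (\<phi> t - \<phi> s) \<le> (2 * L * t - 2 * L * s) * b\<^sup>2 + norm (Z t - Z s) * (2 * b)"
      using 1 2 by simp
    also have "\<dots> = (2 * L * b\<^sup>2) * (t - s) + (2 * b) * norm (Z t - Z s)" by (simp add: algebra_simps)
    also have "\<dots> \<le> (2 * L * b\<^sup>2 + 2 * b) * (t - s) + (2 * L * b\<^sup>2 + 2 * b) * norm (Z t - Z s)"
      using b(1) L st by (intro add_mono mult_right_mono) auto
    finally show "norm (\<phi> t - \<phi> s) \<le> (2 * L * b\<^sup>2 + 2 * b) * (t - s + norm (Z t - Z s))"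
      by (simp add: algebra_simps)
  qed (use b L in auto)
  have "\<phi> T \<le> \<phi> 0"
  proof (rule abs_continuous_on_deriv_nonpos [OF less_imp_le [OF T] ac\<phi> N])
    fix t assume t: "t \<in> {0..T} - N"
    obtain Z' where Z': "(Z has_vector_derivative Z') (at t within {0..T})" "Z' \<bullet> Z t \<le> L * (norm (Z t))\<^sup>2"
      using deriv [OF t] by blast
    have dZ: "((\<lambda>t. Z t \<bullet> Z t) has_real_derivative 2 * (Z' \<bullet> Z t)) (at t within {0..T})"
      using bounded_bilinear.has_vector_derivative [OF bounded_bilinear_inner Z'(1) Z'(1)]
      by (simp add: has_real_derivative_iff_has_vector_derivative inner_commute)
    let ?D = "exp (- (2 * L * t)) * (2 * (Z' \<bullet> Z t) - 2 * L * (Z t \<bullet> Z t))"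
    have "(\<phi> has_real_derivative ?D) (at t within {0..T})"
      unfolding \<phi>_def by (rule derivative_eq_intros dZ refl | simp add: algebra_simps)+
    moreover have "?D \<le> 0"
      using Z'(2) by (intro mult_nonneg_nonpos) (auto simp: power2_norm_eq_inner)
    ultimately show "\<exists>D\<le>0. (\<phi> has_vector_derivative D) (at t within {0..T})"
      by (auto simp: has_real_derivative_iff_has_vector_derivative)
  qed
  also have "\<phi> 0 = 0" by (simp add: \<phi>_def Z0)
  finally have "Z T \<bullet> Z T \<le> 0" by (simp add: \<phi>_def mult_le_0_iff)
  then show ?thesis by (metis inner_gt_zero_iff not_le)
qed

section \<open>The zero-sum subspace as a constraint set\<close>

lemma consensus_perp_add: "y \<in> consensus_perp \<Longrightarrow> z \<in> consensus_perp \<Longrightarrow> y + z \<in> consensus_perp"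
  by (simp add: consensus_perp_def sum.distrib)

lemma closed_consensus_perp: "closed (consensus_perp :: (real^'q^'i) set)"
  unfolding consensus_perp_def by (intro closed_Collect_eq continuous_intros)

lemma convex_consensus_perp: "convex (consensus_perp :: (real^'q^'i) set)"
  by (auto simp: convex_def consensus_perp_def sum.distrib simp flip: scaleR_sum_right)

text \<open>Moving from a point of a subspace along the subspace is a tangent direction, so such a
  vector is its own projection.\<close>

lemma proj_vec_consensus_perp:
  assumes "z \<in> consensus_perp" "v \<in> consensus_perp"
  shows "proj_vec consensus_perp z v = v"
  unfolding proj_vec_def
  using tangent_cone_diff [of 1 "z + v" consensus_perp z] assms
  by (intro closest_point_self) (auto intro: consensus_perp_add)

section \<open>The closed loop\<close>

type_synonym ('n, 'i, 'm) state = "(real^'n^'i) \<times> (real^'m^'i) \<times> (real^'m^'i)"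

context gne_game
begin

definition field :: "('n, 'i, 'm) state \<Rightarrow> ('n, 'i, 'm) state" where
  "field = (\<lambda>(bx, z, l).
     (- adjoint (sel own) (bF bx + jacT (sel own bx) l) - c *\<^sub>R SL bx, SL l, sg (sel own bx) - z - SL l))"

abbreviation "CL \<equiv> closed_loop own \<Omega> g J E c"
abbreviation "S1 \<equiv> stacked_set own \<Omega>"
abbreviation "S3 \<equiv> nonneg_orthant :: (real^'m^'i) set"
abbreviation "state_set \<equiv> S1 \<times> (consensus_perp :: (real^'m^'i) set) \<times> S3"

lemma closed_loop_eq_field:
  "CL (bx, z, l) = (proj_vec S1 bx (fst (field (bx, z, l))), SL l, proj_vec S3 l (snd (snd (field (bx, z, l)))))"
  by (simp add: closed_loop_def field_def)

text \<open>Laplacian images have zero sum, so projecting the unconstrained z-equation onto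
  \<open>consensus_perp\<close> changes nothing. The closed loop becomes one projected system on a
  product, and the flow preserves the zero sum by construction.\<close>

lemma closed_loop_eq_proj_vec:
  assumes "w \<in> state_set"
  shows "CL w = proj_vec state_set w (field w)"
proof -
  obtain bx z l where w: "w = (bx, z, l)" "bx \<in> S1" "z \<in> consensus_perp" "l \<in> S3" using assms by auto
  have "proj_vec state_set w (field w) = (proj_vec S1 bx (fst (field w)),
      proj_vec (consensus_perp \<times> S3) (z, l) (snd (field w)))"
    using proj_vec_Times [OF convex_stacked_set w(2) convex_Times [OF convex_consensus_perp convex_nonneg_orthant], of "(z, l)"] w
    by (simp add: field_def)
  also have "proj_vec (consensus_perp \<times> S3) (z, l) (snd (field w)) = (proj_vec consensus_perp z (SL l), proj_vec S3 l (snd (snd (field w))))"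
    using proj_vec_Times [OF convex_consensus_perp w(3) convex_nonneg_orthant w(4)] w(1) by (simp add: field_def)
  finally show ?thesis
    using proj_vec_consensus_perp [OF w(3) stacked_laplacian_in_perp [OF graph(1)], of l]
    by (simp add: w(1) closed_loop_eq_field)
qed

lemma closed_state_set: "closed state_set" and convex_state_set: "convex state_set"
  by (intro closed_Times closed_stacked_set closed_consensus_perp closed_nonneg_orthant)
    (intro convex_Times convex_stacked_set convex_consensus_perp convex_nonneg_orthant)

text \<open>Replaces the adjoint by a finite sum of products, to which the closure rules for locally
  Lipschitz maps apply.\<close>

lemma jacT_expansion: "jacT x l = (\<Sum>b\<in>Basis. (\<Sum>i\<in>UNIV. l $ i \<bullet> blinfun_apply (Dg i x) b) *\<^sub>R b)"
  by (simp add: inner_jacT [symmetric] euclidean_representation)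

text \<open>The second derivatives of the constraints enter here: the Jacobian is C1 and hence
  locally Lipschitz. The gradients are covered by the constant \<theta>.\<close>

lemma locally_lipschitz_field: "locally_lipschitz field"
proof -
  have fst: "locally_lipschitz (\<lambda>w :: ('n, 'i, 'm) state. fst w)"
    and z: "locally_lipschitz (\<lambda>w :: ('n, 'i, 'm) state. fst (snd w))"
    and l: "locally_lipschitz (\<lambda>w :: ('n, 'i, 'm) state. snd (snd w))"
    by (intro locally_lipschitz_bounded_linear bounded_linear_fst bounded_linear_fst_comp
        bounded_linear_snd_comp bounded_linear_snd bounded_linear_ident)+
  note sel = locally_lipschitz_compose [OF fst locally_lipschitz_linear [OF linear_sel, of own]]
  have Dgb: "locally_lipschitz (\<lambda>x. blinfun_apply (Dg i x) b)" for i b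
    using locally_lipschitz_bilinear [OF bounded_bilinear_blinfun_apply locally_lipschitz_C1 [OF Dg_C1] locally_lipschitz_const] .
  have li: "locally_lipschitz (\<lambda>w :: ('n, 'i, 'm) state. snd (snd w) $ i)" for i
    by (rule locally_lipschitz_compose [OF l locally_lipschitz_bounded_linear [OF bounded_linear_vec_nth]])
  have Dgs: "locally_lipschitz (\<lambda>w :: ('n, 'i, 'm) state. blinfun_apply (Dg i (sel own (fst w))) b)" for i b
    by (rule locally_lipschitz_compose [OF sel Dgb])
  have jac: "locally_lipschitz (\<lambda>w :: ('n, 'i, 'm) state. jacT (sel own (fst w)) (snd (snd w)))"
    unfolding jacT_expansion
    by (intro locally_lipschitz_sum locally_lipschitz_bilinear [OF bounded_bilinear_scaleR]
        locally_lipschitz_bilinear [OF bounded_bilinear_inner] li locally_lipschitz_const Dgs)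
  have bF: "locally_lipschitz (\<lambda>w :: ('n, 'i, 'm) state. bF (fst w))"
    by (rule locally_lipschitz_compose [OF fst locally_lipschitz_lipschitz [OF theta(2)]])
  have SLx: "locally_lipschitz (\<lambda>w :: ('n, 'i, 'm) state. c *\<^sub>R SL (fst w))"
    by (rule locally_lipschitz_compose [OF fst]) (intro locally_lipschitz_linear linear_compose_scale_right linear_stacked_laplacian)
  have SLl: "locally_lipschitz (\<lambda>w :: ('n, 'i, 'm) state. SL (snd (snd w)))"
    by (rule locally_lipschitz_compose [OF l locally_lipschitz_linear [OF linear_stacked_laplacian]])
  have "locally_lipschitz (\<lambda>x. \<Sum>i\<in>UNIV. axis i (g i (blk own i x)) :: real^'m^'i)"
  proof (rule locally_lipschitz_sum)
    fix i
    have "linear (axis i :: real^'m \<Rightarrow> real^'m^'i)" by (rule linearI) (auto simp: vec_eq_iff axis_def)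
    from locally_lipschitz_compose [OF locally_lipschitz_C1 [OF g_C1] locally_lipschitz_linear [OF this]]
    show "locally_lipschitz (\<lambda>x. axis i (g i (blk own i x)) :: real^'m^'i)" .
  qed
  also have "(\<lambda>x. \<Sum>i\<in>UNIV. axis i (g i (blk own i x)) :: real^'m^'i) = sg"
    by (auto simp: fun_eq_iff vec_eq_iff axis_def sum_component if_distrib [of "\<lambda>z. z $ _"] cong: if_cong)
  finally have sg: "locally_lipschitz (\<lambda>w :: ('n, 'i, 'm) state. sg (sel own (fst w)))"
    using locally_lipschitz_compose [OF sel] by blast
  have "locally_lipschitz (\<lambda>w. (- adjoint (sel own) (bF (fst w) + jacT (sel own (fst w)) (snd (snd w))) - c *\<^sub>R SL (fst w),
     SL (snd (snd w)), sg (sel own (fst w)) - fst (snd w) - SL (snd (snd w))))"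
    by (intro locally_lipschitz_Pair locally_lipschitz_diff locally_lipschitz_minus SLx SLl sg z
        locally_lipschitz_compose [OF locally_lipschitz_add [OF bF jac] locally_lipschitz_linear [OF adjoint_linear [OF linear_sel]]])
  then show ?thesis by (simp add: field_def case_prod_unfold)
qed

text \<open>The middle factor is the whole space because this compares arbitrary Caratheodory
  solutions, for which only the two projected components are known to stay in their sets.\<close>

lemma closed_loop_monotone:
  assumes w: "w \<in> S1 \<times> UNIV \<times> S3" and w': "w' \<in> S1 \<times> UNIV \<times> S3"
  shows "(CL w - CL w') \<bullet> (w - w') \<le> (field w - field w') \<bullet> (w - w')"
proof -
  obtain bx z l where 1: "w = (bx, z, l)" "bx \<in> S1" "l \<in> S3" using w by auto
  obtain bx' z' l' where 2: "w' = (bx', z', l')" "bx' \<in> S1" "l' \<in> S3" using w' by auto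
  show ?thesis
    using proj_vec_monotone [OF convex_stacked_set 1(2) 2(2), of "fst (field w)" "fst (field w')"]
      proj_vec_monotone [OF convex_nonneg_orthant 1(3) 2(3), of "snd (snd (field w))" "snd (snd (field w'))"]
    by (simp add: 1(1) 2(1) closed_loop_eq_field inner_prod_def) (simp add: field_def)
qed

subsection \<open>Equilibria of the closed loop\<close>

lemma KKT_imp_equilibrium:
  assumes K: "KKT own \<Omega> g J x l"
  obtains z where "(replicate_vec x, z, replicate_vec l) \<in> state_set" "CL (replicate_vec x, z, replicate_vec l) = 0"
proof -
  have k: "x \<in> joint" "\<And>y. y \<in> joint \<Longrightarrow> F x \<bullet> (y - x) + l \<bullet> (\<Sum>i\<in>UNIV. blinfun_apply (Dg i x) (y - x)) \<ge> 0"
    "0 \<le> l" "cg x \<le> 0" "cg x \<bullet> l = 0"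
    using K by (auto simp: KKT_iff)
  define N where "N = real CARD('i)"
  have N: "N > 0" by (simp add: N_def)
  \<comment> \<open>Subtracting the average turns the local values \<open>g i\<close> into a
    zero-sum vector and leaves every agent with the same share \<open>cg x / N\<close> of the
    coupling constraint, which has the sign and complementarity of \<open>cg x\<close>.\<close>
  define z where "z = sg x - replicate_vec ((1 / N) *\<^sub>R cg x)"
  have z: "z \<in> consensus_perp"
    using N by (simp add: z_def consensus_perp_def sum_subtractf coupling_def sum_constant_scaleR N_def del: sum_constant)
  have S1: "replicate_vec x \<in> S1" using k(1) by (simp add: stacked_set_def)
  have S3: "replicate_vec l \<in> S3" using k(3) by (simp add: nonneg_orthant_def less_eq_vec_def)
  have zero: "proj_vec S a f = 0" if "convex S" "a \<in> S" "f \<in> normal_cone S a" for S and a f :: "'a::euclidean_space"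
    using that zero_in_tangent_cone by (intro proj_vec_unique) auto
  have n1: "fst (field (replicate_vec x, z, replicate_vec l)) \<in> normal_cone S1 (replicate_vec x)"
    unfolding normal_cone_def
  proof (intro CollectI conjI ballI S1)
    fix bx assume "bx \<in> S1"
    then have "sel own bx \<in> joint" by (simp add: stacked_set_def)
    from k(2) [OF this] have "0 \<le> F x \<bullet> (sel own bx - x) + jacT x (replicate_vec l) \<bullet> (sel own bx - x)"
      by (simp add: inner_jacT inner_sum_right)
    then show "fst (field (replicate_vec x, z, replicate_vec l)) \<bullet> (bx - replicate_vec x) \<le> 0"
      by (simp add: field_def inner_adjoint_sel linear_diff [OF linear_sel] inner_add_left)
  qed
  have "snd (snd (field (replicate_vec x, z, replicate_vec l))) = replicate_vec ((1 / N) *\<^sub>R cg x)"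
    by (simp add: field_def z_def)
  moreover have "(1 / N) *\<^sub>R cg x \<in> normal_cone nonneg_orthant l"
    using k N by (auto simp: normal_cone_nonneg_orthant less_eq_vec_def divide_le_0_iff)
  ultimately have n3: "snd (snd (field (replicate_vec x, z, replicate_vec l))) \<in> normal_cone S3 (replicate_vec l)"
    by (simp add: normal_cone_nonneg_orthant_stacked)
  show thesis
  proof
    show "(replicate_vec x, z, replicate_vec l) \<in> state_set" using S1 z S3 by simp
    show "CL (replicate_vec x, z, replicate_vec l) = 0"
      unfolding closed_loop_eq_field
      using zero [OF convex_stacked_set S1 n1] zero [OF convex_nonneg_orthant S3 n3] by (simp add: zero_prod_def)
  qed
qed

lemma equilibrium_normal:
  assumes "CL (bx, z, l) = 0" "bx \<in> S1" "l \<in> S3"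
  shows "fst (field (bx, z, l)) \<in> normal_cone S1 bx" "snd (snd (field (bx, z, l))) \<in> normal_cone S3 l"
  using proj_vec_normal [OF convex_stacked_set assms(2), of "fst (field (bx, z, l))"]
    proj_vec_normal [OF convex_nonneg_orthant assms(3), of "snd (snd (field (bx, z, l)))"] assms(1)
  by (simp_all add: closed_loop_eq_field zero_prod_def)

text \<open>Testing stationarity with replicated vectors, on which the Laplacian vanishes, leaves
  the stationarity condition of the game. Summing the agents' complementarity conditions removes
  \<open>z\<close>, whose blocks add up to zero.\<close>

lemma equilibrium_imp_KKT:
  assumes e: "(replicate_vec x, z, replicate_vec l) \<in> state_set" "CL (replicate_vec x, z, replicate_vec l) = 0"
  shows "KKT own \<Omega> g J x l"
proof -
  have S: "x \<in> joint" "0 \<le> l" and z: "(\<Sum>i\<in>UNIV. z $ i) = 0"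
    using e(1) by (auto simp: stacked_set_def nonneg_orthant_def less_eq_vec_def consensus_perp_def)
  have n: "fst (field (replicate_vec x, z, replicate_vec l)) \<in> normal_cone S1 (replicate_vec x)"
    "snd (snd (field (replicate_vec x, z, replicate_vec l))) \<in> normal_cone S3 (replicate_vec l)"
    using equilibrium_normal [OF e(2)] e(1) by auto
  have 1: "F x \<bullet> (y - x) + l \<bullet> (\<Sum>i\<in>UNIV. blinfun_apply (Dg i x) (y - x)) \<ge> 0" if "y \<in> joint" for y
  proof -
    have "replicate_vec y \<in> S1" using that by (simp add: stacked_set_def)
    then have "fst (field (replicate_vec x, z, replicate_vec l)) \<bullet> (replicate_vec y - replicate_vec x) \<le> 0"
      using n(1) by (simp add: normal_cone_def)
    then have "0 \<le> F x \<bullet> (y - x) + jacT x (replicate_vec l) \<bullet> (y - x)"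
      by (simp add: field_def inner_adjoint_sel linear_diff [OF linear_sel] inner_add_left inner_diff_left
          stacked_laplacian_symmetric [OF graph(1)] linear_diff [OF linear_stacked_laplacian])
    then show ?thesis by (simp add: inner_jacT inner_sum_right)
  qed
  have comp: "sg x $ i - z $ i \<le> 0 \<and> (sg x $ i - z $ i) \<bullet> l = 0" for i
    using n(2) by (simp add: normal_cone_nonneg_orthant_stacked normal_cone_nonneg_orthant field_def)
  have sum: "cg x = (\<Sum>i\<in>UNIV. sg x $ i - z $ i)" using z by (simp add: sum_subtractf coupling_def)
  have "cg x \<le> 0" unfolding sum using comp by (auto simp: less_eq_vec_def sum_component intro!: sum_nonpos)
  moreover have "cg x \<bullet> l = 0" unfolding sum inner_sum_left using comp by simp
  ultimately show ?thesis using S 1 by (simp add: KKT_iff)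
qed

subsection \<open>The Lyapunov function\<close>

end

text \<open>The metric is a parameter because \<open>P\<close> and \<kappa> are obtained
  existentially from the graph.\<close>

locale gne_lyapunov = gne_game own \<Omega> g J E \<mu> \<theta>\<^sub>0 \<theta> c
  for own :: "'n::finite \<Rightarrow> 'i::finite" and \<Omega>
    and g :: "'i \<Rightarrow> real^'n \<Rightarrow> real^'m::finite" and J E \<mu> \<theta>\<^sub>0 \<theta> c +
  fixes P :: "real^'m^'i \<Rightarrow> real^'m^'i" and \<kappa> :: real
  assumes linP: "linear P" and symP: "\<And>u w. P u \<bullet> w = u \<bullet> P w"
    and PL: "\<And>v. P (SL v) = v - replicate_vec (mean v)"
    and \<kappa>: "\<kappa> > 0" and coercive: "\<And>u. P u \<bullet> u \<ge> \<kappa> * (norm u)\<^sup>2"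
begin

definition metric :: "('n, 'i, 'm) state \<Rightarrow> ('n, 'i, 'm) state" where
  "metric w = (fst w, P (fst (snd w)), snd (snd w))"

definition lyap where "lyap e w = (w - e) \<bullet> metric (w - e)"

lemma linear_metric: "linear metric"
  by (rule linearI) (simp_all add: metric_def linear_add [OF linP] linear_scale [OF linP])

lemma metric_symmetric: "metric u \<bullet> w = u \<bullet> metric w"
  by (simp add: metric_def inner_prod_def symP)

lemma lyap_lower: "lyap e w \<ge> min 1 \<kappa> * (norm (w - e))\<^sup>2"
proof -
  obtain u v t where d: "w - e = (u, v, t)" by (metis prod_cases3)
  have "min 1 \<kappa> * (norm u)\<^sup>2 \<le> 1 * (norm u)\<^sup>2" "min 1 \<kappa> * (norm v)\<^sup>2 \<le> \<kappa> * (norm v)\<^sup>2" "min 1 \<kappa> * (norm t)\<^sup>2 \<le> 1 * (norm t)\<^sup>2"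
    by (intro mult_right_mono; simp)+
  then have "min 1 \<kappa> * ((norm u)\<^sup>2 + (norm v)\<^sup>2 + (norm t)\<^sup>2) \<le> (norm u)\<^sup>2 + P v \<bullet> v + (norm t)\<^sup>2"
    using coercive [of v] by (simp add: distrib_left)
  moreover have "(norm (w - e))\<^sup>2 = (norm u)\<^sup>2 + (norm v)\<^sup>2 + (norm t)\<^sup>2" by (simp add: d norm_Pair)
  moreover have "lyap e w = (norm u)\<^sup>2 + P v \<bullet> v + (norm t)\<^sup>2"
    by (simp add: lyap_def d metric_def power2_norm_eq_inner inner_commute)
  ultimately show ?thesis by simp
qed

lemma lyap_self [simp]: "lyap e e = 0"
  by (simp add: lyap_def)

lemma continuous_on_lyap: "continuous_on S (lyap e)"
proof -
  have "continuous_on UNIV metric" using linear_metric by (intro linear_continuous_on) (simp add: linear_conv_bounded_linear)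
  then have "continuous_on S (\<lambda>w. metric (w - e))"
    by (rule continuous_on_compose2) (auto intro: continuous_intros)
  then show ?thesis unfolding lyap_def [abs_def] by (intro continuous_intros)
qed

lemma lyap_has_vector_derivative:
  assumes X: "(X has_vector_derivative v) (at t within S)"
  shows "((\<lambda>t. lyap e (X t)) has_vector_derivative 2 * (v \<bullet> metric (X t - e))) (at t within S)"
proof -
  have d: "((\<lambda>t. X t - e) has_vector_derivative v) (at t within S)"
    using has_vector_derivative_diff_const X by (auto intro!: derivative_eq_intros)
  have "bounded_linear metric" using linear_metric by (simp add: linear_conv_bounded_linear)
  from bounded_bilinear.has_vector_derivative [OF bounded_bilinear_inner d bounded_linear.has_vector_derivative [OF this d]]
  show ?thesis
    by (simp add: lyap_def metric_symmetric inner_commute)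
qed

text \<open>Replacing the projected velocities by \<open>field\<close> only increases the pairing,
  as normal cones are monotone. The z-terms then cancel and the constraint terms have a sign by
  \<open>lagrangian_monotone\<close>; what is left are the dissipation of the estimates and that of
  the multipliers.\<close>

lemma lyap_dissipation:
  assumes e: "(replicate_vec x, ze, replicate_vec le) \<in> state_set" "CL (replicate_vec x, ze, replicate_vec le) = 0"
    and w: "(bx, z, l) \<in> state_set"
  shows "CL (bx, z, l) \<bullet> metric ((bx, z, l) - (replicate_vec x, ze, replicate_vec le))
    \<le> - ((bF bx - F x) \<bullet> (sel own bx - x) + c * (SL bx \<bullet> bx)) - SL l \<bullet> l"
proof -
  let ?rx = "replicate_vec x :: real^'n^'i" and ?rl = "replicate_vec le :: real^'m^'i"
  let ?e = "(?rx, ze, ?rl)" and ?w = "(bx, z, l)"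
  have w': "bx \<in> S1" "z \<in> consensus_perp" "l \<in> S3" and e': "?rx \<in> S1" "ze \<in> consensus_perp" "?rl \<in> S3"
    using e(1) w by auto
  have e0: "proj_vec S1 ?rx (fst (field ?e)) = 0" "proj_vec S3 ?rl (snd (snd (field ?e))) = 0"
    using e(2) by (simp_all add: closed_loop_eq_field zero_prod_def)
  have v1: "proj_vec S1 bx (fst (field ?w)) \<bullet> (bx - ?rx) \<le> (fst (field ?w) - fst (field ?e)) \<bullet> (bx - ?rx)"
    using proj_vec_monotone [OF convex_stacked_set w'(1) e'(1), of "fst (field ?w)" "fst (field ?e)"] by (simp add: e0)
  have v3: "proj_vec S3 l (snd (snd (field ?w))) \<bullet> (l - ?rl) \<le> (snd (snd (field ?w)) - snd (snd (field ?e))) \<bullet> (l - ?rl)"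
    using proj_vec_monotone [OF convex_nonneg_orthant w'(3) e'(3), of "snd (snd (field ?w))" "snd (snd (field ?e))"]
    by (simp add: e0)
  \<comment> \<open>Removes the consensus vectors \<open>mean l\<close> and \<open>le\<close>, by
    which the image under \<open>P\<close> of the Laplacian differs from
    \<open>l - ?rl\<close>.\<close>
  have perp: "replicate_vec y \<bullet> (z - ze) = 0" for y
    using w'(2) e'(2) by (simp add: inner_replicate_vec consensus_perp_def sum_subtractf)
  have v2: "SL l \<bullet> P (z - ze) = (z - ze) \<bullet> (l - ?rl)"
  proof -
    have "SL l \<bullet> P (z - ze) = (l - replicate_vec (mean l)) \<bullet> (z - ze)"
      by (simp add: symP [symmetric] PL)
    then show ?thesis using perp [of "mean l"] perp [of le] by (simp add: inner_diff_left inner_diff_right inner_commute)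
  qed
  have SLrl: "SL l \<bullet> ?rl = 0" by (simp add: stacked_laplacian_symmetric [OF graph(1)])
  have SLrx: "SL bx \<bullet> ?rx = 0" by (simp add: stacked_laplacian_symmetric [OF graph(1)])
  have f1: "(fst (field ?w) - fst (field ?e)) \<bullet> (bx - ?rx)
      = - ((bF bx - F x) \<bullet> (sel own bx - x)) - (jacT (sel own bx) l - jacT x ?rl) \<bullet> (sel own bx - x) - c * (SL bx \<bullet> bx)"
    by (simp add: field_def inner_diff_left inner_adjoint_sel linear_diff [OF linear_sel] inner_add_left SLrx inner_diff_right [of "SL bx"])
  have f3: "(snd (snd (field ?w)) - snd (snd (field ?e))) \<bullet> (l - ?rl)
      = (sg (sel own bx) - sg x) \<bullet> (l - ?rl) - (z - ze) \<bullet> (l - ?rl) - SL l \<bullet> l"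
    using SLrl by (simp add: field_def inner_diff_left inner_diff_right)
  have "0 \<le> l" "0 \<le> ?rl" using w'(3) e'(3) by (auto simp: nonneg_orthant_def)
  from lagrangian_monotone [OF this, of "sel own bx" x]
  have lm: "(sg (sel own bx) - sg x) \<bullet> (l - ?rl) \<le> (jacT (sel own bx) l - jacT x ?rl) \<bullet> (sel own bx - x)" by simp
  have "CL ?w \<bullet> metric (?w - ?e) = proj_vec S1 bx (fst (field ?w)) \<bullet> (bx - ?rx) + SL l \<bullet> P (z - ze)
      + proj_vec S3 l (snd (snd (field ?w))) \<bullet> (l - ?rl)"
    by (simp add: closed_loop_eq_field metric_def)
  with v1 v2 v3 f1 f3 lm show ?thesis by linarith
qed

text \<open>The case of equality yields consensus on the actions and among the multipliers, but
  neither the value of \<open>z\<close> nor the common multiplier.\<close>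

lemma lyap_decrease:
  assumes e: "(replicate_vec x, ze, replicate_vec le) \<in> state_set" "CL (replicate_vec x, ze, replicate_vec le) = 0"
    and w: "(bx, z, l) \<in> state_set"
  shows "CL (bx, z, l) \<bullet> metric ((bx, z, l) - (replicate_vec x, ze, replicate_vec le)) \<le> 0"
    and "CL (bx, z, l) \<bullet> metric ((bx, z, l) - (replicate_vec x, ze, replicate_vec le)) \<ge> 0 \<Longrightarrow>
      bx = replicate_vec x \<and> l = replicate_vec (mean l)"
proof -
  note d = lyap_dissipation [OF assms]
  note nn = augmented_monotone(1) [of bx x] stacked_laplacian_nonneg [OF graph(1), of l]
  show "CL (bx, z, l) \<bullet> metric ((bx, z, l) - (replicate_vec x, ze, replicate_vec le)) \<le> 0"
    using d nn by linarith
  assume "CL (bx, z, l) \<bullet> metric ((bx, z, l) - (replicate_vec x, ze, replicate_vec le)) \<ge> 0"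
  then have "(bF bx - F x) \<bullet> (sel own bx - x) + c * (SL bx \<bullet> bx) \<le> 0" "SL l \<bullet> l = 0"
    using d nn by linarith+
  then show "bx = replicate_vec x \<and> l = replicate_vec (mean l)"
    using augmented_monotone(2) stacked_laplacian_kernel [OF graph] by blast
qed

end

section \<open>Convergence\<close>

context gne_lyapunov
begin

text \<open>Whatever the vector being projected, the velocity of each constrained component lies in
  the tangent cone of its own set, even at points outside that set; so
  \<open>proj_vec_invariant\<close> applies to an arbitrary solution.\<close>

lemma solution_invariant:
  assumes \<psi>: "caratheodory_solution CL w0 \<psi>" and w0: "w0 \<in> state_set" and t: "t \<ge> 0"
  shows "\<psi> t \<in> S1 \<times> UNIV \<times> S3"
proof -
  have \<psi>0: "\<psi> 0 = w0" and ac: "\<And>T. T > 0 \<Longrightarrow> abs_continuous_on 0 T \<psi>"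
    and ae: "AE t in lebesgue. 0 \<le> t \<longrightarrow> (\<psi> has_vector_derivative CL (\<psi> t)) (at t within {0..})"
    using \<psi> by (auto simp: caratheodory_solution_def)
  obtain N where N: "negligible N" "\<And>t. t \<notin> N \<Longrightarrow> 0 \<le> t \<longrightarrow> (\<psi> has_vector_derivative CL (\<psi> t)) (at t within {0..})"
    using AE_lebesgue_negligible [OF ae] by blast
  have cl: "CL w = (proj_vec S1 (fst w) (fst (field w)), SL (snd (snd w)), proj_vec S3 (snd (snd w)) (snd (snd (field w))))" for w
    by (cases w) (simp add: closed_loop_eq_field)
  have component: "\<pi> (\<psi> t) \<in> S"
    if S: "closed S" "convex S" "\<pi> w0 \<in> S" and \<pi>: "bounded_linear \<pi>"
      and proj: "\<And>w. \<exists>u. \<pi> (CL w) = proj_vec S (\<pi> w) u" for S :: "'z::euclidean_space set" and \<pi>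
  proof (rule proj_vec_invariant [OF S(1,2) _ _ N(1) _ t])
    show "\<pi> (\<psi> 0) \<in> S" using S(3) by (simp add: \<psi>0)
    obtain C where C: "C \<ge> 0" "\<And>w. norm (\<pi> w) \<le> norm w * C"
      using bounded_linear.nonneg_bounded [OF \<pi>] by blast
    show "abs_continuous_on 0 T (\<lambda>t. \<pi> (\<psi> t))" if "T > 0" for T
    proof (rule abs_continuous_on_dominated [OF ac [OF that] C(1)])
      fix s t :: real assume st: "s \<le> t"
      have "norm (\<pi> (\<psi> t) - \<pi> (\<psi> s)) \<le> C * norm (\<psi> t - \<psi> s)"
        using C(2) [of "\<psi> t - \<psi> s"] by (simp add: linear_diff [OF bounded_linear.linear [OF \<pi>]] mult.commute)
      also have "\<dots> \<le> C * (t - s + norm (\<psi> t - \<psi> s))" using C(1) st by (intro mult_left_mono) auto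
      finally show "norm (\<pi> (\<psi> t) - \<pi> (\<psi> s)) \<le> C * (t - s + norm (\<psi> t - \<psi> s))" .
    qed
    fix t :: real assume "t \<ge> 0" "t \<notin> N"
    then have "(\<psi> has_vector_derivative CL (\<psi> t)) (at t within {0..})" using N(2) by blast
    from bounded_linear.has_vector_derivative [OF \<pi> this] proj [of "\<psi> t"]
    show "\<exists>u. ((\<lambda>t. \<pi> (\<psi> t)) has_vector_derivative proj_vec S (\<pi> (\<psi> t)) u) (at t within {0..})"
      by metis
  qed
  have "fst (\<psi> t) \<in> S1"
  proof (rule component [OF closed_stacked_set convex_stacked_set _ bounded_linear_fst])
    show "fst w0 \<in> S1" using w0 by auto
    show "\<exists>u. fst (CL w) = proj_vec S1 (fst w) u" for w unfolding cl fst_conv by (rule exI) (rule refl)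
  qed
  moreover have "snd (snd (\<psi> t)) \<in> S3"
  proof (rule component [OF closed_nonneg_orthant convex_nonneg_orthant _ bounded_linear_snd_comp [OF bounded_linear_snd]])
    show "snd (snd w0) \<in> S3" using w0 by auto
    show "\<exists>u. snd (snd (CL w)) = proj_vec S3 (snd (snd w)) u" for w unfolding cl snd_conv by (rule exI) (rule refl)
  qed
  ultimately show ?thesis by (simp add: mem_Times_iff)
qed

text \<open>Both trajectories have bounded range up to time \<open>t\<close>, so a single Lipschitz
  constant of \<open>field\<close> serves for the pair; with invariance the closed loop is one-sided
  Lipschitz between them.\<close>

lemma solution_unique:
  assumes \<psi>: "caratheodory_solution CL w0 \<psi>" and \<omega>: "caratheodory_solution CL w0 \<omega>"
    and w0: "w0 \<in> state_set" and t: "t \<ge> 0"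
  shows "\<psi> t = \<omega> t"
proof (cases "t = 0")
  case False
  then have t: "t > 0" using t by simp
  have ac: "abs_continuous_on 0 t \<psi>" "abs_continuous_on 0 t \<omega>"
    using \<psi> \<omega> t by (auto simp: caratheodory_solution_def)
  have ae: "AE t in lebesgue. 0 \<le> t \<longrightarrow> (\<psi> has_vector_derivative CL (\<psi> t)) (at t within {0..})"
    "AE t in lebesgue. 0 \<le> t \<longrightarrow> (\<omega> has_vector_derivative CL (\<omega> t)) (at t within {0..})"
    using \<psi> \<omega> by (auto simp: caratheodory_solution_def)
  have "bounded (\<psi> ` {0..t} \<union> \<omega> ` {0..t})"
    unfolding bounded_Un
    by (intro conjI compact_imp_bounded compact_continuous_image abs_continuous_on_imp_continuous ac) auto
  then obtain L where L: "L-lipschitz_on (\<psi> ` {0..t} \<union> \<omega> ` {0..t}) field"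
    using locally_lipschitz_field by (metis locally_lipschitzE)
  obtain N1 where N1: "negligible N1" "\<And>s. s \<notin> N1 \<Longrightarrow> 0 \<le> s \<longrightarrow> (\<psi> has_vector_derivative CL (\<psi> s)) (at s within {0..})"
    using AE_lebesgue_negligible [OF ae(1)] by blast
  obtain N2 where N2: "negligible N2" "\<And>s. s \<notin> N2 \<Longrightarrow> 0 \<le> s \<longrightarrow> (\<omega> has_vector_derivative CL (\<omega> s)) (at s within {0..})"
    using AE_lebesgue_negligible [OF ae(2)] by blast
  have "\<psi> t - \<omega> t = 0"
  proof (rule gronwall_zero [OF t abs_continuous_on_diff [OF ac] _ negligible_Un [OF N1(1) N2(1)] lipschitz_on_nonneg [OF L]])
    show "\<psi> 0 - \<omega> 0 = 0" using \<psi> \<omega> by (simp add: caratheodory_solution_def)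
    fix s assume s: "s \<in> {0..t} - (N1 \<union> N2)"
    have "(\<psi> has_vector_derivative CL (\<psi> s)) (at s within {0..})" "(\<omega> has_vector_derivative CL (\<omega> s)) (at s within {0..})"
      using N1(2) N2(2) s by auto
    then have "((\<lambda>s. \<psi> s - \<omega> s) has_vector_derivative CL (\<psi> s) - CL (\<omega> s)) (at s within {0..t})"
      by (intro has_vector_derivative_diff) (auto intro: has_vector_derivative_within_subset)
    moreover have "(CL (\<psi> s) - CL (\<omega> s)) \<bullet> (\<psi> s - \<omega> s) \<le> L * (norm (\<psi> s - \<omega> s))\<^sup>2"
    proof -
      have "(CL (\<psi> s) - CL (\<omega> s)) \<bullet> (\<psi> s - \<omega> s) \<le> (field (\<psi> s) - field (\<omega> s)) \<bullet> (\<psi> s - \<omega> s)"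
        using s by (intro closed_loop_monotone solution_invariant [OF \<psi> w0] solution_invariant [OF \<omega> w0]) auto
      also have "\<dots> \<le> (L * norm (\<psi> s - \<omega> s)) * norm (\<psi> s - \<omega> s)"
        using lipschitz_onD [OF L, of "\<psi> s" "\<omega> s"] s
        by (intro order_trans [OF norm_cauchy_schwarz] mult_right_mono) (auto simp: dist_norm)
      finally show ?thesis by (simp add: power2_eq_square mult.assoc)
    qed
    ultimately show "\<exists>Z'. ((\<lambda>s. \<psi> s - \<omega> s) has_vector_derivative Z') (at s within {0..t}) \<and>
        Z' \<bullet> (\<psi> s - \<omega> s) \<le> L * (norm (\<psi> s - \<omega> s))\<^sup>2" by blast
  qed
  then show ?thesis by simp
qed (use \<psi> \<omega> in \<open>simp add: caratheodory_solution_def\<close>)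

lemma has_vector_derivative_const_right:
  fixes X :: "real \<Rightarrow> 'a::real_normed_vector"
  assumes X: "(X has_vector_derivative v) (at_right 0)" and const: "\<And>t. t \<ge> 0 \<Longrightarrow> X t = X 0"
  shows "v = 0"
proof (rule tendsto_unique)
  show "((\<lambda>y. (1 / (y - 0)) *\<^sub>R (X y - X 0)) \<longlongrightarrow> v) (at_right 0)"
    using X unfolding has_vector_derivative_iff_quotient .
  have "eventually (\<lambda>y. 0 = (1 / (y - 0)) *\<^sub>R (X y - X 0)) (at_right (0::real))"
    using eventually_at_right_less
  proof eventually_elim
    case (elim y)
    then have "X y = X 0" by (intro const) simp
    then show ?case by simp
  qed
  then show "((\<lambda>y. (1 / (y - 0)) *\<^sub>R (X y - X 0)) \<longlongrightarrow> 0) (at_right 0)"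
    by (rule tendsto_eventually [OF eventually_mono]) auto
qed simp

text \<open>LaSalle's argument.  On the limit set the Lyapunov function is constant, so every point of it has
  the form \<open>(replicate_vec x, z, replicate_vec y)\<close>; there \<open>(g x - z) \<bullet> l\<close> increases at rate
  \<open>|l'|^2\<close>, so a maximizer over the (compact, invariant) limit set is an equilibrium.  The Lyapunov
  function centered at that equilibrium then forces convergence.\<close>

lemma solution_exists_converges:
  assumes w0: "w0 \<in> state_set"
  shows "\<exists>\<omega> x z l. caratheodory_solution CL w0 \<omega> \<and> (\<forall>t\<ge>0. \<omega> t \<in> state_set) \<and>
    (\<omega> \<longlongrightarrow> (replicate_vec x, z, replicate_vec l)) at_top \<and>
    (replicate_vec x, z, replicate_vec l) \<in> state_set \<and> CL (replicate_vec x, z, replicate_vec l) = 0"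
proof -
  obtain x le where KKT: "KKT own \<Omega> g J x le" using KKT_exists by blast
  obtain ze where e: "(replicate_vec x, ze, replicate_vec le) \<in> state_set" "CL (replicate_vec x, ze, replicate_vec le) = 0"
    using KKT_imp_equilibrium [OF KKT] by blast
  define e0 where "e0 = (replicate_vec x :: real^'n^'i, ze, replicate_vec le :: real^'m^'i)"
  define k where "k = min 1 \<kappa>"
  have k: "k > 0" using \<kappa> by (simp add: k_def)
  have lower: "k * (norm (w - v))\<^sup>2 \<le> lyap v w" for v w using lyap_lower [of w v] by (simp add: k_def)
  \<comment> \<open>The ball is to contain the sublevel set one unit above the initial value; this
    margin is the strip on which \<open>dini_nonpos_deriv\<close> asks for a derivative.\<close>
  define R where "R = sqrt ((lyap e0 w0 + 1) / k)"
  define B where "B = cball e0 R"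
  have inB: "w \<in> B" if "lyap e0 w \<le> lyap e0 w0 + 1" for w
  proof -
    have "k * (norm (w - e0))\<^sup>2 \<le> lyap e0 w0 + 1" using lower [of w e0] that by linarith
    then have "(norm (w - e0))\<^sup>2 \<le> (lyap e0 w0 + 1) / k" using k by (simp add: field_simps)
    then have "norm (w - e0) \<le> R" unfolding R_def by (rule real_le_rsqrt)
    then show ?thesis by (simp add: B_def dist_norm norm_minus_commute)
  qed
  have B: "closed B" "convex B" "bounded B" by (simp_all add: B_def)
  have Bne: "B \<noteq> {}" using inB [of w0] by auto
  obtain L where L: "L-lipschitz_on B field" using locally_lipschitzE [OF locally_lipschitz_field B(3)] by blast
  obtain M where M: "M > 0" "\<And>w. w \<in> B \<Longrightarrow> norm (field w) \<le> M"
    using lipschitz_on_bounded_image [OF L B(3)] unfolding bounded_pos by auto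
  \<comment> \<open>Composing with the nonexpansive projection onto the ball makes
    \<open>field\<close> globally Lipschitz and bounded and leaves it unchanged on
    \<open>B\<close>.\<close>
  define f where "f w = field (closest_point B w)" for w
  have fL: "L-lipschitz_on state_set f"
  proof (rule lipschitz_onI)
    fix v w
    have "dist (f v) (f w) \<le> L * dist (closest_point B v) (closest_point B w)"
      unfolding f_def by (intro lipschitz_onD [OF L] closest_point_in_set B Bne)
    also have "\<dots> \<le> L * dist v w"
      using closest_point_lipschitz [OF B(2,1) Bne] lipschitz_on_nonneg [OF L] by (intro mult_left_mono)
    finally show "dist (f v) (f w) \<le> L * dist v w" .
  qed (rule lipschitz_on_nonneg [OF L])
  interpret ps: projected_system state_set f L M
    by unfold_locales
      (use closed_state_set convex_state_set fL M closest_point_in_set [OF B(1) Bne] in \<open>auto simp: f_def\<close>)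
  have speed: "ps.speed w = CL w" if "w \<in> state_set" "w \<in> B" for w
    using that by (simp add: closed_loop_eq_proj_vec f_def closest_point_self)
  have decrease: "CL w \<bullet> metric (w - (replicate_vec x', z', replicate_vec l')) \<le> 0"
    if "(replicate_vec x', z', replicate_vec l') \<in> state_set" "CL (replicate_vec x', z', replicate_vec l') = 0" "w \<in> state_set"
    for w x' z' l'
    using lyap_decrease(1) [OF that(1,2)] that(3) by (cases w) auto
  have dlyap: "((\<lambda>t. lyap v (ps.flow p t)) has_vector_derivative 2 * (CL (ps.flow p t) \<bullet> metric (ps.flow p t - v))) (at_right t)"
    if "p \<in> state_set" "t \<ge> 0" "ps.flow p t \<in> B" for p t v
    using lyap_has_vector_derivative [OF ps.flow_right_derivative [OF that(1,2)]] speed [OF ps.flow_in [OF that(1,2)] that(3)]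
    by simp
  have cont_lyap: "continuous_on {a..b} (\<lambda>t. lyap v (ps.flow p t))" if "p \<in> state_set" "0 \<le> a" for p v a b
    by (rule continuous_on_compose2 [OF continuous_on_lyap [of UNIV] continuous_on_subset [OF ps.flow_continuous [OF that(1), of b]]])
      (use that in auto)
  \<comment> \<open>The truncated flow follows the closed loop only inside \<open>B\<close>. Its
    decrease is needed only while the Lyapunov value is less than one above its start, so being in
    \<open>B\<close> there suffices; for the center \<open>e0\<close> this is automatic, and
    confinement to \<open>B\<close> follows.\<close>
  have local_decrease: "lyap v (ps.flow p t) \<le> lyap v (ps.flow p s)"
    if p: "p \<in> state_set" and v: "v = (replicate_vec x', z', replicate_vec l')" "v \<in> state_set" "CL v = 0"
      and B: "\<And>r. s \<le> r \<Longrightarrow> lyap v (ps.flow p r) < lyap v (ps.flow p s) + 1 \<Longrightarrow> ps.flow p r \<in> B"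
      and st: "0 \<le> s" "s \<le> t" for p v x' z' l' s t
  proof -
    have "lyap v (ps.flow p t) - lyap v (ps.flow p s) \<le> 0"
    proof (rule dini_nonpos_deriv [of s t "\<lambda>t. lyap v (ps.flow p t) - lyap v (ps.flow p s)" 1])
      show "continuous_on {s..t} (\<lambda>t. lyap v (ps.flow p t) - lyap v (ps.flow p s))"
        by (intro continuous_intros cont_lyap p st)
      fix r assume r: "s \<le> r" "lyap v (ps.flow p r) - lyap v (ps.flow p s) < 1"
      then have r0: "0 \<le> r" and rB: "ps.flow p r \<in> B" using st B [of r] by simp_all
      show "\<exists>D\<le>0. ((\<lambda>t. lyap v (ps.flow p t) - lyap v (ps.flow p s)) has_vector_derivative D) (at_right r)"
        using dlyap [OF p r0 rB, of v] decrease [of x' z' l' "ps.flow p r"] v ps.flow_in [OF p r0]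
        by (intro exI [of _ "2 * (CL (ps.flow p r) \<bullet> metric (ps.flow p r - v))"] conjI)
          (auto intro!: derivative_eq_intros)
    qed (use st in auto)
    then show ?thesis by simp
  qed
  have flowB: "ps.flow p t \<in> B" if p: "p \<in> state_set" "lyap e0 p \<le> lyap e0 w0" and t: "t \<ge> 0" for p t
  proof -
    have "lyap e0 (ps.flow p t) \<le> lyap e0 (ps.flow p 0)"
      by (rule local_decrease [OF p(1) e0_def _ _ _ order_refl t])
        (use e p in \<open>auto simp: e0_def [symmetric] ps.flow_0 intro!: inB\<close>)
    then show ?thesis using p by (intro inB) (simp add: ps.flow_0)
  qed
  \<comment> \<open>Once the flow is known to stay in \<open>B\<close>, the Lyapunov function of any
    equilibrium may be used, including one found later.\<close>
  have antimono: "lyap v (ps.flow p t) \<le> lyap v (ps.flow p s)"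
    if p: "p \<in> state_set" "lyap e0 p \<le> lyap e0 w0" and v: "v = (replicate_vec x', z', replicate_vec l')" "v \<in> state_set" "CL v = 0"
      and st: "0 \<le> s" "s \<le> t" for p v x' z' l' s t
    by (rule local_decrease [OF p(1) v flowB [OF p] st]) (use st in simp)

  define \<omega> where "\<omega> = ps.flow w0"
  have \<omega>_in: "\<omega> t \<in> state_set" if "t \<ge> 0" for t unfolding \<omega>_def by (rule ps.flow_in [OF w0 that])
  have \<omega>B: "\<omega> t \<in> B" if "t \<ge> 0" for t unfolding \<omega>_def by (rule flowB [OF w0 order_refl that])
  have sol: "caratheodory_solution CL w0 \<omega>"
    unfolding caratheodory_solution_def
  proof (intro conjI allI impI)
    show "\<omega> 0 = w0" by (simp add: \<omega>_def ps.flow_0 [OF w0])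
    show "abs_continuous_on 0 T \<omega>" for T
      using ps.flow_lipschitz [OF w0] M(1) by (intro lipschitz_imp_abs_continuous_on [of _ _ _ M]) (auto simp: \<omega>_def)
    obtain N where N: "countable N" "\<And>t. t > 0 \<Longrightarrow> t \<notin> N \<Longrightarrow> (\<omega> has_vector_derivative ps.speed (\<omega> t)) (at t)"
      using ps.flow_derivative [OF w0] unfolding \<omega>_def by blast
    have "insert 0 N \<in> null_sets lebesgue"
      using N(1) by (intro null_sets_completionI countable_imp_null_set_lborel) simp
    then show "AE t in lebesgue. 0 \<le> t \<longrightarrow> (\<omega> has_vector_derivative CL (\<omega> t)) (at t within {0..})"
    proof (rule AE_I')
      show "{t \<in> space lebesgue. \<not> (0 \<le> t \<longrightarrow> (\<omega> has_vector_derivative CL (\<omega> t)) (at t within {0..}))} \<subseteq> insert 0 N"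
        using N(2) speed [OF \<omega>_in \<omega>B] by (force intro: has_vector_derivative_at_within)
    qed
  qed

  \<comment> \<open>The omega limit set, written as an intersection of closures so that every closed
    condition eventually valid on the trajectory holds on it.\<close>
  define \<Lambda> where "\<Lambda> = (\<Inter>T\<in>{0..}. closure (\<omega> ` {T..}))"
  have \<Lambda>_closed: "closed \<Lambda>" unfolding \<Lambda>_def by (intro closed_INT ballI closed_closure)
  have \<Lambda>D: "p \<in> closure (\<omega> ` {T..})" if "p \<in> \<Lambda>" "T \<ge> 0" for p T using that by (simp add: \<Lambda>_def)
  have \<Lambda>_minimal: "p \<in> C" if "p \<in> \<Lambda>" "T \<ge> 0" "closed C" "\<And>t. t \<ge> T \<Longrightarrow> \<omega> t \<in> C" for p T C
  proof -
    have "closure (\<omega> ` {T..}) \<subseteq> C" using that(3,4) by (intro closure_minimal) auto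
    then show ?thesis using \<Lambda>D [OF that(1,2)] by blast
  qed
  have \<Lambda>_state: "p \<in> state_set" if "p \<in> \<Lambda>" for p
    by (rule \<Lambda>_minimal [OF that order_refl closed_state_set \<omega>_in])
  have "\<Lambda> \<subseteq> B" using \<Lambda>_minimal [OF _ order_refl B(1) \<omega>B] by blast
  then have \<Lambda>_compact: "compact \<Lambda>"
    using \<Lambda>_closed B(3) bounded_subset compact_eq_bounded_closed by blast
  have \<Lambda>_ne: "\<Lambda> \<noteq> {}"
  proof -
    have "compact B" by (simp add: B_def)
    moreover have "\<forall>n. \<omega> (real n) \<in> B" using \<omega>B by simp
    ultimately obtain p r where p: "strict_mono (r :: nat \<Rightarrow> nat)" "((\<lambda>n. \<omega> (real n)) \<circ> r) \<longlonglongrightarrow> p"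
      unfolding compact_def by (metis (no_types, lifting))
    have "p \<in> closure (\<omega> ` {T..})" for T
    proof (rule Lim_in_closed_set [OF closed_closure _ sequentially_bot p(2)])
      obtain n0 where n0: "T \<le> real n0" using real_arch_simple by blast
      show "eventually (\<lambda>n. ((\<lambda>n. \<omega> (real n)) \<circ> r) n \<in> closure (\<omega> ` {T..})) sequentially"
        using eventually_ge_at_top [of n0]
      proof eventually_elim
        case (elim n)
        have "T \<le> real (r n)" using n0 elim seq_suble [OF p(1), of n] by linarith
        then show ?case using closure_subset by (auto intro!: subsetD [OF closure_subset])
      qed
    qed
    then show ?thesis by (auto simp: \<Lambda>_def)
  qed
  have closed_lyap: "closed {w. lyap v w \<le> a}" "closed {w. a \<le> lyap v w}" for v a
    by (intro closed_Collect_le continuous_on_lyap continuous_on_const)+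
  have \<Lambda>_le: "lyap e0 p \<le> lyap e0 (\<omega> t)" if "p \<in> \<Lambda>" "t \<ge> 0" for p t
  proof -
    have "p \<in> {w. lyap e0 w \<le> lyap e0 (\<omega> t)}"
    proof (rule \<Lambda>_minimal [OF that closed_lyap(1)])
      fix s assume "s \<ge> t"
      then show "\<omega> s \<in> {w. lyap e0 w \<le> lyap e0 (\<omega> t)}"
        using antimono [OF w0 order_refl e0_def _ _ that(2), of s] e by (simp add: \<omega>_def e0_def)
    qed
    then show ?thesis by simp
  qed
  have \<Lambda>_const: "lyap e0 p \<le> lyap e0 q" if "p \<in> \<Lambda>" "q \<in> \<Lambda>" for p q
  proof -
    have "q \<in> {w. lyap e0 p \<le> lyap e0 w}"
      by (rule \<Lambda>_minimal [OF that(2) order_refl closed_lyap(2)]) (use \<Lambda>_le [OF that(1)] in simp)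
    then show ?thesis by simp
  qed
  \<comment> \<open>A state of the trajectory close to \<open>p\<close> is followed for time \<tau>;
    stability keeps it close to the flow of \<open>p\<close>, and it is a later state of the same
    trajectory.\<close>
  have \<Lambda>_invariant: "ps.flow p \<tau> \<in> \<Lambda>" if p: "p \<in> \<Lambda>" and \<tau>: "\<tau> \<ge> 0" for p \<tau>
    unfolding \<Lambda>_def
  proof (intro INT_I)
    fix T :: real assume T: "T \<in> {0..}"
    show "ps.flow p \<tau> \<in> closure (\<omega> ` {T..})"
      unfolding closure_approachable
    proof (intro allI impI)
      fix \<epsilon> :: real assume \<epsilon>: "\<epsilon> > 0"
      have "\<epsilon> / exp (L * \<tau>) > 0" using \<epsilon> by simp
      then obtain t where t: "t \<ge> T" "dist (\<omega> t) p < \<epsilon> / exp (L * \<tau>)"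
        using \<Lambda>D [OF p, of T] T unfolding closure_approachable by fastforce
      have t0: "t \<ge> 0" using t T by simp
      have "norm (ps.flow (\<omega> t) \<tau> - ps.flow p \<tau>) \<le> exp (L * \<tau>) * norm (\<omega> t - p)"
        by (rule ps.flow_stability [OF \<omega>_in [OF t0] \<Lambda>_state [OF p] \<tau>])
      also have "\<dots> < \<epsilon>" using t(2) by (simp add: dist_norm field_simps)
      also have "ps.flow (\<omega> t) \<tau> = \<omega> (t + \<tau>)" unfolding \<omega>_def by (rule ps.flow_flow [OF w0 t0 \<tau>])
      finally show "\<exists>y\<in>\<omega> ` {T..}. dist y (ps.flow p \<tau>) < \<epsilon>"
        using t(1) \<tau> by (auto simp: dist_norm intro!: bexI [of _ "\<omega> (t + \<tau>)"])
    qed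
  qed
  have \<Lambda>_derivative: "(ps.flow p has_vector_derivative CL p) (at_right 0)" if "p \<in> \<Lambda>" for p
    using ps.flow_right_derivative [OF \<Lambda>_state [OF that], of 0] speed [OF \<Lambda>_state [OF that]] \<open>\<Lambda> \<subseteq> B\<close> that
    by (auto simp: ps.flow_0 [OF \<Lambda>_state [OF that]])
  \<comment> \<open>By invariance the Lyapunov function is constant along the flow from
    \<open>p\<close>, so its right derivative at time 0 vanishes: the case of equality in
    \<open>lyap_decrease\<close>.\<close>
  have \<Lambda>_form: "fst p = replicate_vec x \<and> snd (snd p) = replicate_vec (mean (snd (snd p)))" if p: "p \<in> \<Lambda>" for p
  proof -
    note p0 = ps.flow_0 [OF \<Lambda>_state [OF p]]
    have "((\<lambda>t. lyap e0 (ps.flow p t)) has_vector_derivative 2 * (CL p \<bullet> metric (p - e0))) (at_right 0)"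
      using lyap_has_vector_derivative [OF \<Lambda>_derivative [OF p], of e0] by (simp add: p0)
    then have "2 * (CL p \<bullet> metric (p - e0)) = 0"
    proof (rule has_vector_derivative_const_right)
      fix t :: real assume "t \<ge> 0"
      then show "lyap e0 (ps.flow p t) = lyap e0 (ps.flow p 0)"
        unfolding p0 using \<Lambda>_const \<Lambda>_invariant [OF p] p by (intro antisym) auto
    qed
    then show ?thesis
      using lyap_decrease(2) [OF e, of "fst p" "fst (snd p)" "snd (snd p)"] \<Lambda>_state [OF p] by (simp add: e0_def)
  qed

  \<comment> \<open>On \<Lambda> the multipliers agree, so the Laplacian of l vanishes, z is
    stationary to first order, and l follows the projected gradient of the linear function with
    coefficient \<open>sg x - z\<close>. \<Phi> is the value of that function.\<close>
  define \<Phi> where "\<Phi> p = (sg x - fst (snd p)) \<bullet> snd (snd p)" for p :: "('n, 'i, 'm) state"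
  have "continuous_on \<Lambda> \<Phi>" unfolding \<Phi>_def [abs_def] by (intro continuous_intros)
  then obtain p where p: "p \<in> \<Lambda>" "\<And>q. q \<in> \<Lambda> \<Longrightarrow> \<Phi> q \<le> \<Phi> p"
    using continuous_attains_sup [OF \<Lambda>_compact \<Lambda>_ne] by blast
  have pS: "p \<in> state_set" by (rule \<Lambda>_state [OF p(1)])
  note p0 = ps.flow_0 [OF pS]
  obtain bx z l where p_eq: "p = (bx, z, l)" by (metis prod_cases3)
  have form: "bx = replicate_vec x" "l = replicate_vec (mean l)" using \<Lambda>_form [OF p(1)] by (auto simp: p_eq)
  obtain v1 v2 v3 where v: "CL p = (v1, v2, v3)" by (metis prod_cases3)
  have fst_snd_p: "fst (snd p) = z" by (simp add: p_eq)
  have v2: "v2 = 0"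
  proof -
    have "v2 = SL l" using v by (simp add: p_eq closed_loop_eq_field)
    then show ?thesis using form(2) by (metis stacked_laplacian_replicate_vec)
  qed
  have "(ps.flow p has_vector_derivative (v1, v2, v3)) (at_right 0)" using \<Lambda>_derivative [OF p(1)] by (simp add: v)
  from bounded_linear.has_vector_derivative [OF bounded_linear_fst this]
    bounded_linear.has_vector_derivative [OF bounded_linear_fst_comp [OF bounded_linear_snd] this]
    bounded_linear.has_vector_derivative [OF bounded_linear_snd_comp [OF bounded_linear_snd] this]
  have d: "((\<lambda>t. fst (ps.flow p t)) has_vector_derivative v1) (at_right 0)"
    "((\<lambda>t. fst (snd (ps.flow p t))) has_vector_derivative v2) (at_right 0)"
    "((\<lambda>t. snd (snd (ps.flow p t))) has_vector_derivative v3) (at_right 0)" by simp_all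
  have v1: "v1 = 0"
    using d(1) by (rule has_vector_derivative_const_right) (use \<Lambda>_form [OF \<Lambda>_invariant [OF p(1)]] in simp)
  define h where "h = sg x - z"
  have h: "h = snd (snd (field p))"
    using form by (simp add: p_eq field_def h_def) (metis stacked_laplacian_replicate_vec)
  have v3: "v3 = proj_vec S3 l h" using v h by (simp add: p_eq closed_loop_eq_field)
  have "h \<bullet> v3 = (norm v3)\<^sup>2"
    unfolding v3 using pS by (intro inner_proj_vec convex_nonneg_orthant) (simp add: p_eq)
  \<comment> \<open>\<Phi> cannot grow from its maximizer within the invariant set, while its right
    derivative is the square of the norm of \<open>v3\<close>.\<close>
  moreover have "h \<bullet> v3 \<le> 0"
  proof -
    have "((\<lambda>t. \<Phi> (ps.flow p t)) has_vector_derivative h \<bullet> v3) (at_right 0)"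
      using bounded_bilinear.has_vector_derivative [OF bounded_bilinear_inner
          has_vector_derivative_diff [OF has_vector_derivative_const [of "sg x"] d(2)] d(3)]
      by (simp add: \<Phi>_def p0 h_def v2 fst_snd_p)
    then have "((\<lambda>t. (1 / (t - 0)) *\<^sub>R (\<Phi> (ps.flow p t) - \<Phi> (ps.flow p 0))) \<longlongrightarrow> h \<bullet> v3) (at_right 0)"
      unfolding has_vector_derivative_iff_quotient .
    moreover have "eventually (\<lambda>t. (1 / (t - 0)) *\<^sub>R (\<Phi> (ps.flow p t) - \<Phi> (ps.flow p 0)) \<le> 0) (at_right 0)"
      using eventually_at_right_less
    proof eventually_elim
      case (elim t)
      then have "\<Phi> (ps.flow p t) \<le> \<Phi> p" by (intro p(2) \<Lambda>_invariant [OF p(1)]) simp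
      with elim show ?case by (simp add: p0 divide_le_0_iff)
    qed
    ultimately show ?thesis by (rule tendsto_upperbound) simp
  qed
  ultimately have "v3 = 0" by simp
  then have CLp: "CL p = 0" using v v1 v2 by (simp add: zero_prod_def)

  \<comment> \<open>A single time at which the trajectory is near \<open>p\<close> suffices: the
    Lyapunov function centered at \<open>p\<close> is small there and never increases again.\<close>
  have lim: "(\<omega> \<longlongrightarrow> p) at_top"
  proof (rule tendstoI)
    fix \<epsilon> :: real assume \<epsilon>: "\<epsilon> > 0"
    have "k * \<epsilon>\<^sup>2 > 0" using k \<epsilon> by simp
    moreover have "isCont (lyap p) p"
      using continuous_on_lyap [of UNIV p] by (metis UNIV_I continuous_on_eq_continuous_at open_UNIV)
    ultimately obtain \<delta> where \<delta>: "\<delta> > 0" "\<And>w. dist w p < \<delta> \<Longrightarrow> dist (lyap p w) (lyap p p) < k * \<epsilon>\<^sup>2"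
      unfolding continuous_at_eps_delta by blast
    obtain T where T: "T \<ge> 0" "dist (\<omega> T) p < \<delta>"
      using \<Lambda>D [OF p(1), of 0] \<delta>(1) unfolding closure_approachable by fastforce
    have "lyap p (\<omega> T) < k * \<epsilon>\<^sup>2" using \<delta>(2) [OF T(2)] by (simp add: dist_real_def)
    have "dist (\<omega> t) p < \<epsilon>" if t: "t \<ge> T" for t
    proof -
      have "lyap p (\<omega> t) \<le> lyap p (\<omega> T)"
        unfolding \<omega>_def
        by (rule antimono [OF w0 order_refl _ pS CLp T(1) t, of x z "mean l"]) (simp add: p_eq flip: form)
      then have "k * (norm (\<omega> t - p))\<^sup>2 < k * \<epsilon>\<^sup>2"
        using lower [of "\<omega> t" p] \<open>lyap p (\<omega> T) < k * \<epsilon>\<^sup>2\<close> by linarith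
      then have "(norm (\<omega> t - p))\<^sup>2 < \<epsilon>\<^sup>2" using k by simp
      then show ?thesis using \<epsilon> by (simp add: dist_norm power_less_imp_less_base)
    qed
    then show "eventually (\<lambda>t. dist (\<omega> t) p < \<epsilon>) at_top"
      by (rule eventually_at_top_linorderI)
  qed
  have "p = (replicate_vec x, z, replicate_vec (mean l))" by (simp add: p_eq flip: form)
  with sol \<omega>_in lim pS CLp show ?thesis by metis
qed

end

theorem theorem2:
  fixes own :: "'n::finite \<Rightarrow> 'i::finite"
    and \<Omega> :: "'i \<Rightarrow> (real^'n) set"
    and g :: "'i \<Rightarrow> real^'n \<Rightarrow> real^'m::finite"
    and J :: "'i \<Rightarrow> real^'n \<Rightarrow> real"
    and E :: "('i \<times> 'i) set"
    and \<mu> \<theta>\<^sub>0 \<theta> c :: real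
    and w0 :: "(real^'n^'i) \<times> (real^'m^'i) \<times> (real^'m^'i)"
  assumes Omega: "\<And>i. \<Omega> i \<subseteq> agent_space own i" "\<And>i. closed (\<Omega> i)" "\<And>i. convex (\<Omega> i)"
    and g_convex: "\<And>i k. convex_on (agent_space own i) (\<lambda>u. g i u $ k)"
    and g_C2: "\<And>i. C2_fun (\<lambda>x. g i (blk own i x))"
    and slater: "slater own \<Omega> g"
    and J_C1: "\<And>i. C1_fun (J i)"
    and J_convex: "\<And>i x. convex_on (agent_space own i) (\<lambda>u. J i (subst_blk own i u x))"
    and strongly_monotone: "\<mu> > 0" "strongly_monotone \<mu> (pseudo_gradient own J)"
    and lipschitz: "\<theta>\<^sub>0 > 0" "\<theta>\<^sub>0-lipschitz_on UNIV (pseudo_gradient own J)"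
    and graph: "sym E" "graph_connected E"
    and theta: "\<theta> \<in> {\<mu>..\<theta>\<^sub>0}" "\<theta>-lipschitz_on UNIV (ext_pseudo_gradient own J)"
    and gain: "c > ((\<theta>\<^sub>0 + \<theta>)\<^sup>2 + 4 * \<mu> * \<theta>) / (4 * \<mu> * lambda2 (laplacian E))"
    and init: "w0 \<in> stacked_set own \<Omega> \<times> consensus_perp \<times> nonneg_orthant"
  shows "\<exists>\<omega>. caratheodory_solution (closed_loop own \<Omega> g J E c) w0 \<omega> \<and>
           (\<forall>\<psi>. caratheodory_solution (closed_loop own \<Omega> g J E c) w0 \<psi> \<longrightarrow>
              (\<forall>t\<ge>0. \<psi> t = \<omega> t)) \<and>
           (\<forall>t\<ge>0. \<omega> t \<in> stacked_set own \<Omega> \<times> consensus_perp \<times> nonneg_orthant) \<and>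
           (\<exists>x z l.
              (\<omega> \<longlongrightarrow> (replicate_vec x, z, replicate_vec l)) at_top \<and>
              closed_loop own \<Omega> g J E c (replicate_vec x, z, replicate_vec l) = 0 \<and>
              KKT own \<Omega> g J x l \<and>
              is_vGNE own \<Omega> g J x \<and>
              (\<forall>y. is_vGNE own \<Omega> g J y \<longrightarrow> y = x))"
proof -
  interpret gne_game own \<Omega> g J E \<mu> \<theta>\<^sub>0 \<theta> c
    by unfold_locales (fact assms)+
  obtain P :: "real^'m^'i \<Rightarrow> real^'m^'i" and \<kappa>
    where P: "linear P" "\<And>u w. P u \<bullet> w = u \<bullet> P w" "\<And>v. P (stacked_laplacian E v) = v - replicate_vec (mean v)"
      "\<kappa> > 0" "\<And>u. P u \<bullet> u \<ge> \<kappa> * (norm u)\<^sup>2"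
    using stacked_laplacian_inverse [OF graph] by blast
  interpret gne_lyapunov own \<Omega> g J E \<mu> \<theta>\<^sub>0 \<theta> c P \<kappa>
    by (intro gne_lyapunov.intro gne_lyapunov_axioms.intro gne_game_axioms P)
  obtain \<omega> x z l where *: "caratheodory_solution CL w0 \<omega> \<and> (\<forall>t\<ge>0. \<omega> t \<in> state_set) \<and>
    (\<omega> \<longlongrightarrow> (replicate_vec x, z, replicate_vec l)) at_top \<and>
    (replicate_vec x, z, replicate_vec l) \<in> state_set \<and> CL (replicate_vec x, z, replicate_vec l) = 0"
    using solution_exists_converges [OF init] by blast
  then have sol: "caratheodory_solution CL w0 \<omega>" and K: "KKT own \<Omega> g J x l"
    using equilibrium_imp_KKT [of x z l] by blast+
  show ?thesis
  proof (intro exI [of _ \<omega>] exI [of _ x] exI [of _ z] exI [of _ l] conjI allI impI)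
    show "\<psi> t = \<omega> t" if "caratheodory_solution CL w0 \<psi>" "0 \<le> t" for \<psi> t
      by (rule solution_unique [OF that(1) sol init that(2)])
    show "y = x" if "is_vGNE own \<Omega> g J y" for y by (rule vGNE_unique [OF K that])
    show "is_vGNE own \<Omega> g J x" by (rule KKT_imp_vGNE [OF K])
  qed (use * K in simp_all)
qed

end
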